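(* For each $n$ let $d=d(n)\in\mathbb{N}$ with $d<n^{1/2}$, $N=N(n)=\binom{n}{d}$, $p=p(n)\in\mathbb{N}$, and suppose $\gamma_n=\frac{N}{p}\to\gamma$ as $n\to\infty$ for some $\gamma\in(0,\infty)$. Let $x_1=x(n)$ be a real random variable (whose law may depend on $n$) such that $$x_1\overset{d}{=}-x_1,\qquad \mathbb{E}[x_1^2]=1,\qquad \mathbb{E}[x_1^{2k}]\le (Ck)^k\ \ (k\in\mathbb{N}),\qquad \lim_{n\to\infty}\frac{\log C}{\log\frac{n^{1/2}}{d}}=0$$ for some $C=C(n)\ge 2$. Let $Z=Z(n)\in\mathbb{R}^{N\times p}$ be a random matrix with i.i.d. columns, each equal in distribution to the random tensor product vector $Z_0\in\mathbb{R}^{N}$ of order $d$ built from i.i.d. copies $x_1,\dots,x_n$ of $x_1$ (defined in the context). Then the empirical spectral distribution of $S=\frac1p ZZ^T\in\mathbb{R}^{N\times N}$ converges weakly, as $n\to\infty$, to the Marchenko-Pastur law $F_\gamma$ (defined in the context), almost surely.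
   Context: $\mathbb{N}=\{1,2,\dots\}$. Random tensor product vector: given i.i.d. $x_1,\dots,x_n$ with $\mathbb{E}[x_1]=0$, $\mathbb{E}[x_1^2]=1$, the vector $Z_0\in\mathbb{R}^{\binom nd}$ has entries $Z_{0,i_1,\dots,i_d}=x_{i_1}x_{i_2}\cdots x_{i_d}$, $1\le i_1<i_2<\dots<i_d\le n$, where the index tuples are identified with $\{1,\dots,\binom nd\}$ via a fixed bijection. Empirical spectral distribution: for a symmetric $A\in\mathbb{R}^{r\times r}$ with eigenvalues $\lambda_1(A)\ge\dots\ge\lambda_r(A)$, $F_A(x)=\frac1r|\{1\le j\le r:\lambda_j(A)\le x\}|$. Marchenko-Pastur law with parameter $\gamma\in(0,\infty)$: the distribution function $$F_\gamma(x)=\Big(1-\frac1\gamma\Big)\mathbf{1}_{\{x\ge 0,\ \gamma>1\}}+\int_{-\infty}^x p_\gamma(y)\,dy,$$ where $p_\gamma(y)=\frac{\sqrt{((1+\sqrt\gamma)^2-y)(y-(1-\sqrt\gamma)^2)}}{2\pi\gamma y}$ for $y\in[(1-\sqrt\gamma)^2,(1+\sqrt\gamma)^2]$ and $p_\gamma(y)=0$ otherwise. The matrices $Z(n)$ are defined on a common probability space; "almost surely" means that with probability one the (random) empirical spectral distributions converge weakly. *)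

theory Defs
  imports "HOL-Probability.Probability" "Jordan_Normal_Form.Char_Poly"
begin

definition increasing_tuples :: "nat \<Rightarrow> nat \<Rightarrow> nat list set" where
  "increasing_tuples n d = {is. length is = d \<and> sorted_wrt (<) is \<and> set is \<subseteq> {1..n}}"

text \<open>
  The coordinates \<open>k < N\<close> of the tensor product vector are labelled by index tuples through the
  enumeration \<open>e\<close>.  A vector is an extensional function on \<open>{..<N}\<close>, that is, a point of
  \<open>PiM {..<N} (\<lambda>_. borel)\<close>.
\<close>

definition tensor_vector ::
  "nat \<Rightarrow> (nat \<Rightarrow> nat list) \<Rightarrow> (nat \<Rightarrow> 'b \<Rightarrow> real) \<Rightarrow> 'b \<Rightarrow> nat \<Rightarrow> real" where
  "tensor_vector N e x \<omega> = (\<lambda>k\<in>{..<N}. \<Prod>i\<leftarrow>e k. x i \<omega>)"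

definition col_fun :: "nat \<Rightarrow> real mat \<Rightarrow> nat \<Rightarrow> nat \<Rightarrow> real" where
  "col_fun N A j = (\<lambda>k\<in>{..<N}. A $$ (k, j))"

text \<open>
  Used only for symmetric \<open>A\<close>, where all roots of the characteristic polynomial are real, so that
  \<open>proots (char_poly A)\<close> is the multiset of all \<open>dim_row A\<close> eigenvalues.
\<close>

definition esd :: "real mat \<Rightarrow> real \<Rightarrow> real" where
  "esd A x = real (size {#l \<in># proots (char_poly A). l \<le> x#}) / real (dim_row A)"

text \<open>
  For \<open>\<gamma> = 1\<close> the left endpoint of the support is \<open>0\<close>, where the formula divides by zero and takes
  the value \<open>0\<close>; this is a null set for the integral below.
\<close>

definition mp_density :: "real \<Rightarrow> real \<Rightarrow> real" where
  "mp_density \<gamma> y =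
    (if y \<in> {(1 - sqrt \<gamma>)\<^sup>2..(1 + sqrt \<gamma>)\<^sup>2}
     then sqrt (((1 + sqrt \<gamma>)\<^sup>2 - y) * (y - (1 - sqrt \<gamma>)\<^sup>2)) / (2 * pi * \<gamma> * y)
     else 0)"

definition mp_cdf :: "real \<Rightarrow> real \<Rightarrow> real" where
  "mp_cdf \<gamma> x =
    (1 - 1 / \<gamma>) * (if 0 \<le> x \<and> 1 < \<gamma> then 1 else 0) + (LBINT y:{..x}. mp_density \<gamma> y)"

end

theory Submission
  imports Defs "Jordan_Normal_Form.Schur_Decomposition"
begin

text \<open>
  Write \<open>S = (1/p) Z Z\<^sup>T\<close> and, for \<open>t > 0\<close>, let \<open>R = (S + t)\<^sup>-\<^sup>1\<close>.  Since \<open>S\<close> is positive semidefinite,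
  its spectral distribution is governed by the real numbers \<open>(1/N) tr R = (1/N) \<Sum> 1/(\<lambda>\<^sub>j + t)\<close>,
  the Stieltjes transform at \<open>-t\<close>.  It suffices to show that they converge almost surely to the
  transform of the Marchenko-Pastur law for countably many \<open>t\<close> that accumulate at a positive point.

  The transform of the law is computed from an explicit antiderivative.  In the other direction, the
  functions \<open>1/(\<lambda> + t)\<close> generate, by partial fractions and uniform limits, all powers of
  \<open>u = 1/(\<lambda> + 1)\<close>, and the Weierstrass theorem on \<open>0 \<le> u \<le> 1\<close> yields enough continuous test functions
  to squeeze the distribution functions at continuity points
  (\<open>stieltjes_convergence_imp_cdf_convergence\<close>).

  Changing one column of \<open>Z\<close> is a perturbation of \<open>S\<close> of rank at most two and moves \<open>tr R\<close> by at most
  \<open>1/t\<close>.  The columns are independent, so the bounded differences inequality shows that \<open>(1/N) tr R\<close>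
  is within any \<open>\<epsilon>\<close> of its mean \<open>m\<close> up to a probability that is exponentially small in \<open>N \<ge> n\<close>
  (\<open>stieltjes_concentration\<close>).  This is summable in \<open>n\<close>, so that the Borel-Cantelli lemma applies
  whatever the joint law of the matrices for different \<open>n\<close> is.

  For the mean, take traces in \<open>(S + t) R = 1\<close>: this gives \<open>N = t tr R + \<Sum>\<^sub>j q\<^sub>j/(1 + q\<^sub>j)\<close>, where
  \<open>q\<^sub>j = (1/p) z\<^sub>j\<^sup>T R\<^sub>j z\<^sub>j\<close> and \<open>R\<^sub>j\<close> is the resolvent without the column \<open>z\<^sub>j\<close>, hence independent of
  \<open>z\<^sub>j\<close>.  If \<open>q\<^sub>j\<close> may be replaced by \<open>(1/p) tr R\<^sub>j\<close>, and this by \<open>\<gamma> m\<close>, then \<open>m\<close> satisfies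
  \<open>\<gamma> (1 - t m) = \<gamma> m/(1 + \<gamma> m)\<close> in the limit.  This quadratic equation has a single positive root,
  the Marchenko-Pastur transform (\<open>expected_stieltjes_equation\<close>, \<open>approximate_root_converges\<close>).

  The replacement of \<open>q\<^sub>j\<close> is where the tensor structure enters.  For a fixed matrix \<open>A\<close> the variance of
  \<open>Z\<^sub>0\<^sup>T A Z\<^sub>0\<close> is a double sum of \<open>A\<^sub>I\<^sub>J A\<^sub>K\<^sub>L\<close> weighted by the covariances of \<open>x\<^sub>I x\<^sub>J\<close> and \<open>x\<^sub>K x\<^sub>L\<close>.  By
  symmetry of the entries these covariances are non-negative and vanish unless \<open>I\<close> and \<open>J\<close> differ in
  the same indices as \<open>K\<close> and \<open>L\<close>; so a Schur test bounds the variance by the largest row sum times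
  \<open>\<Sum> A\<^sub>I\<^sub>J\<^sup>2\<close>.  With \<open>\<mu> = E[x\<^sub>1\<^sup>4]\<close>, a count of \<open>d\<close>-subsets bounds the row sums by
  \<open>N (exp(\<mu> d\<^sup>2/n) (1 + 2 d\<^sup>2/n) - 1)\<close>, which is \<open>o(N)\<close> as \<open>\<mu> \<le> 4 C\<^sup>2\<close> and
  \<open>C d/\<surd>n \<rightarrow> 0\<close> (\<open>moment4_row_sum\<close>, \<open>tensor_law_quadratic_form\<close>, \<open>log_ratio_growth\<close>).
\<close>

section \<open>Weighted counts of subsets of fixed size\<close>

text \<open>
  The ratio of the two binomial coefficients is a product of \<open>v\<close> factors \<open>(d - i)/(n - i)\<close>, each at
  most \<open>d/n\<close>.
\<close>

lemma binomial_diagonal_ratio_bound: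
  fixes n d v :: nat
  assumes "v \<le> d" "d \<le> n" "n \<ge> 1"
  shows "real ((n - v) choose (d - v)) \<le> (real d / real n) ^ v * real (n choose d)"
  using assms(1)
proof (induction v)
  case 0
  show ?case by simp
next
  case (Suc v)
  have "(d - v) * ((n - v) choose (d - v)) = (n - v) * ((n - v - 1) choose (d - v - 1))"
    using Suc.prems assms by (intro times_binomial_minus1_eq) auto
  hence "real (d - v) * real ((n - v) choose (d - v)) = real (n - v) * real ((n - Suc v) choose (d - Suc v))"
    unfolding of_nat_mult[symmetric] by simp
  moreover have pos: "real (n - v) > 0" using Suc.prems assms by auto
  ultimately have "real ((n - Suc v) choose (d - Suc v)) = real (d - v) / real (n - v) * real ((n - v) choose (d - v))"
    by (simp add: field_simps)
  also have "\<dots> \<le> (real d / real n) * ((real d / real n) ^ v * real (n choose d))"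
  proof (intro mult_mono)
    have "real v * real d \<le> real v * real n" using assms by (intro mult_left_mono) auto
    thus "real (d - v) / real (n - v) \<le> real d / real n"
      using pos Suc.prems assms by (simp add: field_simps of_nat_diff)
  qed (use Suc in auto)
  finally show ?case by simp
qed

text \<open>
  For a uniformly random \<open>d\<close>-subset \<open>K\<close> the bound is what independent events \<open>i \<in> K\<close> of probability
  \<open>d/n\<close> would give.  The forced part \<open>V\<close> makes the induction on \<open>T\<close> work: a new element \<open>i\<close> multiplies
  the weight of \<open>K\<close> by \<open>m\<close> if \<open>i \<in> K\<close> and by \<open>1\<close> otherwise, so the sum splits into the sum over
  the same sets and \<open>m - 1\<close> times the sum over those that also contain \<open>i\<close>.
\<close>

lemma sum_subsets_weighted_le:
  fixes m :: real
  assumes "finite A" "A \<noteq> {}" "d \<le> card A" "V \<subseteq> A" "T \<subseteq> A" "V \<inter> T = {}" "m \<ge> 1"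
  shows "(\<Sum>K | K \<subseteq> A \<and> card K = d \<and> V \<subseteq> K. m ^ card (T \<inter> K))
    \<le> real (card A choose d) * (real d / real (card A)) ^ card V
        * (1 + (m - 1) * real d / real (card A)) ^ card T"
proof -
  have n1: "card A \<ge> 1" using assms by (simp add: Suc_leI card_gt_0_iff)
  have fin: "finite {K. K \<subseteq> A \<and> P K}" for P using assms(1) by auto
  have "finite T" using assms finite_subset by blast
  thus ?thesis using assms(4-6)
  proof (induction T arbitrary: V rule: finite_induct)
    case empty
    have finV: "finite V" using empty(1) assms(1) by (rule finite_subset)
    show ?case
    proof (cases "card V \<le> d")
      case True
      have "card {K. K \<subseteq> A \<and> card K = d \<and> V \<subseteq> K} = card {L. L \<subseteq> A - V \<and> card L = d - card V}"
      proof (rule bij_betw_same_card[where f = "\<lambda>K. K - V"],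
             rule bij_betw_byWitness[where f' = "\<lambda>L. L \<union> V"])
        show "(\<lambda>L. L \<union> V) ` {L. L \<subseteq> A - V \<and> card L = d - card V} \<subseteq> {K. K \<subseteq> A \<and> card K = d \<and> V \<subseteq> K}"
        proof safe
          fix L assume L: "L \<subseteq> A - V" "card L = d - card V"
          have "finite L" using L assms(1) finite_subset by blast
          moreover have "L \<inter> V = {}" using L by auto
          ultimately show "card (L \<union> V) = d" using finV L True by (simp add: card_Un_disjoint)
        qed (use empty in auto)
        show "(\<lambda>K. K - V) ` {K. K \<subseteq> A \<and> card K = d \<and> V \<subseteq> K} \<subseteq> {L. L \<subseteq> A - V \<and> card L = d - card V}"
          using finV by (auto simp: card_Diff_subset)
      qed auto
      also have "\<dots> = (card A - card V) choose (d - card V)"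
        using assms(1) finV empty by (subst n_subsets) (auto simp: card_Diff_subset)
      finally show ?thesis
        using binomial_diagonal_ratio_bound[OF True assms(3) n1] by (simp add: mult.commute)
    next
      case False
      have "{K. K \<subseteq> A \<and> card K = d \<and> V \<subseteq> K} = {}"
        using False assms(1) by (auto dest: card_mono[rotated] finite_subset)
      thus ?thesis using assms(7) by (simp only: sum.empty) simp
    qed
  next
    case (insert i T)
    let ?F = "\<lambda>V. {K. K \<subseteq> A \<and> card K = d \<and> V \<subseteq> K}"
    let ?B = "\<lambda>v. real (card A choose d) * (real d / real (card A)) ^ v
        * (1 + (m - 1) * real d / real (card A)) ^ card T"
    have i: "i \<notin> V" "i \<in> A" using insert.prems by auto
    have finV: "finite V" using insert.prems(1) assms(1) by (rule finite_subset)
    have w: "m ^ card (insert i T \<inter> K) =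
        m ^ card (T \<inter> K) + (m - 1) * (if i \<in> K then m ^ card (T \<inter> K) else 0)" for K
      using insert.hyps by (auto simp: algebra_simps)
    have "(\<Sum>K\<in>?F V. m ^ card (insert i T \<inter> K))
        = (\<Sum>K\<in>?F V. m ^ card (T \<inter> K)) + (m - 1) * (\<Sum>K\<in>?F V. if i \<in> K then m ^ card (T \<inter> K) else 0)"
      by (simp add: w sum.distrib sum_distrib_left)
    also have "(\<Sum>K\<in>?F V. if i \<in> K then m ^ card (T \<inter> K) else 0) = (\<Sum>K\<in>?F (insert i V). m ^ card (T \<inter> K))"
      using fin by (intro sum.mono_neutral_cong_right) auto
    also have "(\<Sum>K\<in>?F V. m ^ card (T \<inter> K)) + (m - 1) * (\<Sum>K\<in>?F (insert i V). m ^ card (T \<inter> K))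
        \<le> ?B (card V) + (m - 1) * ?B (card (insert i V))"
      using insert assms(7) i by (intro add_mono mult_left_mono insert.IH) auto
    also have "\<dots> = real (card A choose d) * (real d / real (card A)) ^ card V
        * (1 + (m - 1) * real d / real (card A)) ^ card (insert i T)"
      using i finV insert.hyps by (simp add: algebra_simps)
    finally show ?case .
  qed
qed

section \<open>Variance of quadratic forms in products of independent variables\<close>

text \<open>
  Schur test for a covariance matrix \<open>W\<close> with non-negative entries: \<open>2 A\<^sub>p A\<^sub>r \<le> A\<^sub>p\<^sup>2 + A\<^sub>r\<^sup>2\<close>, and both
  resulting sums are controlled by the row sums because \<open>W\<close> is symmetric.
\<close>

lemma variance_linear_combination_le:
  fixes y :: "'p \<Rightarrow> 'b \<Rightarrow> real" and A :: "'p \<Rightarrow> real"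
  assumes P: "prob_space P" and I: "finite I"
    and i1: "\<And>p. p \<in> I \<Longrightarrow> integrable P (y p)"
    and i2: "\<And>p r. p \<in> I \<Longrightarrow> r \<in> I \<Longrightarrow> integrable P (\<lambda>\<omega>. y p \<omega> * y r \<omega>)"
    and \<tau>: "\<And>p. p \<in> I \<Longrightarrow> (\<integral>\<omega>. y p \<omega> \<partial>P) = \<tau> p"
    and W: "\<And>p r. p \<in> I \<Longrightarrow> r \<in> I \<Longrightarrow> W p r = (\<integral>\<omega>. y p \<omega> * y r \<omega> \<partial>P) - \<tau> p * \<tau> r"
    and W0: "\<And>p r. p \<in> I \<Longrightarrow> r \<in> I \<Longrightarrow> 0 \<le> W p r"
    and row: "\<And>p. p \<in> I \<Longrightarrow> (\<Sum>r\<in>I. W p r) \<le> \<rho>"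
  defines "q \<equiv> \<lambda>\<omega>. \<Sum>p\<in>I. A p * y p \<omega>"
  shows "integrable P (\<lambda>\<omega>. (q \<omega> - (\<Sum>p\<in>I. A p * \<tau> p))\<^sup>2)"
    and "(\<integral>\<omega>. (q \<omega> - (\<Sum>p\<in>I. A p * \<tau> p))\<^sup>2 \<partial>P) \<le> \<rho> * (\<Sum>p\<in>I. (A p)\<^sup>2)"
proof -
  interpret prob_space P by fact
  let ?u = "\<lambda>p \<omega>. y p \<omega> - \<tau> p"
  have uu: "?u p \<omega> * ?u r \<omega> = y p \<omega> * y r \<omega> - \<tau> r * y p \<omega> - \<tau> p * y r \<omega> + \<tau> p * \<tau> r" for p r \<omega>
    by (simp add: algebra_simps)
  have iu: "integrable P (\<lambda>\<omega>. ?u p \<omega> * ?u r \<omega>)" if "p \<in> I" "r \<in> I" for p r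
    unfolding uu using that i1 i2 by simp
  have eu: "(\<integral>\<omega>. ?u p \<omega> * ?u r \<omega> \<partial>P) = W p r" if "p \<in> I" "r \<in> I" for p r
    unfolding uu using that i1 i2 by (simp add: W \<tau> prob_space)
  have sq: "(q \<omega> - (\<Sum>p\<in>I. A p * \<tau> p))\<^sup>2 = (\<Sum>p\<in>I. \<Sum>r\<in>I. A p * A r * (?u p \<omega> * ?u r \<omega>))" for \<omega>
  proof -
    have "q \<omega> - (\<Sum>p\<in>I. A p * \<tau> p) = (\<Sum>p\<in>I. A p * ?u p \<omega>)"
      by (simp add: q_def sum_subtractf[symmetric] algebra_simps)
    thus ?thesis by (simp add: power2_eq_square sum_product mult_ac)
  qed
  show "integrable P (\<lambda>\<omega>. (q \<omega> - (\<Sum>p\<in>I. A p * \<tau> p))\<^sup>2)"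
    unfolding sq by (intro Bochner_Integration.integrable_sum integrable_mult_right iu)
  have "(\<integral>\<omega>. (q \<omega> - (\<Sum>p\<in>I. A p * \<tau> p))\<^sup>2 \<partial>P) = (\<Sum>p\<in>I. \<Sum>r\<in>I. A p * A r * W p r)"
    unfolding sq by (simp add: Bochner_Integration.integral_sum integrable_mult_right iu eu)
  also have "\<dots> \<le> (\<Sum>p\<in>I. \<Sum>r\<in>I. ((A p)\<^sup>2 / 2 + (A r)\<^sup>2 / 2) * W p r)"
  proof (intro sum_mono mult_right_mono W0)
    fix p r show "A p * A r \<le> (A p)\<^sup>2 / 2 + (A r)\<^sup>2 / 2"
      using sum_squares_bound[of "A p" "A r"] by simp
  qed
  also have "\<dots> = (\<Sum>p\<in>I. \<Sum>r\<in>I. (A p)\<^sup>2 / 2 * W p r) + (\<Sum>p\<in>I. \<Sum>r\<in>I. (A r)\<^sup>2 / 2 * W p r)"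
    by (simp only: distrib_right sum.distrib)
  also have "(\<Sum>p\<in>I. \<Sum>r\<in>I. (A r)\<^sup>2 / 2 * W p r) = (\<Sum>r\<in>I. \<Sum>p\<in>I. (A r)\<^sup>2 / 2 * W p r)"
    by (rule sum.swap)
  also have "\<dots> = (\<Sum>p\<in>I. \<Sum>r\<in>I. (A p)\<^sup>2 / 2 * W p r)"
    by (intro sum.cong refl) (simp add: W mult.commute)
  also have "(\<Sum>p\<in>I. \<Sum>r\<in>I. (A p)\<^sup>2 / 2 * W p r) + \<dots> = (\<Sum>p\<in>I. (A p)\<^sup>2 * (\<Sum>r\<in>I. W p r))"
  proof -
    have inner: "(\<Sum>r\<in>I. (A p)\<^sup>2 / 2 * W p r) = (A p)\<^sup>2 / 2 * (\<Sum>r\<in>I. W p r)" for p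
      by (simp only: sum_distrib_left)
    show ?thesis unfolding inner sum.distrib[symmetric] by (intro sum.cong refl) simp
  qed
  also have "\<dots> \<le> (\<Sum>p\<in>I. (A p)\<^sup>2 * \<rho>)"
    by (intro sum_mono mult_left_mono row) auto
  also have "\<dots> = \<rho> * (\<Sum>p\<in>I. (A p)\<^sup>2)"
    by (simp add: sum_distrib_left mult.commute)
  finally show "(\<integral>\<omega>. (q \<omega> - (\<Sum>p\<in>I. A p * \<tau> p))\<^sup>2 \<partial>P) \<le> \<rho> * (\<Sum>p\<in>I. (A p)\<^sup>2)" .
qed

text \<open>
  The moments of order at most four of a symmetric variable with unit variance and fourth moment \<open>m\<close>.
\<close>

definition standard_moment :: "real \<Rightarrow> nat \<Rightarrow> real" where
  "standard_moment m j = (if odd j then 0 else if j = 4 then m else 1)"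

definition mult4 :: "'i set \<Rightarrow> 'i set \<Rightarrow> 'i set \<Rightarrow> 'i set \<Rightarrow> 'i \<Rightarrow> nat" where
  "mult4 a b c d i = of_bool (i \<in> a) + of_bool (i \<in> b) + of_bool (i \<in> c) + of_bool (i \<in> d)"

text \<open>
  The expectation of \<open>x\<^sub>a x\<^sub>b x\<^sub>c x\<^sub>d\<close>, where \<open>x\<^sub>a\<close> is the product of the variables with index in the set \<open>a\<close>.
\<close>

definition moment4 :: "'i set \<Rightarrow> real \<Rightarrow> 'i set \<Rightarrow> 'i set \<Rightarrow> 'i set \<Rightarrow> 'i set \<Rightarrow> real" where
  "moment4 A m a b c d = (\<Prod>i\<in>A. standard_moment m (mult4 a b c d i))"

lemma prod_subset_as_powers:
  fixes f :: "'i \<Rightarrow> real"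
  assumes "finite A" "a \<subseteq> A"
  shows "(\<Prod>i\<in>a. f i) = (\<Prod>i\<in>A. f i ^ of_bool (i \<in> a))"
proof -
  have "(\<Prod>i\<in>A. f i ^ of_bool (i \<in> a)) = (\<Prod>i\<in>a. f i ^ of_bool (i \<in> a))"
    using assms by (intro prod.mono_neutral_right) auto
  thus ?thesis by simp
qed

lemma moment4_nonneg: "m \<ge> 1 \<Longrightarrow> moment4 A m a b c d \<ge> 0"
  by (auto simp: moment4_def standard_moment_def intro!: prod_nonneg)

text \<open>
  An index that lies in an odd number of the four sets contributes a vanishing odd moment.  If there
  is no such index, the factors different from \<open>1\<close> come from the indices common to all four sets.
\<close>

lemma moment4_eq:
  assumes "finite A" "a \<subseteq> A" "b \<subseteq> A" "c \<subseteq> A" "d \<subseteq> A"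
  shows "moment4 A m a b c d = (if sym_diff a b = sym_diff c d then m ^ card (a \<inter> b \<inter> c \<inter> d) else 0)"
proof (cases "sym_diff a b = sym_diff c d")
  case True
  have "standard_moment m (mult4 a b c d i) = (if i \<in> a \<inter> b \<inter> c \<inter> d then m else 1)" for i
    using True by (cases "i \<in> a"; cases "i \<in> b"; cases "i \<in> c"; cases "i \<in> d")
      (auto simp: standard_moment_def mult4_def)
  hence "moment4 A m a b c d = (\<Prod>i\<in>A. if i \<in> a \<inter> b \<inter> c \<inter> d then m else 1)"
    by (simp add: moment4_def)
  also have "\<dots> = (\<Prod>i\<in>a \<inter> b \<inter> c \<inter> d. m)"
    using assms by (intro prod.mono_neutral_cong_right) auto
  finally show ?thesis using True by simp
next
  case False
  then obtain i where "i \<in> sym_diff a b \<longleftrightarrow> i \<notin> sym_diff c d" by blast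
  hence "i \<in> A" "odd (mult4 a b c d i)"
    using assms by (auto simp: mult4_def)
  hence "moment4 A m a b c d = 0"
    unfolding moment4_def by (intro prod_zero[OF assms(1)] bexI[of _ i]) (auto simp: standard_moment_def)
  thus ?thesis using False by simp
qed

text \<open>
  Given \<open>a\<close> and \<open>b\<close>, a non-zero term determines \<open>e\<close> from \<open>c\<close>, since \<open>c\<close> and \<open>e\<close> must differ exactly in
  \<open>S = sym_diff a b\<close>.  So the row is a weighted count of \<open>d\<close>-sets \<open>c\<close> instead of pairs.  For \<open>a = b\<close> the subtraction
  of the product of the means leaves \<open>m ^ card (a \<inter> c) - 1\<close>, which is small on average as \<open>a\<close> and \<open>c\<close>
  rarely intersect.  For \<open>a \<noteq> b\<close> the sets \<open>c\<close> and \<open>e\<close> can have equal size only if \<open>c\<close> meets \<open>S\<close>, and a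
  random \<open>c\<close> does so with probability at most \<open>card S * d/n \<le> 2 d\<^sup>2/n\<close>.
\<close>

lemma moment4_row_sum:
  fixes m :: real
  assumes A: "finite A" "A \<noteq> {}" "d \<le> card A" and m: "m \<ge> 1"
    and ab: "a \<subseteq> A" "card a = d" "b \<subseteq> A" "card b = d"
  defines "F \<equiv> {K. K \<subseteq> A \<and> card K = d}" and "n \<equiv> real (card A)"
  shows "(\<Sum>c\<in>F. \<Sum>e\<in>F. moment4 A m a b c e - of_bool (a = b) * of_bool (c = e))
     \<le> real (card A choose d) * ((1 + (m - 1) * d / n) ^ d * (1 + 2 * real d ^ 2 / n) - 1)"
proof -
  have finF: "finite F" using A by (simp add: F_def)
  have cardF: "card F = card A choose d" unfolding F_def using n_subsets[OF A(1)] by simp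
  have fin: "finite K" if "K \<in> F" for K using that A finite_subset by (auto simp: F_def)
  have fab: "finite a" "finite b" using ab A finite_subset by auto
  have n0: "n > 0" using A by (simp add: n_def card_gt_0_iff)
  define \<beta> where "\<beta> = 1 + (m - 1) * d / n"
  have \<beta>: "\<beta> \<ge> 1" using m n0 by (simp add: \<beta>_def)
  have mom: "moment4 A m a b c e = (if sym_diff a b = sym_diff c e then m ^ card (a \<inter> b \<inter> c \<inter> e) else 0)"
    if "c \<in> F" "e \<in> F" for c e
    using that ab by (intro moment4_eq A) (auto simp: F_def)
  show ?thesis
  proof (cases "a = b")
    case True
    have "(\<Sum>c\<in>F. \<Sum>e\<in>F. moment4 A m a b c e - of_bool (a = b) * of_bool (c = e))
       = (\<Sum>c\<in>F. \<Sum>e\<in>F. if c = e then m ^ card (a \<inter> c) - 1 else 0)"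
    proof (intro sum.cong refl)
      fix c e assume ce: "c \<in> F" "e \<in> F"
      have "sym_diff c e = {} \<longleftrightarrow> c = e" by auto
      thus "moment4 A m a b c e - of_bool (a = b) * of_bool (c = e) = (if c = e then m ^ card (a \<inter> c) - 1 else 0)"
        unfolding mom[OF ce] using True by (auto simp: Int_assoc)
    qed
    also have "\<dots> = (\<Sum>c\<in>F. m ^ card (a \<inter> c)) - real (card F)"
      using finF by (simp add: sum.delta' sum_subtractf)
    also have "(\<Sum>c\<in>F. m ^ card (a \<inter> c)) \<le> real (card A choose d) * \<beta> ^ d"
      using sum_subsets_weighted_le[OF A, of "{}" a m] ab m by (simp add: F_def n_def \<beta>_def)
    also have "real (card A choose d) * \<beta> ^ d - real (card F) \<le> real (card A choose d) * (\<beta> ^ d * (1 + 2 * real d ^ 2 / n) - 1)"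
    proof -
      have "\<beta> ^ d * 1 \<le> \<beta> ^ d * (1 + 2 * real d ^ 2 / n)"
        using \<beta> n0 by (intro mult_left_mono) auto
      hence "real (card A choose d) * (\<beta> ^ d - 1) \<le> real (card A choose d) * (\<beta> ^ d * (1 + 2 * real d ^ 2 / n) - 1)"
        by (intro mult_left_mono) auto
      thus ?thesis by (simp add: cardF algebra_simps)
    qed
    finally show ?thesis by (simp add: \<beta>_def)
  next
    case False
    define S where "S = sym_diff a b"
    define T where "T = a \<inter> b"
    have S: "finite S" "S \<subseteq> A" "S \<inter> T = {}" "S \<noteq> {}"
      using fab ab False by (auto simp: S_def T_def)
    have cS: "card S \<le> 2 * d"
    proof -
      have "card S \<le> card (a \<union> b)" using fab by (intro card_mono) (auto simp: S_def)
      also have "\<dots> \<le> 2 * d" using card_Un_le[of a b] ab by simp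
      finally show ?thesis .
    qed
    have cT: "card T \<le> d" using fab ab card_mono[of a T] by (auto simp: T_def)
    \<comment> \<open>Summing over the elements of \<open>S\<close> that \<open>c\<close> contains bounds the event that \<open>c\<close> meets \<open>S\<close>.\<close>
    have inner: "(\<Sum>e\<in>F. moment4 A m a b c e) \<le> (\<Sum>i\<in>S. if i \<in> c then m ^ card (T \<inter> c) else 0)" if c: "c \<in> F" for c
    proof (cases "c \<inter> S = {}")
      case True
      have "moment4 A m a b c e = 0" if e: "e \<in> F" for e
      proof -
        have "S \<noteq> sym_diff c e"
        proof
          assume "S = sym_diff c e"
          hence "e = c \<union> S" using True by auto
          hence "card e = card c + card S" using True fin[OF c] S by (simp add: card_Un_disjoint)
          moreover have "card S > 0" using S by (simp add: card_gt_0_iff)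
          ultimately show False using c e by (auto simp: F_def)
        qed
        thus ?thesis using mom[OF c e] by (simp add: S_def)
      qed
      thus ?thesis using m by (auto intro!: sum_nonneg)
    next
      case False
      then obtain i where i: "i \<in> c" "i \<in> S" by auto
      have "(\<Sum>e\<in>F. moment4 A m a b c e) \<le> (\<Sum>e\<in>F. if e = sym_diff c S then m ^ card (T \<inter> c) else 0)"
      proof (intro sum_mono)
        fix e assume e: "e \<in> F"
        have "m ^ card (a \<inter> b \<inter> c \<inter> e) \<le> m ^ card (T \<inter> c)"
          using m fab by (intro power_increasing card_mono) (auto simp: T_def)
        moreover have "e = sym_diff c S" if "S = sym_diff c e" using that by auto
        ultimately show "moment4 A m a b c e \<le> (if e = sym_diff c S then m ^ card (T \<inter> c) else 0)"
          using mom[OF c e] m by (auto simp: S_def)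
      qed
      also have "\<dots> \<le> m ^ card (T \<inter> c)" using finF m by (simp add: sum.delta)
      also have "\<dots> = (if i \<in> c then m ^ card (T \<inter> c) else 0)" using i by simp
      also have "\<dots> \<le> (\<Sum>i\<in>S. if i \<in> c then m ^ card (T \<inter> c) else 0)"
        using i S m by (intro member_le_sum[of i S "\<lambda>i. if i \<in> c then m ^ card (T \<inter> c) else 0"]) auto
      finally show ?thesis .
    qed
    have "(\<Sum>c\<in>F. \<Sum>e\<in>F. moment4 A m a b c e - of_bool (a = b) * of_bool (c = e))
        = (\<Sum>c\<in>F. \<Sum>e\<in>F. moment4 A m a b c e)" using False by simp
    also have "\<dots> \<le> (\<Sum>c\<in>F. \<Sum>i\<in>S. if i \<in> c then m ^ card (T \<inter> c) else 0)"
      by (intro sum_mono inner)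
    also have "\<dots> = (\<Sum>i\<in>S. \<Sum>c\<in>F. if i \<in> c then m ^ card (T \<inter> c) else 0)"
      by (rule sum.swap)
    also have "\<dots> \<le> (\<Sum>i\<in>S. real (card A choose d) * (real d / n) * \<beta> ^ d)"
    proof (intro sum_mono)
      fix i assume i: "i \<in> S"
      have "(\<Sum>c\<in>F. if i \<in> c then m ^ card (T \<inter> c) else 0)
          = (\<Sum>c | c \<subseteq> A \<and> card c = d \<and> {i} \<subseteq> c. m ^ card (T \<inter> c))"
        using finF by (intro sum.mono_neutral_cong_right) (auto simp: F_def)
      also have "\<dots> \<le> real (card A choose d) * (real d / n) * \<beta> ^ card T"
        using sum_subsets_weighted_le[OF A, of "{i}" T m] ab m i S
        by (auto simp: n_def \<beta>_def T_def)
      also have "\<dots> \<le> real (card A choose d) * (real d / n) * \<beta> ^ d"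
        using cT \<beta> n0 by (intro mult_left_mono power_increasing) auto
      finally show "(\<Sum>c\<in>F. if i \<in> c then m ^ card (T \<inter> c) else 0) \<le> real (card A choose d) * (real d / n) * \<beta> ^ d" .
    qed
    also have "\<dots> \<le> real (2 * d) * (real (card A choose d) * (real d / n) * \<beta> ^ d)"
      using cS \<beta> n0 by (simp only: sum_constant) (intro mult_right_mono, auto)
    also have "\<dots> = real (card A choose d) * (\<beta> ^ d * (2 * real d ^ 2 / n))"
      by (simp add: power2_eq_square)
    also have "\<dots> \<le> real (card A choose d) * (\<beta> ^ d * (1 + 2 * real d ^ 2 / n) - 1)"
      using \<beta> one_le_power[OF \<beta>, of d] by (intro mult_left_mono) (auto simp: algebra_simps)
    finally show ?thesis by (simp add: \<beta>_def)
  qed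
qed

lemma indep_power_products:
  fixes x :: "'i \<Rightarrow> 'b \<Rightarrow> real"
  assumes P: "prob_space P" and A: "finite A" and ind: "prob_space.indep_vars P (\<lambda>_. borel) x A"
    and int: "\<And>i j. i \<in> A \<Longrightarrow> j \<le> 4 \<Longrightarrow> integrable P (\<lambda>\<omega>. x i \<omega> ^ j)"
    and mom: "\<And>i j. i \<in> A \<Longrightarrow> j \<le> 4 \<Longrightarrow> (\<integral>\<omega>. x i \<omega> ^ j \<partial>P) = standard_moment m j"
    and k: "\<And>i. i \<in> A \<Longrightarrow> k i \<le> 4"
  shows "integrable P (\<lambda>\<omega>. \<Prod>i\<in>A. x i \<omega> ^ k i)"
    and "(\<integral>\<omega>. (\<Prod>i\<in>A. x i \<omega> ^ k i) \<partial>P) = (\<Prod>i\<in>A. standard_moment m (k i))"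
proof -
  interpret prob_space P by fact
  have ind': "indep_vars (\<lambda>_. borel) (\<lambda>i \<omega>. x i \<omega> ^ k i) A"
    by (rule indep_vars_compose2[OF ind]) auto
  show "integrable P (\<lambda>\<omega>. \<Prod>i\<in>A. x i \<omega> ^ k i)"
    by (rule indep_vars_integrable[OF A ind']) (auto intro: int k)
  show "(\<integral>\<omega>. (\<Prod>i\<in>A. x i \<omega> ^ k i) \<partial>P) = (\<Prod>i\<in>A. standard_moment m (k i))"
    by (subst indep_vars_lebesgue_integral[OF A ind']) (auto intro!: prod.cong int k mom)
qed

text \<open>
  The Schur test is applied to the products \<open>z a * z b\<close>, indexed by pairs \<open>(a, b)\<close>: their means are the
  entries of the identity matrix, so the mean of the quadratic form is the trace.
\<close>

lemma tensor_quadratic_form_variance: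
  fixes x :: "'i \<Rightarrow> 'b \<Rightarrow> real" and B :: "nat \<Rightarrow> nat \<Rightarrow> real"
  assumes P: "prob_space P" and A: "finite A" "A \<noteq> {}" "d \<le> card A"
    and ind: "prob_space.indep_vars P (\<lambda>_. borel) x A"
    and int: "\<And>i j. i \<in> A \<Longrightarrow> j \<le> 4 \<Longrightarrow> integrable P (\<lambda>\<omega>. x i \<omega> ^ j)"
    and mom: "\<And>i j. i \<in> A \<Longrightarrow> j \<le> 4 \<Longrightarrow> (\<integral>\<omega>. x i \<omega> ^ j \<partial>P) = standard_moment m j"
    and m: "m \<ge> 1"
    and I: "bij_betw I {..<N} {K. K \<subseteq> A \<and> card K = d}"
  defines "z \<equiv> \<lambda>k \<omega>. \<Prod>i\<in>I k. x i \<omega>" and "n \<equiv> real (card A)"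
  defines "q \<equiv> \<lambda>\<omega>. \<Sum>a<N. \<Sum>b<N. B a b * (z a \<omega> * z b \<omega>)"
  shows "integrable P (\<lambda>\<omega>. (q \<omega> - (\<Sum>a<N. B a a))\<^sup>2)"
    and "(\<integral>\<omega>. (q \<omega> - (\<Sum>a<N. B a a))\<^sup>2 \<partial>P)
      \<le> real N * ((1 + (m - 1) * d / n) ^ d * (1 + 2 * real d ^ 2 / n) - 1) * (\<Sum>a<N. \<Sum>b<N. (B a b)\<^sup>2)"
proof -
  let ?F = "{K. K \<subseteq> A \<and> card K = d}"
  have IF: "I a \<subseteq> A" "card (I a) = d" if "a < N" for a
    using bij_betwE[OF I] that by auto
  have N: "N = card A choose d"
    using bij_betw_same_card[OF I] n_subsets[OF A(1)] by simp
  have inj: "I a = I b \<longleftrightarrow> a = b" if "a < N" "b < N" for a b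
    using I that by (auto simp: bij_betw_def inj_on_def)
  have zp: "z a \<omega> = (\<Prod>i\<in>A. x i \<omega> ^ of_bool (i \<in> I a))" if "a < N" for a \<omega>
    unfolding z_def by (rule prod_subset_as_powers[OF A(1) IF(1)[OF that]])
  have z4: "z a \<omega> * z b \<omega> * (z c \<omega> * z e \<omega>) = (\<Prod>i\<in>A. x i \<omega> ^ mult4 (I a) (I b) (I c) (I e) i)"
    if "a < N" "b < N" "c < N" "e < N" for a b c e \<omega>
    unfolding mult4_def
    using that by (simp only: zp prod.distrib[symmetric] power_add mult.assoc)
  have z2: "z a \<omega> * z b \<omega> = (\<Prod>i\<in>A. x i \<omega> ^ (of_bool (i \<in> I a) + of_bool (i \<in> I b)))"
    if "a < N" "b < N" for a b \<omega>
    using that by (simp only: zp prod.distrib[symmetric] power_add)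
  have le4: "mult4 a b c e i \<le> 4" for a b c e :: "'i set" and i
    by (auto simp: mult4_def)
  note ipp = indep_power_products[OF P A(1) ind int mom]
  have e2: "(\<integral>\<omega>. z a \<omega> * z b \<omega> \<partial>P) = of_bool (a = b)" if ab: "a < N" "b < N" for a b
  proof -
    have "(\<integral>\<omega>. z a \<omega> * z b \<omega> \<partial>P) = (\<Prod>i\<in>A. standard_moment m (of_bool (i \<in> I a) + of_bool (i \<in> I b)))"
      unfolding z2[OF ab] by (rule ipp(2)) auto
    also have "\<dots> = of_bool (a = b)"
    proof (cases "a = b")
      case True
      thus ?thesis by (auto simp: standard_moment_def intro!: prod.neutral)
    next
      case False
      hence "I a \<noteq> I b" using inj ab by simp
      then obtain i where "i \<in> A" "i \<in> I a \<longleftrightarrow> i \<notin> I b" using IF ab by blast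
      hence "(\<Prod>i\<in>A. standard_moment m (of_bool (i \<in> I a) + of_bool (i \<in> I b))) = 0"
        by (intro prod_zero[OF A(1)] bexI[of _ i]) (auto simp: standard_moment_def)
      thus ?thesis using False by simp
    qed
    finally show ?thesis .
  qed
  define W where "W a b c e = moment4 A m (I a) (I b) (I c) (I e) - of_bool (a = b) * of_bool (c = e)" for a b c e
  have W0: "0 \<le> W a b c e" if "a < N" "b < N" "c < N" "e < N" for a b c e
  proof (cases "a = b \<and> c = e")
    case True
    hence "W a b c e = m ^ card (I a \<inter> I c) - 1"
      using that IF A by (simp add: W_def moment4_eq Int_assoc)
    thus ?thesis using one_le_power[OF m] by simp
  qed (use moment4_nonneg[OF m] in \<open>auto simp: W_def\<close>)
  have row: "(\<Sum>c<N. \<Sum>e<N. W a b c e)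
      \<le> real N * ((1 + (m - 1) * d / n) ^ d * (1 + 2 * real d ^ 2 / n) - 1)" if ab: "a < N" "b < N" for a b
  proof -
    have "(\<Sum>c<N. \<Sum>e<N. W a b c e)
        = (\<Sum>c<N. \<Sum>e<N. moment4 A m (I a) (I b) (I c) (I e) - of_bool (I a = I b) * of_bool (I c = I e))"
      using ab by (intro sum.cong refl) (simp add: W_def inj)
    also have "\<dots> = (\<Sum>C\<in>?F. \<Sum>E\<in>?F. moment4 A m (I a) (I b) C E - of_bool (I a = I b) * of_bool (C = E))"
      by (simp add: sum.reindex_bij_betw[OF I, symmetric])
    also have "\<dots> \<le> real (card A choose d) * ((1 + (m - 1) * d / n) ^ d * (1 + 2 * real d ^ 2 / n) - 1)"
      unfolding n_def using ab IF by (intro moment4_row_sum A m) auto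
    finally show ?thesis by (simp add: N)
  qed
  let ?P = "{..<N} \<times> {..<N}"
  let ?y = "\<lambda>(a, b) \<omega>. z a \<omega> * z b \<omega>" and ?\<tau> = "\<lambda>(a, b). of_bool (a = b) :: real"
  have q: "(\<Sum>p\<in>?P. case_prod B p * ?y p \<omega>) = q \<omega>" for \<omega>
    by (simp add: q_def sum.cartesian_product case_prod_beta')
  have tr: "(\<Sum>p\<in>?P. case_prod B p * ?\<tau> p) = (\<Sum>a<N. B a a)"
  proof -
    have "(\<Sum>p\<in>?P. case_prod B p * ?\<tau> p) = (\<Sum>(a, b)\<in>?P. B a b * of_bool (a = b))"
      by (intro sum.cong refl) auto
    also have "\<dots> = (\<Sum>a<N. \<Sum>b<N. B a b * of_bool (a = b))"
      by (simp only: sum.cartesian_product)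
    also have "\<dots> = (\<Sum>a<N. \<Sum>b<N. if a = b then B a a else 0)"
      by (intro sum.cong refl) auto
    finally show ?thesis by simp
  qed
  have fro: "(\<Sum>p\<in>?P. (case_prod B p)\<^sup>2) = (\<Sum>a<N. \<Sum>b<N. (B a b)\<^sup>2)"
    by (simp add: sum.cartesian_product case_prod_beta')
  have i1: "integrable P (?y p)" if pm: "p \<in> ?P" for p
  proof -
    obtain a b where p: "p = (a, b)" "a < N" "b < N" using pm by blast
    have "integrable P (\<lambda>\<omega>. z a \<omega> * z b \<omega>)" unfolding z2[OF p(2,3)] by (rule ipp(1)) auto
    thus ?thesis using p by simp
  qed
  have i2: "integrable P (\<lambda>\<omega>. ?y p \<omega> * ?y r \<omega>)"
    and Wpr: "case_prod (case_prod W p) r = (\<integral>\<omega>. ?y p \<omega> * ?y r \<omega> \<partial>P) - ?\<tau> p * ?\<tau> r"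
    if pr: "p \<in> ?P" "r \<in> ?P" for p r
  proof -
    obtain a b where p: "p = (a, b)" "a < N" "b < N" using pr by blast
    obtain c e where r: "r = (c, e)" "c < N" "e < N" using pr by blast
    have "integrable P (\<lambda>\<omega>. z a \<omega> * z b \<omega> * (z c \<omega> * z e \<omega>))"
      unfolding z4[OF p(2,3) r(2,3)] by (rule ipp(1)) (auto simp: le4)
    thus "integrable P (\<lambda>\<omega>. ?y p \<omega> * ?y r \<omega>)" using p r by simp
    have "W a b c e = (\<integral>\<omega>. z a \<omega> * z b \<omega> * (z c \<omega> * z e \<omega>) \<partial>P) - of_bool (a = b) * of_bool (c = e)"
      unfolding z4[OF p(2,3) r(2,3)] W_def moment4_def by (subst ipp(2)) (auto simp: le4)
    thus "case_prod (case_prod W p) r = (\<integral>\<omega>. ?y p \<omega> * ?y r \<omega> \<partial>P) - ?\<tau> p * ?\<tau> r"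
      using p r by simp
  qed
  have W0': "0 \<le> case_prod (case_prod W p) r" if "p \<in> ?P" "r \<in> ?P" for p r
    using that W0 by auto
  have row': "(\<Sum>r\<in>?P. case_prod (case_prod W p) r)
      \<le> real N * ((1 + (m - 1) * d / n) ^ d * (1 + 2 * real d ^ 2 / n) - 1)" if pm: "p \<in> ?P" for p
  proof -
    obtain a b where p: "p = (a, b)" "a < N" "b < N" using pm by blast
    show ?thesis using row[OF p(2,3)] p by (simp add: sum.cartesian_product)
  qed
  have \<tau>': "(\<integral>\<omega>. ?y p \<omega> \<partial>P) = ?\<tau> p" if "p \<in> ?P" for p
    using that e2 by auto
  note var = variance_linear_combination_le[OF P _ i1 i2 \<tau>' Wpr W0' row', where A = "case_prod B", unfolded q tr fro]
  show "integrable P (\<lambda>\<omega>. (q \<omega> - (\<Sum>a<N. B a a))\<^sup>2)"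
    "(\<integral>\<omega>. (q \<omega> - (\<Sum>a<N. B a a))\<^sup>2 \<partial>P)
      \<le> real N * ((1 + (m - 1) * d / n) ^ d * (1 + 2 * real d ^ 2 / n) - 1) * (\<Sum>a<N. \<Sum>b<N. (B a b)\<^sup>2)"
    using var by auto
qed

section \<open>Resolvents of positive definite matrices under rank-one updates\<close>

definition mtrace :: "real mat \<Rightarrow> real" where
  "mtrace A = (\<Sum>k<dim_row A. A $$ (k, k))"

text \<open>
  The adjugate formula makes the entries of the inverse visibly measurable functions of the entries of
  the matrix.
\<close>

definition inv_mat :: "real mat \<Rightarrow> real mat" where
  "inv_mat A = (1 / Determinant.det A) \<cdot>\<^sub>m adj_mat A"

definition coercive :: "nat \<Rightarrow> real \<Rightarrow> real mat \<Rightarrow> bool" where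
  "coercive N t A \<longleftrightarrow> A \<in> carrier_mat N N \<and> A\<^sup>T = A \<and>
     (\<forall>v\<in>carrier_vec N. t * scalar_prod v v \<le> scalar_prod v (A *\<^sub>v v))"

lemma scalar_prod_self: "scalar_prod v v = (\<Sum>k<dim_vec v. (v $ k)\<^sup>2)"
  for v :: "real Matrix.vec"
  by (simp add: scalar_prod_def power2_eq_square atLeast0LessThan)

lemma scalar_prod_self_nonneg: "scalar_prod v v \<ge> 0" for v :: "real Matrix.vec"
  by (simp add: scalar_prod_self sum_nonneg)

lemma scalar_prod_self_eq_0:
  fixes v :: "real Matrix.vec"
  assumes "v \<in> carrier_vec N" "scalar_prod v v = 0"
  shows "v = 0\<^sub>v N"
proof (rule eq_vecI)
  show "dim_vec v = dim_vec (0\<^sub>v N)" using assms by auto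
  fix i assume "i < dim_vec (0\<^sub>v N :: real Matrix.vec)"
  moreover have "\<forall>k\<in>{..<dim_vec v}. (v $ k)\<^sup>2 = 0"
    using assms(2) unfolding scalar_prod_self by (subst (asm) sum_nonneg_eq_0_iff) auto
  ultimately show "v $ i = 0\<^sub>v N $ i" using assms(1) by auto
qed

lemma mult_mat_vec_sum:
  assumes "A \<in> carrier_mat N N" "v \<in> carrier_vec N" "k < N"
  shows "(A *\<^sub>v v) $ k = (\<Sum>l<N. A $$ (k, l) * v $ l)"
  using assms by (simp add: scalar_prod_def atLeast0LessThan)

lemma
  assumes G: "coercive N t G" and t: "t > 0"
  shows coercive_det: "Determinant.det G \<noteq> 0"
    and inv_mat_carrier: "inv_mat G \<in> carrier_mat N N"
    and inv_mat_right: "G * inv_mat G = 1\<^sub>m N"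
    and inv_mat_left: "inv_mat G * G = 1\<^sub>m N"
    and inv_mat_sym: "(inv_mat G)\<^sup>T = inv_mat G"
proof -
  have c: "G \<in> carrier_mat N N" and s: "G\<^sup>T = G" using G by (auto simp: coercive_def)
  show d: "Determinant.det G \<noteq> 0"
  proof
    assume "Determinant.det G = 0"
    then obtain v where v: "v \<in> carrier_vec N" "v \<noteq> 0\<^sub>v N" "G *\<^sub>v v = 0\<^sub>v N"
      using det_0_iff_vec_prod_zero_field[OF c] by auto
    have "t * scalar_prod v v \<le> 0"
      using G v by (force simp: coercive_def)
    hence "scalar_prod v v = 0"
      using t scalar_prod_self_nonneg[of v] by (simp add: mult_le_0_iff)
    thus False using v scalar_prod_self_eq_0 by blast
  qed
  show R: "inv_mat G \<in> carrier_mat N N" using adj_mat(1)[OF c] by (simp add: inv_mat_def)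
  have "G * inv_mat G = (1 / Determinant.det G) \<cdot>\<^sub>m (G * adj_mat G)"
    unfolding inv_mat_def using c adj_mat(1)[OF c] by (intro mult_smult_distrib)
  also have "\<dots> = 1\<^sub>m N"
    using d by (auto simp: adj_mat(2)[OF c])
  finally show r: "G * inv_mat G = 1\<^sub>m N" .
  have "inv_mat G * G = (1 / Determinant.det G) \<cdot>\<^sub>m (adj_mat G * G)"
    unfolding inv_mat_def using c adj_mat(1)[OF c] by (intro mult_smult_assoc_mat)
  also have "\<dots> = 1\<^sub>m N"
    using d by (auto simp: adj_mat(3)[OF c])
  finally show l: "inv_mat G * G = 1\<^sub>m N" .
  have "(inv_mat G)\<^sup>T * G = 1\<^sub>m N"
    using transpose_mult[OF c R] r s by simp
  hence "(inv_mat G)\<^sup>T * G * inv_mat G = inv_mat G"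
    using R by simp
  moreover have "(inv_mat G)\<^sup>T * G * inv_mat G = (inv_mat G)\<^sup>T * (G * inv_mat G)"
    using R c by (intro assoc_mult_mat[of _ N N _ N _ N]) auto
  ultimately show "(inv_mat G)\<^sup>T = inv_mat G" using r R by simp
qed

lemma inv_mat_vec:
  assumes G: "coercive N t G" and t: "t > 0" and v: "v \<in> carrier_vec N"
  shows "G *\<^sub>v (inv_mat G *\<^sub>v v) = v" "inv_mat G *\<^sub>v (G *\<^sub>v v) = v"
proof -
  have c: "G \<in> carrier_mat N N" using G by (auto simp: coercive_def)
  show "G *\<^sub>v (inv_mat G *\<^sub>v v) = v" "inv_mat G *\<^sub>v (G *\<^sub>v v) = v"
    using assoc_mult_mat_vec[OF c inv_mat_carrier[OF G t] v] inv_mat_right[OF G t]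
      assoc_mult_mat_vec[OF inv_mat_carrier[OF G t] c v] inv_mat_left[OF G t] one_mult_mat_vec[OF v] by metis+
qed

text \<open>
  With \<open>v = G w\<close> this is the coercivity of \<open>G\<close> at \<open>w\<close>.  All bounds on the inverse follow from it.
\<close>

lemma inv_mat_quadratic_form_ge:
  assumes G: "coercive N t G" and t: "t > 0" and v: "v \<in> carrier_vec N"
  defines "w \<equiv> inv_mat G *\<^sub>v v"
  shows "t * scalar_prod w w \<le> scalar_prod v w"
proof -
  have w: "w \<in> carrier_vec N" unfolding w_def using inv_mat_carrier[OF G t] v by auto
  have "t * scalar_prod w w \<le> scalar_prod w (G *\<^sub>v w)" using G w by (auto simp: coercive_def)
  also have "\<dots> = scalar_prod v w"
    using inv_mat_vec[OF G t v] v w by (simp add: w_def comm_scalar_prod[of _ N])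
  finally show ?thesis .
qed

lemma inv_mat_column_norm_le:
  assumes G: "coercive N t G" and t: "t > 0" and k: "k < N"
  shows "(\<Sum>l<N. (inv_mat G $$ (l, k))\<^sup>2) \<le> 1 / t\<^sup>2"
proof -
  let ?R = "inv_mat G" let ?w = "?R *\<^sub>v unit_vec N k"
  have R: "?R \<in> carrier_mat N N" using inv_mat_carrier[OF G t] .
  have w: "?w \<in> carrier_vec N" using R by auto
  have comp: "?w $ l = ?R $$ (l, k)" if "l < N" for l
    using R k that by simp
  define S where "S = (\<Sum>l<N. (?R $$ (l, k))\<^sup>2)"
  have S: "scalar_prod ?w ?w = S"
    unfolding scalar_prod_self S_def using R by (intro sum.cong) (auto simp: comp simp del: index_mult_mat_vec)
  have "t * S \<le> scalar_prod (unit_vec N k) ?w"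
    using inv_mat_quadratic_form_ge[OF G t, of "unit_vec N k"] S by simp
  also have "\<dots> = ?R $$ (k, k)"
    using w k comp[OF k] by (simp add: scalar_prod_left_unit[OF w k])
  finally have 1: "t * S \<le> ?R $$ (k, k)" .
  \<comment> \<open>The column has squared norm \<open>S\<close> and \<open>t S \<le> R\<^sub>k\<^sub>k \<le> sqrt S\<close>.\<close>
  have "(?R $$ (k, k))\<^sup>2 \<le> S"
    unfolding S_def using k by (intro member_le_sum[of k _ "\<lambda>l. (?R $$ (l, k))\<^sup>2"]) auto
  moreover have "(t * S)\<^sup>2 \<le> (?R $$ (k, k))\<^sup>2"
    using 1 t by (intro power_mono) (auto simp: S_def sum_nonneg)
  ultimately have "(t * S)\<^sup>2 \<le> S" by (rule order_trans[rotated])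
  hence "t\<^sup>2 * (S * S) \<le> 1 * S" by (simp add: power_mult_distrib power2_eq_square mult_ac)
  moreover have "S \<ge> 0" by (simp add: S_def sum_nonneg)
  ultimately have "t\<^sup>2 * S \<le> 1"
    by (cases "S = 0") (auto simp: mult.assoc[symmetric])
  thus ?thesis using t unfolding S_def by (simp add: field_simps)
qed

text \<open>
  The Schur test above asks for the Frobenius norm of the matrix of a quadratic form.  For a resolvent
  it costs no more than \<open>N\<close> times the squared operator norm.
\<close>

lemma inv_mat_frobenius_le:
  assumes G: "coercive N t G" and t: "t > 0"
  shows "(\<Sum>k<N. \<Sum>l<N. (inv_mat G $$ (k, l))\<^sup>2) \<le> real N / t\<^sup>2"
proof -
  have "(\<Sum>k<N. \<Sum>l<N. (inv_mat G $$ (k, l))\<^sup>2) = (\<Sum>l<N. \<Sum>k<N. (inv_mat G $$ (k, l))\<^sup>2)"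
    by (rule sum.swap)
  also have "\<dots> \<le> (\<Sum>l<N. 1 / t\<^sup>2)"
    using inv_mat_column_norm_le[OF G t] by (intro sum_mono) auto
  finally show ?thesis by simp
qed

lemma inv_mat_trace_bounds:
  assumes G: "coercive N t G" and t: "t > 0"
  shows "0 \<le> mtrace (inv_mat G)" "mtrace (inv_mat G) \<le> real N / t"
proof -
  let ?R = "inv_mat G"
  have R: "?R \<in> carrier_mat N N" using inv_mat_carrier[OF G t] .
  have "0 \<le> ?R $$ (k, k) \<and> ?R $$ (k, k) \<le> 1 / t" if k: "k < N" for k
  proof
    have w: "?R *\<^sub>v unit_vec N k \<in> carrier_vec N" using R by auto
    have "0 \<le> scalar_prod (unit_vec N k) (?R *\<^sub>v unit_vec N k)"
      using inv_mat_quadratic_form_ge[OF G t, of "unit_vec N k"]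
        scalar_prod_self_nonneg[of "?R *\<^sub>v unit_vec N k"] t
      by (smt (verit) mult_nonneg_nonneg unit_vec_carrier)
    thus "0 \<le> ?R $$ (k, k)" using R k by (simp add: scalar_prod_left_unit[OF w k])
    have "(?R $$ (k, k))\<^sup>2 \<le> (\<Sum>l<N. (?R $$ (l, k))\<^sup>2)"
      using k by (intro member_le_sum[of k _ "\<lambda>l. (?R $$ (l, k))\<^sup>2"]) auto
    also have "\<dots> \<le> (1 / t)\<^sup>2" using inv_mat_column_norm_le[OF G t k] by (simp add: power_divide)
    finally have sq: "(?R $$ (k, k))\<^sup>2 \<le> (1 / t)\<^sup>2" .
    show "?R $$ (k, k) \<le> 1 / t" by (rule power2_le_imp_le[OF sq]) (use t in simp)
  qed
  hence b: "\<And>k. k < N \<Longrightarrow> 0 \<le> ?R $$ (k, k)" "\<And>k. k < N \<Longrightarrow> ?R $$ (k, k) \<le> 1 / t" by blast+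
  have tr: "mtrace ?R = (\<Sum>k<N. ?R $$ (k, k))" using R unfolding mtrace_def by simp
  show "0 \<le> mtrace ?R" unfolding tr using b(1) by (intro sum_nonneg) simp
  have "(\<Sum>k<N. ?R $$ (k, k)) \<le> (\<Sum>k<N. 1 / t)" using b(2) by (intro sum_mono) simp
  thus "mtrace ?R \<le> real N / t" unfolding tr by simp
qed

text \<open>
  With \<open>R\<close>, \<open>R'\<close> the two inverses, \<open>R v = R' v + c (z \<cdot> R' v) R z\<close> for every \<open>v\<close>.  The choice \<open>v = z\<close>
  gives the relation between \<open>q\<close> and \<open>q'\<close>; the unit vectors \<open>v\<close> give
  \<open>tr R - tr R' = c |R z|\<^sup>2/(1 + q)\<close>, where \<open>t c |R z|\<^sup>2 \<le> q\<close> by coercivity.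
\<close>

lemma rank_one_update_resolvent:
  fixes z :: "real Matrix.vec" and N :: nat
  assumes G: "coercive N t G" and G': "coercive N t G'" and t: "t > 0" and z: "z \<in> carrier_vec N"
    and c: "c \<ge> 0"
    and upd: "\<And>v. v \<in> carrier_vec N \<Longrightarrow> G' *\<^sub>v v = G *\<^sub>v v + (c * scalar_prod z v) \<cdot>\<^sub>v z"
  defines "q \<equiv> c * scalar_prod z (inv_mat G *\<^sub>v z)"
    and "q' \<equiv> c * scalar_prod z (inv_mat G' *\<^sub>v z)"
  shows "q \<ge> 0" "q' = q / (1 + q)"
    and "mtrace (inv_mat G') \<le> mtrace (inv_mat G)"
    and "mtrace (inv_mat G) \<le> mtrace (inv_mat G') + 1 / t"
proof -
  let ?R = "inv_mat G" and ?R' = "inv_mat G'"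
  have R: "?R \<in> carrier_mat N N" "?R' \<in> carrier_mat N N"
    using inv_mat_carrier G G' t by blast+
  have Gc: "G \<in> carrier_mat N N" using G by (auto simp: coercive_def)
  define w where "w = ?R *\<^sub>v z"
  define w' where "w' = ?R' *\<^sub>v z"
  have w: "w \<in> carrier_vec N" "w' \<in> carrier_vec N" using R z by (auto simp: w_def w'_def)
  have key: "?R *\<^sub>v v = ?R' *\<^sub>v v + (c * scalar_prod z (?R' *\<^sub>v v)) \<cdot>\<^sub>v w"
    if v: "v \<in> carrier_vec N" for v
  proof -
    let ?u = "?R' *\<^sub>v v"
    have u: "?u \<in> carrier_vec N" using R v by auto
    have "v = G *\<^sub>v ?u + (c * scalar_prod z ?u) \<cdot>\<^sub>v z"
      using upd[OF u] inv_mat_vec(1)[OF G' t v] by simp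
    hence "?R *\<^sub>v v = ?R *\<^sub>v (G *\<^sub>v ?u + (c * scalar_prod z ?u) \<cdot>\<^sub>v z)" by simp
    also have "\<dots> = ?R *\<^sub>v (G *\<^sub>v ?u) + ?R *\<^sub>v ((c * scalar_prod z ?u) \<cdot>\<^sub>v z)"
      using R Gc u z by (intro mult_add_distrib_mat_vec[of _ N N]) auto
    also have "?R *\<^sub>v (G *\<^sub>v ?u) = ?u" using inv_mat_vec(2)[OF G t u] .
    also have "?R *\<^sub>v ((c * scalar_prod z ?u) \<cdot>\<^sub>v z) = (c * scalar_prod z ?u) \<cdot>\<^sub>v w"
      using mult_mat_vec[OF R(1) z] by (simp add: w_def)
    finally show ?thesis .
  qed
  have ww': "w = w' + q' \<cdot>\<^sub>v w"
    using key[OF z] by (simp add: w_def w'_def q'_def)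
  have "scalar_prod z w = scalar_prod z (w' + q' \<cdot>\<^sub>v w)" using ww' by simp
  also have "\<dots> = scalar_prod z w' + q' * scalar_prod z w"
    using scalar_prod_add_distrib[OF z w(2), of "q' \<cdot>\<^sub>v w"] z w by simp
  finally have zw': "scalar_prod z w = scalar_prod z w' + q' * scalar_prod z w" .
  have "c * scalar_prod z w = c * (scalar_prod z w' + q' * scalar_prod z w)"
    by (rule arg_cong[OF zw'])
  also have "\<dots> = c * scalar_prod z w' + q' * (c * scalar_prod z w)"
    by (simp only: distrib_left mult.left_commute)
  finally have "c * scalar_prod z w = c * scalar_prod z w' + q' * (c * scalar_prod z w)" .
  moreover have "c * scalar_prod z w = q" "c * scalar_prod z w' = q'"
    by (simp_all add: q_def q'_def w_def w'_def)
  ultimately have qq: "q = q' + q' * q" by simp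
  have tw: "t * scalar_prod w w \<le> scalar_prod z w"
    using inv_mat_quadratic_form_ge[OF G t z] by (simp add: w_def)
  have nn: "scalar_prod w w \<ge> 0" by (rule scalar_prod_self_nonneg)
  have zw: "scalar_prod z w \<ge> 0" using tw nn t by (smt (verit) mult_nonneg_nonneg)
  thus q0: "q \<ge> 0" using c by (simp add: q_def w_def)
  show q': "q' = q / (1 + q)" using qq q0 by (simp add: field_simps)
  have diff: "?R $$ (k, k) - ?R' $$ (k, k) = c * (1 - q') * (w $ k)\<^sup>2" if k: "k < N" for k
  proof -
    let ?e = "unit_vec N k :: real Matrix.vec"
    have eN: "?R' *\<^sub>v ?e \<in> carrier_vec N" using R by auto
    have "scalar_prod z (?R' *\<^sub>v ?e) = scalar_prod (?R'\<^sup>T *\<^sub>v z) ?e"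
      using transpose_vec_mult_scalar[OF R(2), of ?e z] z by simp
    also have "\<dots> = scalar_prod w' ?e"
      using inv_mat_sym[OF G' t] by (simp add: w'_def)
    also have "\<dots> = w' $ k" using k w by (simp add: scalar_prod_right_unit[OF k])
    finally have s: "scalar_prod z (?R' *\<^sub>v ?e) = w' $ k" .
    have "(?R *\<^sub>v ?e) $ k = (?R' *\<^sub>v ?e + (c * w' $ k) \<cdot>\<^sub>v w) $ k"
      using key[of ?e] s by simp
    hence "?R $$ (k, k) = ?R' $$ (k, k) + c * w' $ k * w $ k"
      using R w k by simp
    moreover have "w $ k = w' $ k + q' * w $ k"
      using arg_cong[OF ww', of "\<lambda>v. v $ k"] w k by simp
    hence "w' $ k = (1 - q') * w $ k" by (simp add: algebra_simps)
    ultimately show ?thesis by (simp add: power2_eq_square)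
  qed
  have "mtrace ?R - mtrace ?R' = (\<Sum>k<N. ?R $$ (k, k) - ?R' $$ (k, k))"
    using R by (simp add: mtrace_def sum_subtractf)
  also have "\<dots> = (\<Sum>k<N. c * (1 - q') * (w $ k)\<^sup>2)" by (intro sum.cong) (auto simp: diff)
  also have "\<dots> = (1 - q') * (c * scalar_prod w w)"
    using w by (simp add: scalar_prod_self sum_distrib_left mult_ac)
  finally have tr: "mtrace ?R - mtrace ?R' = (1 - q') * (c * scalar_prod w w)" .
  have q'1: "1 - q' = 1 / (1 + q)" using q0 q' by (simp add: field_simps)
  have "t * (c * scalar_prod w w) \<le> q"
    using mult_left_mono[OF tw c] by (simp add: q_def w_def mult_ac)
  hence "c * scalar_prod w w \<le> q / t" using t by (simp add: field_simps)
  hence "(1 - q') * (c * scalar_prod w w) \<le> 1 / (1 + q) * (q / t)"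
    unfolding q'1 using q0 by (intro mult_left_mono) auto
  also have "\<dots> = q / (1 + q) / t" by simp
  also have "\<dots> \<le> 1 / t" using q0 t by (intro divide_right_mono) (auto simp: divide_le_eq)
  finally show "mtrace ?R \<le> mtrace ?R' + 1 / t" using tr by simp
  have "0 \<le> (1 - q') * (c * scalar_prod w w)"
    unfolding q'1 using c nn q0 by (intro mult_nonneg_nonneg) auto
  thus "mtrace ?R' \<le> mtrace ?R" using tr by simp
qed

text \<open>
  The matrix \<open>c \<Sum>\<^sub>j z\<^sub>j z\<^sub>j\<^sup>T + t\<close>.  The set \<open>J\<close> of columns is a parameter because columns are removed one
  at a time.
\<close>

definition shifted_gram :: "nat \<Rightarrow> real \<Rightarrow> real \<Rightarrow> nat set \<Rightarrow> (nat \<Rightarrow> nat \<Rightarrow> real) \<Rightarrow> real mat" where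
  "shifted_gram N t c J z = mat N N (\<lambda>(k, l). (if k = l then t else 0) + c * (\<Sum>j\<in>J. z j k * z j l))"

definition resolvent :: "nat \<Rightarrow> real \<Rightarrow> real \<Rightarrow> nat set \<Rightarrow> (nat \<Rightarrow> nat \<Rightarrow> real) \<Rightarrow> real mat" where
  "resolvent N t c J z = inv_mat (shifted_gram N t c J z)"

lemma shifted_gram_carrier [simp]: "shifted_gram N t c J z \<in> carrier_mat N N"
  by (simp add: shifted_gram_def)

lemma shifted_gram_dims [simp]:
  "dim_row (shifted_gram N t c J z) = N" "dim_col (shifted_gram N t c J z) = N"
  by (simp_all add: shifted_gram_def)

lemma shifted_gram_insert:
  assumes "finite J" "j \<notin> J" and v: "v \<in> carrier_vec N"
  shows "shifted_gram N t c (insert j J) z *\<^sub>v v = shifted_gram N t c J z *\<^sub>v v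
      + (c * scalar_prod (Matrix.vec N (z j)) v) \<cdot>\<^sub>v Matrix.vec N (z j)"
proof (rule eq_vecI)
  fix k assume "k < dim_vec (shifted_gram N t c J z *\<^sub>v v
      + (c * scalar_prod (Matrix.vec N (z j)) v) \<cdot>\<^sub>v Matrix.vec N (z j))"
  hence k: "k < N" by simp
  have "(shifted_gram N t c (insert j J) z *\<^sub>v v) $ k
     = (\<Sum>l<N. shifted_gram N t c (insert j J) z $$ (k, l) * v $ l)"
    using mult_mat_vec_sum[OF shifted_gram_carrier v k] .
  also have "\<dots> = (\<Sum>l<N. shifted_gram N t c J z $$ (k, l) * v $ l) + (\<Sum>l<N. c * (z j l * v $ l) * z j k)"
    unfolding sum.distrib[symmetric]
    using assms k by (intro sum.cong) (auto simp: shifted_gram_def algebra_simps)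
  also have "(\<Sum>l<N. shifted_gram N t c J z $$ (k, l) * v $ l) = (shifted_gram N t c J z *\<^sub>v v) $ k"
    using mult_mat_vec_sum[OF shifted_gram_carrier v k] by simp
  also have "(\<Sum>l<N. c * (z j l * v $ l) * z j k) = c * scalar_prod (Matrix.vec N (z j)) v * z j k"
    using v by (simp add: scalar_prod_def atLeast0LessThan sum_distrib_left sum_distrib_right)
  finally show "(shifted_gram N t c (insert j J) z *\<^sub>v v) $ k = (shifted_gram N t c J z *\<^sub>v v
      + (c * scalar_prod (Matrix.vec N (z j)) v) \<cdot>\<^sub>v Matrix.vec N (z j)) $ k"
    using k by simp
qed simp

lemma shifted_gram_coercive:
  assumes "finite J" "c \<ge> 0"
  shows "coercive N t (shifted_gram N t c J z)"
proof -
  have sym: "(shifted_gram N t c J z)\<^sup>T = shifted_gram N t c J z"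
    by (rule eq_matI) (auto simp: shifted_gram_def mult.commute)
  have "t * scalar_prod v v \<le> scalar_prod v (shifted_gram N t c J z *\<^sub>v v)" if v: "v \<in> carrier_vec N" for v
    using assms(1)
  proof (induction J rule: finite_induct)
    case empty
    have "shifted_gram N t c {} z *\<^sub>v v = t \<cdot>\<^sub>v v"
    proof (rule eq_vecI)
      fix k assume "k < dim_vec (t \<cdot>\<^sub>v v)"
      hence k: "k < N" using v by simp
      have "(shifted_gram N t c {} z *\<^sub>v v) $ k = (\<Sum>l<N. if k = l then t * v $ l else 0)"
        unfolding mult_mat_vec_sum[OF shifted_gram_carrier v k]
        using k by (intro sum.cong) (auto simp: shifted_gram_def)
      thus "(shifted_gram N t c {} z *\<^sub>v v) $ k = (t \<cdot>\<^sub>v v) $ k" using k v by (simp add: sum.delta)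
    qed (use v in \<open>simp add: shifted_gram_def\<close>)
    thus ?case using v by simp
  next
    case (insert j J)
    let ?z = "Matrix.vec N (z j)"
    have zc: "?z \<in> carrier_vec N" by simp
    have gc: "shifted_gram N t c J z *\<^sub>v v \<in> carrier_vec N"
      using v by (intro mult_mat_vec_carrier[OF shifted_gram_carrier])
    have "scalar_prod v (shifted_gram N t c (insert j J) z *\<^sub>v v)
        = scalar_prod v (shifted_gram N t c J z *\<^sub>v v) + (c * scalar_prod ?z v) * scalar_prod v ?z"
      unfolding shifted_gram_insert[OF insert.hyps v]
      by (subst scalar_prod_add_distrib[OF v gc]) (use v in \<open>auto\<close>)
    also have "scalar_prod v ?z = scalar_prod ?z v" using comm_scalar_prod[OF v zc] .
    finally show ?case using insert.IH assms(2)
      by (smt (verit) mult.assoc mult_nonneg_nonneg zero_le_square)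
  qed
  thus ?thesis using sym by (auto simp: coercive_def)
qed

definition qform :: "nat \<Rightarrow> real mat \<Rightarrow> (nat \<Rightarrow> real) \<Rightarrow> real" where
  "qform N A z = (\<Sum>k<N. \<Sum>l<N. A $$ (k, l) * (z k * z l))"

lemma qform_eq_scalar_prod:
  assumes "A \<in> carrier_mat N N"
  shows "scalar_prod (Matrix.vec N z) (A *\<^sub>v Matrix.vec N z) = qform N A z"
proof -
  have "scalar_prod (Matrix.vec N z) (A *\<^sub>v Matrix.vec N z) = (\<Sum>k<N. z k * (A *\<^sub>v Matrix.vec N z) $ k)"
    using assms by (simp add: scalar_prod_def atLeast0LessThan)
  also have "\<dots> = (\<Sum>k<N. z k * (\<Sum>l<N. A $$ (k, l) * z l))"
    using assms by (intro sum.cong) (auto simp: mult_mat_vec_sum simp del: index_mult_mat_vec)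
  finally show ?thesis by (simp add: qform_def sum_distrib_left mult_ac)
qed

lemma resolvent_column_added:
  fixes z :: "nat \<Rightarrow> nat \<Rightarrow> real" and N :: nat
  assumes "finite J" "j \<notin> J" "c \<ge> 0" "t > 0"
  defines "q \<equiv> c * qform N (resolvent N t c J z) (z j)"
  shows "q \<ge> 0" "c * qform N (resolvent N t c (insert j J) z) (z j) = q / (1 + q)"
    and "mtrace (resolvent N t c (insert j J) z) \<le> mtrace (resolvent N t c J z)"
    and "mtrace (resolvent N t c J z) \<le> mtrace (resolvent N t c (insert j J) z) + 1 / t"
proof -
  have co: "coercive N t (shifted_gram N t c J z)" "coercive N t (shifted_gram N t c (insert j J) z)"
    using assms by (auto intro: shifted_gram_coercive)
  have R: "resolvent N t c J z \<in> carrier_mat N N" "resolvent N t c (insert j J) z \<in> carrier_mat N N"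
    unfolding resolvent_def using inv_mat_carrier co assms by blast+
  note rank_one_update_resolvent[OF co assms(4) _ assms(3) shifted_gram_insert[OF assms(1,2)],
      folded resolvent_def, simplified, unfolded qform_eq_scalar_prod[OF R(1)] qform_eq_scalar_prod[OF R(2)]]
  thus "q \<ge> 0" "c * qform N (resolvent N t c (insert j J) z) (z j) = q / (1 + q)"
    "mtrace (resolvent N t c (insert j J) z) \<le> mtrace (resolvent N t c J z)"
    "mtrace (resolvent N t c J z) \<le> mtrace (resolvent N t c (insert j J) z) + 1 / t"
    by (auto simp: q_def)
qed

text \<open>
  The trace of \<open>(t + c \<Sum>\<^sub>j z\<^sub>j z\<^sub>j\<^sup>T) R = 1\<close>.
\<close>

lemma resolvent_trace_identity:
  assumes "finite J" "c \<ge> 0" "t > 0"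
  shows "real N = t * mtrace (resolvent N t c J z) + (\<Sum>j\<in>J. c * qform N (resolvent N t c J z) (z j))"
proof -
  let ?G = "shifted_gram N t c J z" and ?R = "resolvent N t c J z"
  have co: "coercive N t ?G" using assms by (intro shifted_gram_coercive)
  have R: "?R \<in> carrier_mat N N" unfolding resolvent_def using inv_mat_carrier[OF co] assms by blast
  have GR: "?G * ?R = 1\<^sub>m N" unfolding resolvent_def using inv_mat_right[OF co] assms by blast
  have diag: "(\<Sum>l<N. ?G $$ (k, l) * ?R $$ (l, k)) = 1" if "k < N" for k
  proof -
    have "(?G * ?R) $$ (k, k) = (\<Sum>l<N. ?G $$ (k, l) * ?R $$ (l, k))"
      using that R by (simp add: scalar_prod_def atLeast0LessThan)
    moreover have "(?G * ?R) $$ (k, k) = 1" using GR that by simp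
    ultimately show ?thesis by simp
  qed
  have "real N = (\<Sum>k<N. \<Sum>l<N. ?G $$ (k, l) * ?R $$ (l, k))" by (simp add: diag)
  also have "\<dots> = (\<Sum>k<N. \<Sum>l<N. (if k = l then t * ?R $$ (l, k) else 0)
      + (\<Sum>j\<in>J. c * (?R $$ (l, k) * (z j l * z j k))))"
    by (intro sum.cong) (auto simp: shifted_gram_def algebra_simps sum_distrib_left)
  also have "\<dots> = (\<Sum>k<N. t * ?R $$ (k, k))
      + (\<Sum>k<N. \<Sum>l<N. \<Sum>j\<in>J. c * (?R $$ (l, k) * (z j l * z j k)))"
    by (simp add: sum.distrib sum.delta)
  also have "(\<Sum>k<N. t * ?R $$ (k, k)) = t * mtrace ?R"
    using R by (simp add: mtrace_def sum_distrib_left)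
  also have "(\<Sum>k<N. \<Sum>l<N. \<Sum>j\<in>J. c * (?R $$ (l, k) * (z j l * z j k)))
      = (\<Sum>l<N. \<Sum>k<N. \<Sum>j\<in>J. c * (?R $$ (l, k) * (z j l * z j k)))"
    by (rule sum.swap)
  also have "\<dots> = (\<Sum>l<N. \<Sum>j\<in>J. \<Sum>k<N. c * (?R $$ (l, k) * (z j l * z j k)))"
    by (intro sum.cong refl sum.swap)
  also have "\<dots> = (\<Sum>j\<in>J. \<Sum>l<N. \<Sum>k<N. c * (?R $$ (l, k) * (z j l * z j k)))"
    by (rule sum.swap)
  also have "\<dots> = (\<Sum>j\<in>J. c * qform N ?R (z j))"
    by (simp add: qform_def sum_distrib_left)
  finally show ?thesis .
qed

section \<open>Spectra of Gram matrices\<close>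

text \<open>
  The polynomial splits over the complex numbers, and each root \<open>a\<close> is real: for an eigenvector \<open>v\<close> the
  number \<open>v\<^sup>* A v = a |v|\<^sup>2\<close> is its own conjugate.
\<close>

lemma symmetric_char_poly_splits:
  fixes A :: "real mat"
  assumes A: "A \<in> carrier_mat N N" "A\<^sup>T = A"
  shows "\<exists>es. char_poly A = (\<Prod>e\<leftarrow>es. [:- e, 1:])"
proof -
  let ?B = "map_mat complex_of_real A"
  have B: "?B \<in> carrier_mat N N" using A by simp
  obtain as where as: "char_poly ?B = (\<Prod>a\<leftarrow>as. [:- a, 1:])"
    using char_poly_factorized[OF B] by blast
  have "Im a = 0" if a: "a \<in> set as" for a
  proof -
    have "poly (char_poly ?B) a = 0"
      unfolding as poly_prod_list using a by (auto simp: prod_list_zero_iff)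
    hence "eigenvalue ?B a" using eigenvalue_root_char_poly[OF B] by simp
    then obtain v where v: "v \<in> carrier_vec N" "v \<noteq> 0\<^sub>v N" "?B *\<^sub>v v = a \<cdot>\<^sub>v v"
      using A by (auto simp: eigenvalue_def eigenvector_def)
    have ev: "(\<Sum>l<N. complex_of_real (A $$ (k, l)) * v $ l) = a * v $ k" if k: "k < N" for k
    proof -
      have "(?B *\<^sub>v v) $ k = (\<Sum>l<N. complex_of_real (A $$ (k, l)) * v $ l)"
        using A v(1) k by (simp add: scalar_prod_def atLeast0LessThan)
      moreover have "(?B *\<^sub>v v) $ k = (a \<cdot>\<^sub>v v) $ k" using v(3) by (rule arg_cong)
      moreover have "(a \<cdot>\<^sub>v v) $ k = a * v $ k" using v(1) k by simp
      ultimately show ?thesis by simp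
    qed
    define s where "s = (\<Sum>k<N. \<Sum>l<N. cnj (v $ k) * (complex_of_real (A $$ (k, l)) * v $ l))"
    have "s = (\<Sum>k<N. cnj (v $ k) * (a * v $ k))"
      unfolding s_def sum_distrib_left[symmetric] by (intro sum.cong refl) (simp add: ev)
    hence s1: "s = a * (\<Sum>k<N. cnj (v $ k) * v $ k)"
      by (simp add: sum_distrib_left mult_ac)
    have sym: "A $$ (k, l) = A $$ (l, k)" if "k < N" "l < N" for k l
      using arg_cong[OF A(2), of "\<lambda>A. A $$ (k, l)"] A(1) that by simp
    have "cnj s = (\<Sum>k<N. \<Sum>l<N. v $ k * (complex_of_real (A $$ (k, l)) * cnj (v $ l)))"
      by (simp add: s_def)
    also have "\<dots> = (\<Sum>l<N. \<Sum>k<N. v $ k * (complex_of_real (A $$ (k, l)) * cnj (v $ l)))"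
      by (rule sum.swap)
    also have "\<dots> = s"
      unfolding s_def by (intro sum.cong refl) (auto simp: sym mult_ac)
    finally have cs: "cnj s = s" .
    define r where "r = (\<Sum>k<N. (cmod (v $ k))\<^sup>2)"
    have r: "(\<Sum>k<N. cnj (v $ k) * v $ k) = complex_of_real r"
      unfolding r_def of_real_sum by (intro sum.cong refl) (simp only: complex_norm_square mult.commute)
    have "r \<noteq> 0"
    proof
      assume "r = 0"
      hence "\<forall>k\<in>{..<N}. (cmod (v $ k))\<^sup>2 = 0"
        unfolding r_def by (subst (asm) sum_nonneg_eq_0_iff) auto
      hence "v = 0\<^sub>v N" using v(1) by (intro eq_vecI) auto
      thus False using v by simp
    qed
    moreover have "Im s = 0" using cs by (simp add: complex_eq_iff)
    ultimately show ?thesis using s1 r by simp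
  qed
  hence re: "complex_of_real (Re a) = a" if "a \<in> set as" for a using that by (simp add: complex_eq_iff)
  have "map_poly complex_of_real (\<Prod>e\<leftarrow>map Re as. [:- e, 1:]) = (\<Prod>a\<leftarrow>as. [:- a, 1:])"
  proof -
    interpret mp: map_poly_comm_ring_hom complex_of_real ..
    have "map_poly complex_of_real (\<Prod>e\<leftarrow>map Re as. [:- e, 1:])
        = (\<Prod>a\<leftarrow>as. map_poly complex_of_real [:- Re a, 1:])"
      unfolding mp.hom_prod_list by (simp add: o_def)
    also have "\<dots> = (\<Prod>a\<leftarrow>as. [:- a, 1:])"
      by (intro arg_cong[where f = prod_list] map_cong refl) (simp add: re)
    finally show ?thesis .
  qed
  also have "\<dots> = char_poly ?B" using as by simp
  also have "\<dots> = map_poly complex_of_real (char_poly A)"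
    by (rule of_real_hom.char_poly_hom[OF A(1)])
  finally have eq: "map_poly complex_of_real (\<Prod>e\<leftarrow>map Re as. [:- e, 1:])
      = map_poly complex_of_real (char_poly A)" .
  have "char_poly A = (\<Prod>e\<leftarrow>map Re as. [:- e, 1:])"
  proof (rule poly_eqI)
    fix k show "coeff (char_poly A) k = coeff (\<Prod>e\<leftarrow>map Re as. [:- e, 1:]) k"
      using arg_cong[OF eq, of "\<lambda>p. coeff p k"] by (simp add: coeff_map_poly del: map_map)
  qed
  thus ?thesis by blast
qed

lemma mtrace_mult_comm:
  assumes "A \<in> carrier_mat N N" "B \<in> carrier_mat N N"
  shows "mtrace (A * B) = mtrace (B * A)"
proof -
  have "mtrace (A * B) = (\<Sum>k<N. \<Sum>l<N. A $$ (k, l) * B $$ (l, k))"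
    using assms by (simp add: mtrace_def scalar_prod_def atLeast0LessThan)
  also have "\<dots> = (\<Sum>l<N. \<Sum>k<N. A $$ (k, l) * B $$ (l, k))" by (rule sum.swap)
  also have "\<dots> = mtrace (B * A)"
    using assms by (simp add: mtrace_def scalar_prod_def atLeast0LessThan mult.commute)
  finally show ?thesis .
qed

text \<open>
  Comparison of columns from left to right shows that \<open>V\<close> is upper triangular as well, so the diagonal
  entries of \<open>V U\<close> are the products of the diagonal entries.
\<close>

lemma upper_triangular_left_inverse_diag:
  fixes U V :: "real mat"
  assumes U: "U \<in> carrier_mat N N" "upper_triangular U" and V: "V \<in> carrier_mat N N" "V * U = 1\<^sub>m N"
    and j: "j < N"
  shows "V $$ (j, j) = 1 / U $$ (j, j)"
proof -
  have prod: "(\<Sum>k<N. V $$ (i, k) * U $$ (k, j)) = (if i = j then 1 else 0)" if "i < N" "j < N" for i j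
  proof -
    have "(V * U) $$ (i, j) = (\<Sum>k<N. V $$ (i, k) * U $$ (k, j))"
      using that U(1) V(1) by (simp add: scalar_prod_def atLeast0LessThan)
    moreover have "(V * U) $$ (i, j) = (1\<^sub>m N :: real mat) $$ (i, j)" using V(2) by simp
    ultimately show ?thesis using that by simp
  qed
  have tri: "U $$ (k, j) = 0" if "j < k" "k < N" for k j
    using U that by (auto simp: upper_triangular_def)
  have step: "V $$ (i, j) * U $$ (j, j) + (\<Sum>k<j. V $$ (i, k) * U $$ (k, j)) = (if i = j then 1 else 0)"
    if "i < N" "j < N" for i j
  proof -
    have "(\<Sum>k<N. V $$ (i, k) * U $$ (k, j)) = (\<Sum>k<Suc j. V $$ (i, k) * U $$ (k, j))"
      using that by (intro sum.mono_neutral_right) (auto simp: tri)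
    thus ?thesis using prod[OF that] by simp
  qed
  have zero: "\<forall>i. j < i \<longrightarrow> i < N \<longrightarrow> V $$ (i, j) = 0 " if "j < N" for j
    using that
  proof (induction j rule: less_induct)
    case (less j)
    have "V $$ (j, k) = 0" if "k < j" for k using less that by auto
    hence "(\<Sum>k<j. V $$ (j, k) * U $$ (k, j)) = 0" by simp
    hence "U $$ (j, j) \<noteq> 0" using step[OF less.prems less.prems] by auto
    moreover have "(\<Sum>k<j. V $$ (i, k) * U $$ (k, j)) = 0" if "j < i" "i < N" for i
      using less that by (intro sum.neutral) auto
    ultimately show ?case using step[OF _ less.prems] by fastforce
  qed
  have "(\<Sum>k<j. V $$ (j, k) * U $$ (k, j)) = 0" using zero j by (intro sum.neutral) auto
  hence "V $$ (j, j) * U $$ (j, j) = 1" using step[OF j j] by simp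
  thus ?thesis by (metis mult_zero_right nonzero_mult_div_cancel_right zero_neq_one)
qed

text \<open>
  A Schur decomposition \<open>A = P B Q\<close> conjugates the inverse of \<open>A + t\<close> to the inverse of the upper
  triangular matrix \<open>B + t\<close>, whose diagonal is known.
\<close>

lemma resolvent_trace_eigenvalues:
  fixes A :: "real mat"
  assumes A: "A \<in> carrier_mat N N" and sp: "char_poly A = (\<Prod>e\<leftarrow>es. [:- e, 1:])"
    and co: "coercive N t (A + t \<cdot>\<^sub>m 1\<^sub>m N)" and t: "t > 0"
  shows "mtrace (inv_mat (A + t \<cdot>\<^sub>m 1\<^sub>m N)) = (\<Sum>e\<leftarrow>es. 1 / (e + t))"
proof -
  obtain B P Q where d: "schur_decomposition A es = (B, P, Q)" by (metis prod_cases3)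
  have sd: "similar_mat_wit A B P Q" "upper_triangular B" "diag_mat B = es"
    using schur_decomposition[OF A sp d] by auto
  let ?G = "A + t \<cdot>\<^sub>m 1\<^sub>m N" and ?U = "B + t \<cdot>\<^sub>m 1\<^sub>m N"
  note w = similar_mat_witD2[OF A sd(1)]
  have c: "B \<in> carrier_mat N N" "P \<in> carrier_mat N N" "Q \<in> carrier_mat N N" using w by auto
  have U: "?U \<in> carrier_mat N N" "upper_triangular ?U"
    using c sd(2) by (auto simp: upper_triangular_def)
  have G: "?G \<in> carrier_mat N N" using A by simp
  let ?R = "inv_mat ?G"
  have R: "?R \<in> carrier_mat N N" using inv_mat_carrier[OF co t] .
  have "A * P = P * B"
  proof -
    have "A * P = P * B * (Q * P)"
      using w(3) c by (simp add: assoc_mult_mat[of _ N N _ N _ N])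
    thus ?thesis using w c by simp
  qed
  have "P * (t \<cdot>\<^sub>m 1\<^sub>m N) = t \<cdot>\<^sub>m P"
    using mult_smult_distrib[OF c(2) one_carrier_mat[of N]] c by simp
  hence comm: "?G * P = P * ?U"
    using A c \<open>A * P = P * B\<close>
    by (simp add: add_mult_distrib_mat[of _ N N] mult_add_distrib_mat[of _ N N]
        mult_smult_assoc_mat[of _ N N])
  let ?V = "Q * ?R * P"
  have V: "?V \<in> carrier_mat N N" using c R by simp
  have "?V * ?U = Q * (?R * (P * ?U))"
    using c R U by (simp add: assoc_mult_mat[of _ N N _ N _ N])
  also have "\<dots> = Q * ((?R * ?G) * P)"
    unfolding comm[symmetric] using c R G by (simp add: assoc_mult_mat[of _ N N _ N _ N])
  also have "\<dots> = 1\<^sub>m N" using inv_mat_left[OF co t] w c by simp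
  finally have VU: "?V * ?U = 1\<^sub>m N" .
  have "P * ?V = ?R * P"
  proof -
    have "P * ?V = (P * Q) * (?R * P)" using c R by (simp add: assoc_mult_mat[of _ N N _ N _ N])
    thus ?thesis using w c R by simp
  qed
  hence "P * ?V * Q = ?R * (P * Q)" using c R by (simp add: assoc_mult_mat[of _ N N _ N _ N])
  hence PVQ: "P * ?V * Q = ?R" using w R by simp
  have "mtrace ?R = mtrace (Q * (P * ?V))"
    using mtrace_mult_comm[of "P * ?V" N Q] c V PVQ by simp
  also have "Q * (P * ?V) = ?V"
  proof -
    have "Q * (P * ?V) = (Q * P) * ?V" using c V by (intro assoc_mult_mat[symmetric, of _ N N _ N _ N]) auto
    thus ?thesis using w V by simp
  qed
  also have "mtrace ?V = (\<Sum>k<N. ?V $$ (k, k))" by (simp only: mtrace_def carrier_matD(1)[OF V])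
  also have "\<dots> = (\<Sum>k<N. 1 / (B $$ (k, k) + t))"
  proof (intro sum.cong refl)
    fix k assume "k \<in> {..<N}"
    hence k: "k < N" by simp
    show "?V $$ (k, k) = 1 / (B $$ (k, k) + t)"
      unfolding upper_triangular_left_inverse_diag[OF U V VU k] using c k by simp
  qed
  also have "\<dots> = (\<Sum>e\<leftarrow>diag_mat B. 1 / (e + t))"
    using c by (simp add: diag_mat_def sum_list_distinct_conv_sum_set o_def atLeast0LessThan)
  finally show ?thesis using sd by simp
qed

lemma proots_linear_factors: "proots (\<Prod>e\<leftarrow>es. [:- e, 1:]) = mset es" for es :: "real list"
proof (induction es)
  case (Cons e es)
  have "(\<Prod>e\<leftarrow>es. [:- e, 1:]) \<noteq> 0" by (auto simp: prod_list_zero_iff)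
  thus ?case using Cons by (simp only: list.map prod_list.Cons, subst proots_mult) auto
qed simp

text \<open>
  Coercivity with shift \<open>0\<close> makes the eigenvalues non-negative.  The list is chosen before \<open>t\<close>, since
  different values of \<open>t\<close> are later evaluated on the same spectrum.
\<close>

lemma gram_spectrum:
  fixes N :: nat and z :: "nat \<Rightarrow> nat \<Rightarrow> real"
  assumes c: "c \<ge> 0" and J: "finite J"
  defines "S \<equiv> mat N N (\<lambda>(k, l). c * (\<Sum>j\<in>J. z j k * z j l))"
  obtains es where "proots (char_poly S) = mset es" "length es = N" "\<And>e. e \<in> set es \<Longrightarrow> e \<ge> 0"
    "\<And>t. t > 0 \<Longrightarrow> mtrace (resolvent N t c J z) = (\<Sum>e\<leftarrow>es. 1 / (e + t))"
proof -
  have S: "S \<in> carrier_mat N N" "S\<^sup>T = S"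
    by (auto simp: S_def mult.commute intro!: eq_matI)
  obtain es where es: "char_poly S = (\<Prod>e\<leftarrow>es. [:- e, 1:])" using symmetric_char_poly_splits[OF S] by blast
  have G: "shifted_gram N t c J z = S + t \<cdot>\<^sub>m 1\<^sub>m N" for t
    by (rule eq_matI) (auto simp: shifted_gram_def S_def)
  have co: "coercive N t (S + t \<cdot>\<^sub>m 1\<^sub>m N)" for t
    using shifted_gram_coercive[OF J c, of N t z] unfolding G .
  have S0: "S = S + 0 \<cdot>\<^sub>m 1\<^sub>m N" using S by (intro eq_matI) auto
  have nn: "e \<ge> 0" if e: "e \<in> set es" for e
  proof -
    have "poly (char_poly S) e = 0"
      unfolding es poly_prod_list using e by (auto simp: prod_list_zero_iff)
    hence "eigenvalue S e" using eigenvalue_root_char_poly[OF S(1)] by simp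
    then obtain v where v: "v \<in> carrier_vec N" "v \<noteq> 0\<^sub>v N" "S *\<^sub>v v = e \<cdot>\<^sub>v v"
      using S by (auto simp: eigenvalue_def eigenvector_def)
    have "0 \<le> scalar_prod v (S *\<^sub>v v)" using co[of 0] S0 v by (auto simp: coercive_def)
    hence "0 \<le> e * scalar_prod v v" using v by simp
    moreover have "scalar_prod v v > 0"
      using scalar_prod_self_nonneg[of v] scalar_prod_self_eq_0[of v] v by (metis less_eq_real_def)
    ultimately show ?thesis by (simp add: zero_le_mult_iff)
  qed
  have "degree (char_poly S) = N" using degree_monic_char_poly[OF S(1)] by simp
  hence "length es = N" using degree_linear_factors[of uminus es] es by simp
  moreover have "mtrace (resolvent N t c J z) = (\<Sum>e\<leftarrow>es. 1 / (e + t))" if "t > 0" for t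
    unfolding resolvent_def G by (rule resolvent_trace_eigenvalues[OF S(1) es co that])
  moreover have "proots (char_poly S) = mset es" unfolding es by (rule proots_linear_factors)
  ultimately show ?thesis using that nn by blast
qed

section \<open>The bounded differences inequality\<close>

text \<open>
  If two values of \<open>X\<close> differ by at most \<open>c\<close>, then \<open>X\<close> differs from its mean by at most \<open>c\<close>, and
  Hoeffding's lemma applies on the interval from \<open>-c\<close> to \<open>c\<close>.
\<close>

lemma exp_moment_centered_le:
  fixes X :: "'b \<Rightarrow> real"
  assumes "prob_space Q" and [measurable]: "X \<in> borel_measurable Q"
    and bd: "\<And>y y'. y \<in> space Q \<Longrightarrow> y' \<in> space Q \<Longrightarrow> \<bar>X y - X y'\<bar> \<le> c" and s: "s > 0"
    and B: "\<And>y. y \<in> space Q \<Longrightarrow> \<bar>X y\<bar> \<le> B"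
  shows "(\<integral>\<^sup>+y. ennreal (exp (s * X y)) \<partial>Q)
     \<le> ennreal (exp (s\<^sup>2 * c\<^sup>2 / 2)) * ennreal (exp (s * (\<integral>y. X y \<partial>Q)))"
proof -
  interpret prob_space Q by fact
  let ?m = "\<integral>y. X y \<partial>Q"
  have int: "integrable Q X" by (rule integrable_const_bound[of _ B]) (auto simp: B)
  have dev: "\<bar>X y - ?m\<bar> \<le> c" if y: "y \<in> space Q" for y
  proof -
    have "X y - ?m = (\<integral>y'. X y - X y' \<partial>Q)"
      using int by (simp add: prob_space)
    also have "\<bar>\<dots>\<bar> \<le> (\<integral>y'. \<bar>X y - X y'\<bar> \<partial>Q)" by (rule integral_abs_bound)
    also have "\<dots> \<le> (\<integral>y'. c \<partial>Q)"
      using int y bd by (intro integral_mono) auto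
    finally show ?thesis by (simp add: prob_space)
  qed
  interpret Y: interval_bounded_random_variable Q "\<lambda>y. X y - ?m" "- c" c
  proof unfold_locales
    show "AE y in Q. X y - ?m \<in> {- c..c}" using dev by (intro AE_I2) (force simp: abs_le_iff)
  qed auto
  have "(\<integral>\<^sup>+y. ennreal (exp (s * (X y - ?m))) \<partial>Q) \<le> ennreal (exp (s\<^sup>2 * (c - (- c))\<^sup>2 / 8))"
    using int by (intro Y.Hoeffdings_lemma_nn_integral_0 s) (simp add: prob_space)
  also have "s\<^sup>2 * (c - (- c))\<^sup>2 / 8 = s\<^sup>2 * c\<^sup>2 / 2" by (simp add: power2_eq_square)
  finally have h: "(\<integral>\<^sup>+y. ennreal (exp (s * (X y - ?m))) \<partial>Q) \<le> ennreal (exp (s\<^sup>2 * c\<^sup>2 / 2))" .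
  have "(\<integral>\<^sup>+y. ennreal (exp (s * X y)) \<partial>Q)
      = (\<integral>\<^sup>+y. ennreal (exp (s * (X y - ?m))) * ennreal (exp (s * ?m)) \<partial>Q)"
    by (intro nn_integral_cong) (simp add: ennreal_mult'[symmetric] exp_add[symmetric] algebra_simps)
  also have "\<dots> = (\<integral>\<^sup>+y. ennreal (exp (s * (X y - ?m))) \<partial>Q) * ennreal (exp (s * ?m))"
    by (rule nn_integral_multc) simp
  finally show ?thesis using h by (simp add: mult_right_mono)
qed

text \<open>
  Coordinates are integrated out one at a time: the conditional mean \<open>g\<close> of \<open>f\<close> given the remaining
  coordinates has bounded differences with the same constant.
\<close>

lemma bounded_differences_exp_moment:
  fixes f :: "('i \<Rightarrow> 'b) \<Rightarrow> real"
  assumes Q: "prob_space Q" and "finite I" and f: "f \<in> borel_measurable (PiM I (\<lambda>_. Q))"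
    and B: "\<And>z. z \<in> space (PiM I (\<lambda>_. Q)) \<Longrightarrow> \<bar>f z\<bar> \<le> B"
    and c: "\<And>z i y. z \<in> space (PiM I (\<lambda>_. Q)) \<Longrightarrow> i \<in> I \<Longrightarrow> y \<in> space Q \<Longrightarrow> \<bar>f (z(i := y)) - f z\<bar> \<le> c"
    and s: "s > 0"
  shows "(\<integral>\<^sup>+z. ennreal (exp (s * f z)) \<partial>PiM I (\<lambda>_. Q))
     \<le> ennreal (exp (real (card I) * (s\<^sup>2 * c\<^sup>2 / 2))) * ennreal (exp (s * (\<integral>z. f z \<partial>PiM I (\<lambda>_. Q))))"
  using \<open>finite I\<close> f B c
proof (induction I arbitrary: f rule: finite_induct)
  case empty
  interpret product_sigma_finite "\<lambda>_. Q"
    using Q by (simp add: product_sigma_finite_def prob_space_imp_sigma_finite)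
  show ?case by (simp add: PiM_empty nn_integral_count_space_finite lebesgue_integral_count_space_finite)
next
  case (insert i I)
  interpret Q: prob_space Q by fact
  interpret product_sigma_finite "\<lambda>_. Q"
    using Q by (simp add: product_sigma_finite_def prob_space_imp_sigma_finite)
  interpret PI: prob_space "PiM (insert i I) (\<lambda>_. Q)" using Q by (intro prob_space_PiM)
  let ?PI = "PiM I (\<lambda>_. Q)" and ?PJ = "PiM (insert i I) (\<lambda>_. Q)"
  note [measurable] = insert.prems(1)
  define g where "g = (\<lambda>z. \<integral>y. f (z(i := y)) \<partial>Q)"
  have upd: "z(i := y) \<in> space ?PJ" if "z \<in> space ?PI" "y \<in> space Q" for z y
    using that by (auto simp: space_PiM PiE_iff extensional_def)
  have meas: "(\<lambda>y. f (z(i := y))) \<in> borel_measurable Q" if z: "z \<in> space ?PI" for z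
    using z insert.hyps by measurable
  have g_meas [measurable]: "g \<in> borel_measurable ?PI"
    unfolding g_def by measurable
  have intQ: "integrable Q (\<lambda>y. f (z(i := y)))" if z: "z \<in> space ?PI" for z
    using meas[OF z] insert.prems(2) upd[OF z] by (intro Q.integrable_const_bound[of _ B]) auto
  have gB: "\<bar>g z\<bar> \<le> B" if z: "z \<in> space ?PI" for z
  proof -
    have "\<bar>g z\<bar> \<le> (\<integral>y. \<bar>f (z(i := y))\<bar> \<partial>Q)" unfolding g_def by (rule integral_abs_bound)
    also have "\<dots> \<le> (\<integral>y. B \<partial>Q)"
      using intQ[OF z] insert.prems(2) upd[OF z] by (intro integral_mono) auto
    finally show ?thesis by (simp add: Q.prob_space)
  qed
  have gc: "\<bar>g (z(j := y)) - g z\<bar> \<le> c" if z: "z \<in> space ?PI" and j: "j \<in> I" and y: "y \<in> space Q" for z j y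
  proof -
    have z': "z(j := y) \<in> space ?PI" using z j y by (auto simp: space_PiM PiE_iff extensional_def)
    have ji: "j \<noteq> i" using j insert.hyps by auto
    have "g (z(j := y)) - g z = (\<integral>y'. f (z(j := y, i := y')) - f (z(i := y')) \<partial>Q)"
      unfolding g_def using intQ[OF z] intQ[OF z'] by simp
    also have "\<bar>\<dots>\<bar> \<le> (\<integral>y'. \<bar>f (z(j := y, i := y')) - f (z(i := y'))\<bar> \<partial>Q)" by (rule integral_abs_bound)
    also have "\<dots> \<le> (\<integral>y'. c \<partial>Q)"
    proof (intro integral_mono)
      fix y' assume y': "y' \<in> space Q"
      have "z(j := y, i := y') = (z(i := y'))(j := y)" using ji by (rule fun_upd_twist)
      show "\<bar>f (z(j := y, i := y')) - f (z(i := y'))\<bar> \<le> c"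
        unfolding \<open>z(j := y, i := y') = _\<close>
        by (rule insert.prems(3)) (use upd[OF z y'] j y in \<open>simp_all del: fun_upd_apply\<close>)
    qed (use intQ[OF z] intQ[OF z'] in auto)
    finally show ?thesis by (simp add: Q.prob_space)
  qed
  have cond: "(\<integral>\<^sup>+y. ennreal (exp (s * f (z(i := y)))) \<partial>Q)
      \<le> ennreal (exp (s\<^sup>2 * c\<^sup>2 / 2)) * ennreal (exp (s * g z))" if z: "z \<in> space ?PI" for z
    unfolding g_def
  proof (rule exp_moment_centered_le[OF Q meas[OF z] _ s])
    fix y y' assume y: "y \<in> space Q" "y' \<in> space Q"
    have "\<bar>f ((z(i := y'))(i := y)) - f (z(i := y'))\<bar> \<le> c"
      by (rule insert.prems(3)) (use upd[OF z y(2)] y in \<open>simp_all del: fun_upd_apply\<close>)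
    thus "\<bar>f (z(i := y)) - f (z(i := y'))\<bar> \<le> c" by simp
  qed (use insert.prems(2) upd[OF z] in auto)
  have "(\<integral>\<^sup>+z. ennreal (exp (s * f z)) \<partial>?PJ)
      = (\<integral>\<^sup>+z. \<integral>\<^sup>+y. ennreal (exp (s * f (z(i := y)))) \<partial>Q \<partial>?PI)"
    by (rule product_nn_integral_insert) (use insert.hyps in auto)
  also have "\<dots> \<le> (\<integral>\<^sup>+z. ennreal (exp (s\<^sup>2 * c\<^sup>2 / 2)) * ennreal (exp (s * g z)) \<partial>?PI)"
    by (intro nn_integral_mono cond)
  also have "\<dots> = ennreal (exp (s\<^sup>2 * c\<^sup>2 / 2)) * (\<integral>\<^sup>+z. ennreal (exp (s * g z)) \<partial>?PI)"
    by (rule nn_integral_cmult) simp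
  also have "\<dots> \<le> ennreal (exp (s\<^sup>2 * c\<^sup>2 / 2)) * (ennreal (exp (real (card I) * (s\<^sup>2 * c\<^sup>2 / 2)))
      * ennreal (exp (s * (\<integral>z. g z \<partial>?PI))))"
    by (intro mult_left_mono insert.IH g_meas gB gc) auto
  also have "(\<integral>z. g z \<partial>?PI) = (\<integral>z. f z \<partial>?PJ)"
    unfolding g_def using insert.hyps insert.prems
    by (intro product_integral_insert[symmetric] PI.integrable_const_bound[of _ B]) auto
  finally show ?case
    using insert.hyps by (simp add: ennreal_mult'[symmetric] exp_add[symmetric] algebra_simps add_divide_distrib)
qed

lemma bounded_differences_upper_tail:
  fixes f :: "('i \<Rightarrow> 'b) \<Rightarrow> real"
  assumes Q: "prob_space Q" and "finite I" "I \<noteq> {}" and f: "f \<in> borel_measurable (PiM I (\<lambda>_. Q))"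
    and B: "\<And>z. z \<in> space (PiM I (\<lambda>_. Q)) \<Longrightarrow> \<bar>f z\<bar> \<le> B"
    and c: "\<And>z i y. z \<in> space (PiM I (\<lambda>_. Q)) \<Longrightarrow> i \<in> I \<Longrightarrow> y \<in> space Q \<Longrightarrow> \<bar>f (z(i := y)) - f z\<bar> \<le> c"
    and c0: "c > 0" and \<epsilon>: "\<epsilon> > 0"
  shows "measure (PiM I (\<lambda>_. Q)) {z \<in> space (PiM I (\<lambda>_. Q)). f z \<ge> (\<integral>z. f z \<partial>PiM I (\<lambda>_. Q)) + \<epsilon>}
     \<le> exp (- (\<epsilon>\<^sup>2 / (2 * real (card I) * c\<^sup>2)))"
proof -
  let ?P = "PiM I (\<lambda>_. Q)"
  interpret prob_space ?P using Q by (intro prob_space_PiM)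
  note [measurable] = f
  let ?m = "\<integral>z. f z \<partial>?P"
  have n: "card I > 0" using assms by (simp add: card_gt_0_iff)
  \<comment> \<open>The minimizer of the Chernoff exponent \<open>card I s\<^sup>2 c\<^sup>2/2 - s \<epsilon>\<close>.\<close>
  define s where "s = \<epsilon> / (real (card I) * c\<^sup>2)"
  have s: "s > 0" using n c0 \<epsilon> by (simp add: s_def)
  let ?A = "{z \<in> space ?P. f z \<ge> ?m + \<epsilon>}"
  have "emeasure ?P ?A = (\<integral>\<^sup>+z. indicator ?A z \<partial>?P)" by simp
  also have "\<dots> \<le> (\<integral>\<^sup>+z. ennreal (exp (- s * (?m + \<epsilon>))) * ennreal (exp (s * f z)) \<partial>?P)"
  proof (intro nn_integral_mono)
    fix z
    have "1 \<le> exp (- s * (?m + \<epsilon>)) * exp (s * f z)" if "f z \<ge> ?m + \<epsilon>"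
      using that s by (simp add: exp_add[symmetric])
    thus "indicator ?A z \<le> ennreal (exp (- s * (?m + \<epsilon>))) * ennreal (exp (s * f z))"
      by (auto simp: indicator_def ennreal_mult'[symmetric] simp del: ennreal_1 simp flip: ennreal_1)
  qed
  also have "\<dots> = ennreal (exp (- s * (?m + \<epsilon>))) * (\<integral>\<^sup>+z. ennreal (exp (s * f z)) \<partial>?P)"
    by (rule nn_integral_cmult) simp
  also have "\<dots> \<le> ennreal (exp (- s * (?m + \<epsilon>))) *
      (ennreal (exp (real (card I) * (s\<^sup>2 * c\<^sup>2 / 2))) * ennreal (exp (s * ?m)))"
    by (intro mult_left_mono bounded_differences_exp_moment[OF Q assms(2) f B c s]) auto
  also have "\<dots> = ennreal (exp (real (card I) * (s\<^sup>2 * c\<^sup>2 / 2) - s * \<epsilon>))"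
    by (simp add: ennreal_mult'[symmetric] exp_add[symmetric] algebra_simps)
  also have "real (card I) * (s\<^sup>2 * c\<^sup>2 / 2) - s * \<epsilon> = - (\<epsilon>\<^sup>2 / (2 * real (card I) * c\<^sup>2))"
    unfolding s_def using n c0 by (simp add: field_simps power2_eq_square)
  finally show ?thesis by (simp add: emeasure_eq_measure)
qed

text \<open>
  McDiarmid's inequality for equal constants and identical factors, up to the constant in the exponent.
\<close>

theorem bounded_differences_inequality:
  fixes f :: "('i \<Rightarrow> 'b) \<Rightarrow> real"
  assumes Q: "prob_space Q" and "finite I" "I \<noteq> {}" and f: "f \<in> borel_measurable (PiM I (\<lambda>_. Q))"
    and B: "\<And>z. z \<in> space (PiM I (\<lambda>_. Q)) \<Longrightarrow> \<bar>f z\<bar> \<le> B"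
    and c: "\<And>z i y. z \<in> space (PiM I (\<lambda>_. Q)) \<Longrightarrow> i \<in> I \<Longrightarrow> y \<in> space Q \<Longrightarrow> \<bar>f (z(i := y)) - f z\<bar> \<le> c"
    and c0: "c > 0" and \<epsilon>: "\<epsilon> > 0"
  shows "measure (PiM I (\<lambda>_. Q)) {z \<in> space (PiM I (\<lambda>_. Q)). \<bar>f z - (\<integral>z. f z \<partial>PiM I (\<lambda>_. Q))\<bar> \<ge> \<epsilon>}
     \<le> 2 * exp (- (\<epsilon>\<^sup>2 / (2 * real (card I) * c\<^sup>2)))"
proof -
  let ?P = "PiM I (\<lambda>_. Q)"
  interpret prob_space ?P using Q by (intro prob_space_PiM)
  note [measurable] = f
  let ?m = "\<integral>z. f z \<partial>?P"
  let ?A = "{z \<in> space ?P. f z \<ge> ?m + \<epsilon>}" and ?B = "{z \<in> space ?P. - f z \<ge> (\<integral>z. - f z \<partial>?P) + \<epsilon>}"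
  have "{z \<in> space ?P. \<bar>f z - ?m\<bar> \<ge> \<epsilon>} \<subseteq> ?A \<union> ?B" by auto
  hence "prob {z \<in> space ?P. \<bar>f z - ?m\<bar> \<ge> \<epsilon>} \<le> prob (?A \<union> ?B)"
    by (intro finite_measure_mono) auto
  also have "\<dots> \<le> prob ?A + prob ?B" by (intro measure_Un_le) auto
  also have "prob ?A \<le> exp (- (\<epsilon>\<^sup>2 / (2 * real (card I) * c\<^sup>2)))"
    by (rule bounded_differences_upper_tail[OF assms])
  also have "prob ?B \<le> exp (- (\<epsilon>\<^sup>2 / (2 * real (card I) * c\<^sup>2)))"
    by (rule bounded_differences_upper_tail[OF Q assms(2,3) _ _ _ c0 \<epsilon>, where B = B])
       (use B c in \<open>auto simp: abs_minus_commute\<close>)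
  finally show ?thesis by simp
qed

section \<open>Concentration and mean of the Stieltjes transform\<close>

lemma det_measurable:
  assumes c: "\<And>z. z \<in> space M \<Longrightarrow> A z \<in> carrier_mat N N"
    and m: "\<And>i j. i < N \<Longrightarrow> j < N \<Longrightarrow> (\<lambda>z. A z $$ (i, j)) \<in> borel_measurable M"
  shows "(\<lambda>z. Determinant.det (A z :: real mat)) \<in> borel_measurable M"
proof -
  have "(\<lambda>z. \<Sum>\<pi> | \<pi> permutes {0..<N}. signof \<pi> * (\<Prod>i = 0..<N. A z $$ (i, \<pi> i))) \<in> borel_measurable M"
  proof (intro borel_measurable_sum borel_measurable_times borel_measurable_const borel_measurable_prod m)
    fix \<pi> i assume "\<pi> \<in> {\<pi>. \<pi> permutes {0..<N}}" "i \<in> {0..<N}"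
    thus "\<pi> i < N" "i < N" using permutes_in_image[of \<pi> "{0..<N}" i] by auto
  qed
  moreover have "Determinant.det (A z) = (\<Sum>\<pi> | \<pi> permutes {0..<N}. signof \<pi> * (\<Prod>i = 0..<N. A z $$ (i, \<pi> i)))"
    if "z \<in> space M" for z
    using det_def'[OF c[OF that]] .
  ultimately show ?thesis using measurable_cong by (metis (no_types, lifting))
qed

lemma inv_mat_measurable:
  assumes c: "\<And>z. z \<in> space M \<Longrightarrow> A z \<in> carrier_mat N N"
    and m: "\<And>i j. i < N \<Longrightarrow> j < N \<Longrightarrow> (\<lambda>z. A z $$ (i, j)) \<in> borel_measurable M"
    and kl: "k < N" "l < N"
  shows "(\<lambda>z. inv_mat (A z) $$ (k, l)) \<in> borel_measurable M"
proof -
  have [measurable]: "(\<lambda>z. Determinant.det (A z)) \<in> borel_measurable M" by (rule det_measurable[OF c m])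
  have [measurable]: "(\<lambda>z. Determinant.det (mat_delete (A z) l k)) \<in> borel_measurable M"
  proof (rule det_measurable[where N = "N - 1"])
    show "mat_delete (A z) l k \<in> carrier_mat (N - 1) (N - 1)" if "z \<in> space M" for z
      using mat_delete_carrier[OF c[OF that]] .
    fix i j assume ij: "i < N - 1" "j < N - 1"
    let ?i = "if i < l then i else Suc i" and ?j = "if j < k then j else Suc j"
    have "(\<lambda>z. A z $$ (?i, ?j)) \<in> borel_measurable M" by (rule m) (use ij in auto)
    moreover have "mat_delete (A z) l k $$ (i, j) = A z $$ (?i, ?j)" if "z \<in> space M" for z
      using c[OF that] ij by (simp add: mat_delete_def)
    ultimately show "(\<lambda>z. mat_delete (A z) l k $$ (i, j)) \<in> borel_measurable M"
      using measurable_cong by (metis (no_types, lifting))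
  qed
  have "(\<lambda>z. 1 / Determinant.det (A z) * ((-1) ^ (l + k) * Determinant.det (mat_delete (A z) l k))) \<in> borel_measurable M"
    by measurable
  moreover have "inv_mat (A z) $$ (k, l) = 1 / Determinant.det (A z) * ((-1) ^ (l + k) * Determinant.det (mat_delete (A z) l k))"
    if "z \<in> space M" for z
    using c[OF that] kl by (simp add: inv_mat_def adj_mat_def cofactor_def)
  ultimately show ?thesis using measurable_cong by (metis (no_types, lifting))
qed

lemma column_entry_measurable:
  assumes "sets Q = sets (PiM {..<N} (\<lambda>_. borel))" "k < N" "j \<in> I"
  shows "(\<lambda>z. z j k) \<in> borel_measurable (PiM I (\<lambda>_. Q))"
proof -
  have [measurable]: "(\<lambda>y. y k) \<in> borel_measurable Q"
    using assms by (subst measurable_cong_sets[OF assms(1) refl]) measurable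
  show ?thesis using assms by measurable
qed

lemma resolvent_measurable:
  assumes "sets Q = sets (PiM {..<N} (\<lambda>_. borel))" "J \<subseteq> I" "k < N" "l < N"
  shows "(\<lambda>z. resolvent N t c J z $$ (k, l)) \<in> borel_measurable (PiM I (\<lambda>_. Q))"
  unfolding resolvent_def
proof (rule inv_mat_measurable)
  fix i j assume ij: "i < N" "j < N"
  have eq: "(\<lambda>z. shifted_gram N t c J z $$ (i, j)) = (\<lambda>z. (if i = j then t else 0) + c * (\<Sum>r\<in>J. z r i * z r j))"
    using ij by (intro ext) (simp add: shifted_gram_def)
  show "(\<lambda>z. shifted_gram N t c J z $$ (i, j)) \<in> borel_measurable (PiM I (\<lambda>_. Q))"
    unfolding eq using assms ij by (intro borel_measurable_add borel_measurable_times borel_measurable_sum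
        borel_measurable_const column_entry_measurable[OF assms(1)]) auto
qed (use assms in auto)

lemma resolvent_carrier:
  assumes "finite J" "c \<ge> 0" "t > 0"
  shows "resolvent N t c J z \<in> carrier_mat N N"
  unfolding resolvent_def using inv_mat_carrier[OF shifted_gram_coercive] assms by blast

lemma resolvent_cong:
  assumes "\<And>j k. j \<in> J \<Longrightarrow> k < N \<Longrightarrow> z j k = z' j k"
  shows "resolvent N t c J z = resolvent N t c J z'"
proof -
  have "shifted_gram N t c J z = shifted_gram N t c J z'"
    unfolding shifted_gram_def by (rule eq_matI) (auto simp: assms intro!: sum.cong)
  thus ?thesis by (simp add: resolvent_def)
qed

lemma resolvent_trace_measurable:
  assumes "sets Q = sets (PiM {..<N} (\<lambda>_. borel))" "J \<subseteq> I" "finite J" "c \<ge> 0" "t > 0"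
  shows "(\<lambda>z. mtrace (resolvent N t c J z)) \<in> borel_measurable (PiM I (\<lambda>_. Q))"
  unfolding mtrace_def carrier_matD(1)[OF resolvent_carrier[OF assms(3-5)]]
  by (intro borel_measurable_sum resolvent_measurable[OF assms(1,2)]) auto

lemma qform_measurable:
  assumes "sets Q = sets (PiM {..<N} (\<lambda>_. borel))" "J \<subseteq> I" "j \<in> I"
  shows "(\<lambda>z. qform N (resolvent N t c J z) (z j)) \<in> borel_measurable (PiM I (\<lambda>_. Q))"
  unfolding qform_def
  by (intro borel_measurable_sum borel_measurable_times resolvent_measurable[OF assms(1,2)]
      column_entry_measurable[OF assms(1)]) (use assms in auto)

lemma resolvent_trace_bounds:
  assumes "finite J" "c \<ge> 0" "t > 0"
  shows "0 \<le> mtrace (resolvent N t c J z)" "mtrace (resolvent N t c J z) \<le> real N / t"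
  unfolding resolvent_def using inv_mat_trace_bounds[OF shifted_gram_coercive] assms by blast+

text \<open>
  Both resolvents arise from the one without column \<open>j\<close> by adding a column, and each of the two
  additions lowers the trace by an amount between \<open>0\<close> and \<open>1/t\<close>.
\<close>

lemma resolvent_trace_change_column:
  fixes z :: "nat \<Rightarrow> nat \<Rightarrow> real"
  assumes J: "finite J" "j \<in> J" and c: "c \<ge> 0" and t: "t > 0"
  shows "\<bar>mtrace (resolvent N t c J (z(j := y))) - mtrace (resolvent N t c J z)\<bar> \<le> 1 / t"
proof -
  let ?K = "J - {j}"
  have K: "finite ?K" "j \<notin> ?K" and ins: "insert j ?K = J" using J by auto
  have "resolvent N t c ?K (z(j := y)) = resolvent N t c ?K z" by (rule resolvent_cong) auto
  thus ?thesis
    using resolvent_column_added(3,4)[OF K c t, of N z] resolvent_column_added(3,4)[OF K c t, of N "z(j := y)"]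
    unfolding ins by (simp add: abs_le_iff)
qed

text \<open>
  The bounded differences of the normalized trace are \<open>1/(t N)\<close>, in \<open>p\<close> independent columns.  The exponent is
  of order \<open>N\<^sup>2/p\<close>, that is, of order \<open>N\<close> when \<open>N/p\<close> stays bounded away from \<open>0\<close>.
\<close>

lemma stieltjes_concentration:
  assumes Q: "prob_space Q" "sets Q = sets (PiM {..<N} (\<lambda>_. borel))" and t: "t > 0" and p: "p \<ge> 1" and N: "N \<ge> 1"
    and \<epsilon>: "\<epsilon> > 0"
  defines "PM \<equiv> PiM {..<p} (\<lambda>_. Q)"
    and "F \<equiv> \<lambda>z. mtrace (resolvent N t (1 / real p) {..<p} z) / real N"
  shows "measure PM {z \<in> space PM. \<bar>F z - (\<integral>z. F z \<partial>PM)\<bar> \<ge> \<epsilon>}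
     \<le> 2 * exp (- (\<epsilon>\<^sup>2 * t\<^sup>2 * (real N)\<^sup>2 / (2 * real p)))"
proof -
  have "measure PM {z \<in> space PM. \<bar>F z - (\<integral>z. F z \<partial>PM)\<bar> \<ge> \<epsilon>}
      \<le> 2 * exp (- (\<epsilon>\<^sup>2 / (2 * real (card {..<p}) * (1 / (t * real N))\<^sup>2)))"
    unfolding PM_def
  proof (rule bounded_differences_inequality[OF Q(1)])
    show "F \<in> borel_measurable (PiM {..<p} (\<lambda>_. Q))"
      unfolding F_def using Q t by (intro borel_measurable_divide resolvent_trace_measurable) auto
    show "\<bar>F z\<bar> \<le> 1 / t" for z
      using resolvent_trace_bounds[of "{..<p}" "1 / real p" t N z] t N
      by (simp add: F_def field_simps)
    fix z i y assume "i \<in> {..<p}"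
    hence "\<bar>mtrace (resolvent N t (1 / real p) {..<p} (z(i := y))) - mtrace (resolvent N t (1 / real p) {..<p} z)\<bar> \<le> 1 / t"
      using t by (intro resolvent_trace_change_column) auto
    hence "\<bar>mtrace (resolvent N t (1 / real p) {..<p} (z(i := y))) - mtrace (resolvent N t (1 / real p) {..<p} z)\<bar> / real N
        \<le> 1 / t / real N" by (rule divide_right_mono) simp
    thus "\<bar>F (z(i := y)) - F z\<bar> \<le> 1 / (t * real N)"
      by (simp add: F_def diff_divide_distrib[symmetric])
  qed (use t p N \<epsilon> in \<open>auto simp: lessThan_empty_iff\<close>)
  also have "\<epsilon>\<^sup>2 / (2 * real (card {..<p}) * (1 / (t * real N))\<^sup>2) = \<epsilon>\<^sup>2 * t\<^sup>2 * (real N)\<^sup>2 / (2 * real p)"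
    using t N by (simp add: field_simps power_mult_distrib)
  finally show ?thesis .
qed

lemma abs_deviation_le_of_tail:
  fixes F :: "'b \<Rightarrow> real"
  assumes "prob_space M" and [measurable]: "F \<in> borel_measurable M"
    and bd: "\<And>z. z \<in> space M \<Longrightarrow> 0 \<le> F z \<and> F z \<le> B" and \<epsilon>: "\<epsilon> > 0"
    and tail: "measure M {z \<in> space M. \<bar>F z - (\<integral>z. F z \<partial>M)\<bar> \<ge> \<epsilon>} \<le> \<tau>"
  shows "(\<integral>z. \<bar>F z - (\<integral>z. F z \<partial>M)\<bar> \<partial>M) \<le> \<epsilon> + B * \<tau>"
proof -
  interpret prob_space M by fact
  let ?m = "\<integral>z. F z \<partial>M" and ?A = "{z \<in> space M. \<bar>F z - (\<integral>z. F z \<partial>M)\<bar> \<ge> \<epsilon>}"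
  have int: "integrable M F" by (rule integrable_const_bound[of _ B]) (use bd in \<open>auto intro!: AE_I2\<close>)
  have m: "0 \<le> ?m" "?m \<le> B"
    using bd int by (auto intro!: integral_nonneg_AE AE_I2 integral_le_const)
  have A: "?A \<in> sets M" by measurable
  obtain z0 where "z0 \<in> space M" using not_empty by auto
  hence B0: "B \<ge> 0" using bd[of z0] by linarith
  have "(\<integral>z. \<bar>F z - ?m\<bar> \<partial>M) \<le> (\<integral>z. \<epsilon> + B * indicator ?A z \<partial>M)"
  proof (rule integral_mono)
    fix z assume z: "z \<in> space M"
    have "\<bar>F z - ?m\<bar> \<le> B" using bd[OF z] m by (auto simp: abs_le_iff)
    thus "\<bar>F z - ?m\<bar> \<le> \<epsilon> + B * indicator ?A z" using \<epsilon> z B0 by (auto simp: indicator_def)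
  qed (use int A in \<open>auto intro!: integrable_real_mult_indicator integrable_real_indicator simp: less_top[symmetric]\<close>)
  also have "\<dots> = \<epsilon> + B * measure M ?A"
    using A by (subst Bochner_Integration.integral_add)
      (auto intro!: integrable_real_indicator simp: prob_space less_top[symmetric] Int_absorb1 sets.sets_into_space)
  also have "\<dots> \<le> \<epsilon> + B * \<tau>" using tail B0 by (intro add_left_mono mult_left_mono)
  finally show ?thesis .
qed

lemma rational_map_lipschitz:
  fixes x y :: real
  assumes "x \<ge> 0" "y \<ge> 0"
  shows "\<bar>x / (1 + x) - y / (1 + y)\<bar> \<le> \<bar>x - y\<bar>"
proof -
  have "x / (1 + x) - y / (1 + y) = (x - y) / ((1 + x) * (1 + y))"
    using assms by (simp add: divide_simps) (simp add: algebra_simps)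
  moreover have "1 * 1 \<le> (1 + x) * (1 + y)" using assms by (intro mult_mono) auto
  ultimately show ?thesis
    using assms by (simp add: abs_mult divide_le_eq mult_le_cancel_left1 mult.commute)
qed

text \<open>
  The resolvent without column \<open>j\<close> is a fixed matrix once the other columns are fixed, so the
  assumption on deterministic matrices can be used under the integral over column \<open>j\<close>.
\<close>

lemma leave_one_out_quadratic_form:
  assumes Q: "prob_space Q" "sets Q = sets (PiM {..<N} (\<lambda>_. borel))" and t: "t > 0" and c: "c \<ge> 0"
    and j: "j < p" and \<delta>0: "\<delta> \<ge> 0"
    and \<delta>: "\<And>B. (\<Sum>k<N. \<Sum>l<N. (B $$ (k, l))\<^sup>2) \<le> real N / t\<^sup>2 \<Longrightarrow>
       (\<integral>\<^sup>+y. ennreal \<bar>c * qform N B y - c * (\<Sum>k<N. B $$ (k, k))\<bar> \<partial>Q) \<le> ennreal \<delta>"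
  defines "J \<equiv> {..<p} - {j}"
  shows "(\<integral>\<^sup>+z. ennreal \<bar>c * qform N (resolvent N t c J z) (z j) - c * mtrace (resolvent N t c J z)\<bar>
      \<partial>PiM {..<p} (\<lambda>_. Q)) \<le> ennreal \<delta>"
proof -
  interpret Q: prob_space Q by fact
  interpret product_sigma_finite "\<lambda>_. Q"
    using Q by (simp add: product_sigma_finite_def prob_space_imp_sigma_finite)
  interpret PJ: prob_space "PiM J (\<lambda>_. Q)" using Q by (intro prob_space_PiM)
  have ins: "insert j J = {..<p}" and J: "finite J" "j \<notin> J" using j by (auto simp: J_def)
  let ?f = "\<lambda>z. ennreal \<bar>c * qform N (resolvent N t c J z) (z j) - c * mtrace (resolvent N t c J z)\<bar>"
  have meas: "?f \<in> borel_measurable (PiM (insert j J) (\<lambda>_. Q))"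
    using qform_measurable[OF Q(2), of J "insert j J" j t c] resolvent_trace_measurable[OF Q(2), of J "insert j J" c t] J t c
    by (intro measurable_compose[OF _ measurable_ennreal] borel_measurable_abs borel_measurable_diff borel_measurable_times) auto
  have "(\<integral>\<^sup>+z. ?f z \<partial>PiM {..<p} (\<lambda>_. Q)) = (\<integral>\<^sup>+z. (\<integral>\<^sup>+y. ?f (z(j := y)) \<partial>Q) \<partial>PiM J (\<lambda>_. Q))"
    unfolding ins[symmetric] by (rule product_nn_integral_insert[OF J meas])
  also have "\<dots> \<le> (\<integral>\<^sup>+z. ennreal \<delta> \<partial>PiM J (\<lambda>_. Q))"
  proof (rule nn_integral_mono)
    fix z
    have R: "resolvent N t c J (z(j := y)) = resolvent N t c J z" for y
      using J by (intro resolvent_cong) auto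
    have tr: "mtrace (resolvent N t c J z) = (\<Sum>k<N. resolvent N t c J z $$ (k, k))"
      using resolvent_carrier[OF J(1) c t, of N z] by (simp add: mtrace_def)
    have "(\<integral>\<^sup>+y. ennreal \<bar>c * qform N (resolvent N t c J z) y - c * (\<Sum>k<N. resolvent N t c J z $$ (k, k))\<bar> \<partial>Q) \<le> ennreal \<delta>"
      by (rule \<delta>) (use inv_mat_frobenius_le[OF shifted_gram_coercive t] J c in \<open>auto simp: resolvent_def\<close>)
    thus "(\<integral>\<^sup>+y. ?f (z(j := y)) \<partial>Q) \<le> ennreal \<delta>" unfolding R tr by simp
  qed
  also have "\<dots> = ennreal \<delta>" by (simp add: PJ.emeasure_space_1)
  finally show ?thesis .
qed

text \<open>
  The three error terms come from the three replacements
  \<open>q\<^sub>j \<leadsto> (1/p) tr R\<^sub>j \<leadsto> (1/p) tr R \<leadsto> g m\<close>: the quadratic form by its mean, the removal of column \<open>j\<close>,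
  and the fluctuation of the trace.  The map \<open>q \<mapsto> q/(1 + q)\<close> is Lipschitz, so the errors carry over to
  the trace identity.
\<close>

lemma expected_stieltjes_equation:
  assumes Q: "prob_space Q" "sets Q = sets (PiM {..<N} (\<lambda>_. borel))" and t: "t > 0" and p: "p \<ge> 1"
    and N: "N \<ge> 1" and \<delta>0: "\<delta> \<ge> 0"
    and \<delta>: "\<And>B. (\<Sum>k<N. \<Sum>l<N. (B $$ (k, l))\<^sup>2) \<le> real N / t\<^sup>2 \<Longrightarrow>
       (\<integral>\<^sup>+y. ennreal \<bar>qform N B y / real p - (\<Sum>k<N. B $$ (k, k)) / real p\<bar> \<partial>Q) \<le> ennreal \<delta>"
  defines "PM \<equiv> PiM {..<p} (\<lambda>_. Q)"
    and "F \<equiv> \<lambda>z. mtrace (resolvent N t (1 / real p) {..<p} z) / real N"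
  defines "m \<equiv> \<integral>z. F z \<partial>PM" and "g \<equiv> real N / real p"
  shows "\<bar>g * (1 - t * m) - g * m / (1 + g * m)\<bar>
     \<le> \<delta> + 1 / (t * real p) + g * (\<integral>z. \<bar>F z - m\<bar> \<partial>PM)"
proof -
  let ?c = "1 / real p"
  have c: "?c \<ge> 0" by simp
  have p0: "real p > 0" and N0: "real N > 0" using p N by auto
  interpret PM: prob_space PM unfolding PM_def using Q by (intro prob_space_PiM)
  have Fm [measurable]: "F \<in> borel_measurable PM"
    unfolding F_def PM_def using Q t by (intro borel_measurable_divide resolvent_trace_measurable) auto
  have Fb: "0 \<le> F z \<and> F z \<le> 1 / t" for z
    using resolvent_trace_bounds[of "{..<p}" ?c t N z] t N0 by (simp add: F_def field_simps)
  have Fi: "integrable PM F" by (rule PM.integrable_const_bound[of _ "1 / t"]) (use Fb in \<open>auto intro!: AE_I2\<close>)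
  have m0: "m \<ge> 0" unfolding m_def using Fb by (intro integral_nonneg_AE AE_I2) auto
  have g0: "g > 0" using p0 N0 by (simp add: g_def)
  define D where "D = (\<integral>z. \<bar>F z - m\<bar> \<partial>PM)"
  define err where "err = \<delta> + 1 / (t * real p) + g * D"
  have D0: "D \<ge> 0" by (simp add: D_def)
  define h where "h j z = ?c * qform N (resolvent N t ?c {..<p} z) (z j)" for j z
  define q where "q j z = ?c * qform N (resolvent N t ?c ({..<p} - {j}) z) (z j)" for j z
  have hq: "h j z = q j z / (1 + q j z)" "q j z \<ge> 0"
    and tr: "\<bar>?c * mtrace (resolvent N t ?c ({..<p} - {j}) z) - g * F z\<bar> \<le> 1 / (t * real p)" if j: "j < p" for j z
  proof -
    have ins: "insert j ({..<p} - {j}) = {..<p}" using j by auto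
    note add = resolvent_column_added[of "{..<p} - {j}" j ?c t N z, unfolded ins]
    show "h j z = q j z / (1 + q j z)" "q j z \<ge> 0" using add t by (auto simp: h_def q_def)
    let ?d = "mtrace (resolvent N t ?c ({..<p} - {j}) z) - mtrace (resolvent N t ?c {..<p} z)"
    have "?c * mtrace (resolvent N t ?c ({..<p} - {j}) z) - g * F z = ?c * ?d"
      using N0 by (simp add: g_def F_def diff_divide_distrib)
    moreover have "0 \<le> ?d" "?d \<le> 1 / t" using add t by auto
    hence "0 \<le> ?c * ?d" "?c * ?d \<le> ?c * (1 / t)" by (intro mult_nonneg_nonneg mult_left_mono c; simp)+
    hence "\<bar>?c * ?d\<bar> \<le> ?c * (1 / t)" by (simp only: abs_of_nonneg)
    ultimately show "\<bar>?c * mtrace (resolvent N t ?c ({..<p} - {j}) z) - g * F z\<bar> \<le> 1 / (t * real p)"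
      by (simp add: mult.commute)
  qed
  have hm [measurable]: "h j \<in> borel_measurable PM" if "j < p" for j
    unfolding h_def PM_def using that
    by (intro borel_measurable_times borel_measurable_const qform_measurable[OF Q(2)]) auto
  have h01: "0 \<le> h j z \<and> h j z \<le> 1" if "j < p" for j z
    using hq(1)[OF that, of z] hq(2)[OF that, of z] by (simp add: divide_le_eq)
  have hi: "integrable PM (h j)" if "j < p" for j
    by (rule PM.integrable_const_bound[of _ 1]) (use h01 hm that in \<open>auto intro!: AE_I2\<close>)
  define s where "s = g * m"
  have s0: "s \<ge> 0" using g0 m0 by (simp add: s_def)
  have each: "\<bar>(\<integral>z. h j z \<partial>PM) - s / (1 + s)\<bar> \<le> err" if j: "j < p" for j
  proof -
    let ?T = "\<lambda>z. \<bar>q j z - ?c * mtrace (resolvent N t ?c ({..<p} - {j}) z)\<bar>"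
    have Tm: "?T \<in> borel_measurable PM"
      unfolding q_def PM_def using j t
      by (intro borel_measurable_abs borel_measurable_diff borel_measurable_times borel_measurable_const
          qform_measurable[OF Q(2)] resolvent_trace_measurable[OF Q(2)]) auto
    have T: "(\<integral>\<^sup>+z. ennreal (?T z) \<partial>PM) \<le> ennreal \<delta>"
      unfolding PM_def q_def
      by (rule leave_one_out_quadratic_form[OF Q t c j \<delta>0]) (use \<delta> in simp)
    have pw: "\<bar>h j z - s / (1 + s)\<bar> \<le> ?T z + (1 / (t * real p) + g * \<bar>F z - m\<bar>)" for z
    proof -
      have "\<bar>h j z - s / (1 + s)\<bar> \<le> \<bar>q j z - s\<bar>"
        unfolding hq(1)[OF j] by (rule rational_map_lipschitz[OF hq(2)[OF j] s0])
      also have "\<dots> \<le> ?T z + \<bar>?c * mtrace (resolvent N t ?c ({..<p} - {j}) z) - g * F z\<bar> + \<bar>g * F z - s\<bar>"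
        by linarith
      also have "\<bar>g * F z - s\<bar> = g * \<bar>F z - m\<bar>"
        using g0 by (simp add: s_def right_diff_distrib[symmetric] abs_mult)
      finally show ?thesis using tr[OF j, of z] by linarith
    qed
    have "ennreal \<bar>(\<integral>z. h j z \<partial>PM) - s / (1 + s)\<bar> = ennreal \<bar>\<integral>z. h j z - s / (1 + s) \<partial>PM\<bar>"
      using hi[OF j] by (simp add: PM.prob_space)
    also have "\<dots> \<le> ennreal (\<integral>z. \<bar>h j z - s / (1 + s)\<bar> \<partial>PM)"
      by (intro ennreal_leI integral_abs_bound)
    also have "\<dots> = (\<integral>\<^sup>+z. ennreal \<bar>h j z - s / (1 + s)\<bar> \<partial>PM)"
      using hi[OF j] by (intro nn_integral_eq_integral[symmetric]) auto
    also have "\<dots> \<le> (\<integral>\<^sup>+z. ennreal (?T z) + ennreal (1 / (t * real p) + g * \<bar>F z - m\<bar>) \<partial>PM)"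
      using pw t g0 by (intro nn_integral_mono) (simp flip: ennreal_plus)
    also have "\<dots> = (\<integral>\<^sup>+z. ennreal (?T z) \<partial>PM) + (\<integral>\<^sup>+z. ennreal (1 / (t * real p) + g * \<bar>F z - m\<bar>) \<partial>PM)"
      using Tm by (intro nn_integral_add) auto
    also have "(\<integral>\<^sup>+z. ennreal (1 / (t * real p) + g * \<bar>F z - m\<bar>) \<partial>PM)
        = ennreal (\<integral>z. 1 / (t * real p) + g * \<bar>F z - m\<bar> \<partial>PM)"
      using Fi g0 t by (intro nn_integral_eq_integral) auto
    also have "(\<integral>z. 1 / (t * real p) + g * \<bar>F z - m\<bar> \<partial>PM) = 1 / (t * real p) + g * D"
      using Fi by (simp add: D_def PM.prob_space)
    also have "(\<integral>\<^sup>+z. ennreal (?T z) \<partial>PM) + ennreal (1 / (t * real p) + g * D)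
        \<le> ennreal \<delta> + ennreal (1 / (t * real p) + g * D)"
      using T by (rule add_right_mono)
    also have "\<dots> = ennreal err"
      using \<delta>0 t g0 D0 by (simp add: err_def add.assoc flip: ennreal_plus)
    finally show ?thesis
      using \<delta>0 t g0 D0 by (subst (asm) ennreal_le_iff) (auto simp: err_def)
  qed
  have id: "real N = t * (real N * F z) + (\<Sum>j<p. h j z)" for z
    using resolvent_trace_identity[of "{..<p}" ?c t N z] t N0 by (simp add: F_def h_def)
  have "(\<integral>z. t * (real N * F z) + (\<Sum>j<p. h j z) \<partial>PM) = t * (real N * m) + (\<Sum>j<p. \<integral>z. h j z \<partial>PM)"
    using Fi hi by (subst Bochner_Integration.integral_add)
      (auto simp: m_def Bochner_Integration.integral_sum intro!: Bochner_Integration.integrable_sum)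
  hence eN: "real N = t * (real N * m) + (\<Sum>j<p. \<integral>z. h j z \<partial>PM)"
    unfolding id[symmetric] by (simp add: PM.prob_space)
  have "real N * (1 - t * m) - real p * (s / (1 + s)) = (\<Sum>j<p. (\<integral>z. h j z \<partial>PM) - s / (1 + s))"
    using eN by (simp add: sum_subtractf algebra_simps)
  also have "\<bar>\<dots>\<bar> \<le> (\<Sum>j<p. err)" using each by (intro order_trans[OF sum_abs] sum_mono) auto
  finally have "\<bar>real N * (1 - t * m) - real p * (s / (1 + s))\<bar> / real p \<le> err"
    using p0 by (simp add: divide_le_eq mult.commute)
  moreover have "\<bar>real N * (1 - t * m) - real p * (s / (1 + s))\<bar> / real p
      = \<bar>(real N * (1 - t * m) - real p * (s / (1 + s))) / real p\<bar>" using p0 by simp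
  moreover have "(real N * (1 - t * m) - real p * (s / (1 + s))) / real p = g * (1 - t * m) - s / (1 + s)"
    using p0 by (simp add: g_def diff_divide_distrib)
  ultimately have "\<bar>g * (1 - t * m) - s / (1 + s)\<bar> \<le> err" by (simp only:)
  thus ?thesis by (simp add: err_def D_def s_def)
qed

section \<open>An integral of semicircle type\<close>

text \<open>
  For \<open>a = 0\<close> the integrand is singular at \<open>0\<close>.  The antiderivative stays continuous there because the
  last term carries the factor \<open>sqrt (a * b)\<close>, so both cases are covered by the fundamental theorem
  with differentiability in the interior.
\<close>

lemma semicircle_over_linear_integral:
  fixes a b :: real
  assumes ab: "0 \<le> a" "a < b"
  shows "((\<lambda>u. sqrt ((b - u) * (u - a)) / u) has_integral pi * ((a + b) / 2 - sqrt (a * b))) {a..b}"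
proof -
  define F where "F u = sqrt ((b - u) * (u - a)) + (a + b) / 2 * arcsin ((2 * u - a - b) / (b - a))
      - sqrt (a * b) * arcsin (((a + b) * u - 2 * a * b) / (u * (b - a)))" for u
  have "((\<lambda>u. sqrt ((b - u) * (u - a)) / u) has_integral (F b - F a)) {a..b}"
  proof (rule fundamental_theorem_of_calculus_interior)
    show "a \<le> b" using ab by simp
    have in1: "(2 * u - a - b) / (b - a) \<in> {-1..1}" if "u \<in> {a..b}" for u
      using that ab by (auto simp: field_simps)
    have in2: "((a + b) * u - 2 * a * b) / (u * (b - a)) \<in> {-1..1}" if "u \<in> {a..b}" "a > 0" for u
    proof -
      have u: "u > 0" using that by auto
      have "(a + b) * u - 2 * a * b \<le> u * (b - a)"
        using mult_left_mono[of u b "2 * a"] that by (simp add: algebra_simps)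
      moreover have "- (u * (b - a)) \<le> (a + b) * u - 2 * a * b"
        using mult_left_mono[of a u "2 * b"] that ab by (simp add: algebra_simps)
      moreover have "u * (b - a) > 0" using u ab by simp
      ultimately show ?thesis by (simp add: le_divide_eq divide_le_eq)
    qed
    have c1: "continuous_on {a..b} (\<lambda>u. sqrt ((b - u) * (u - a)) + (a + b) / 2 * arcsin ((2 * u - a - b) / (b - a)))"
      using in1 ab by (intro continuous_intros) auto
    have c2: "continuous_on {a..b} (\<lambda>u. sqrt (a * b) * arcsin (((a + b) * u - 2 * a * b) / (u * (b - a))))"
    proof (cases "a = 0")
      case False
      thus ?thesis using in2 ab by (intro continuous_intros) auto
    qed simp
    show "continuous_on {a..b} F"
      unfolding F_def by (rule continuous_on_diff[OF c1 c2])
    fix u assume u: "u \<in> {a<..<b}"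
    hence u0: "u > 0" "b - u > 0" "u - a > 0" using ab by auto
    define r where "r = sqrt ((b - u) * (u - a))"
    have r: "r > 0" "r\<^sup>2 = (b - u) * (u - a)" using u0 by (auto simp: r_def)
    have d1: "((\<lambda>u. sqrt ((b - u) * (u - a))) has_real_derivative (a + b - 2 * u) / (2 * r)) (at u)"
    proof -
      have "(b - u) * (u - a) > 0" using u0 by simp
      moreover from this have "a * u + b * u > a * b + u * u" by (simp add: algebra_simps)
      ultimately show ?thesis unfolding r_def using u0
      by (auto intro!: derivative_eq_intros simp: field_simps)
    qed
    have d2: "((\<lambda>u. arcsin ((2 * u - a - b) / (b - a))) has_real_derivative 1 / r) (at u)"
    proof -
      have lt: "-1 < (2 * u - a - b) / (b - a)" "(2 * u - a - b) / (b - a) < 1"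
        using u0 by (auto simp: field_simps)
      have "1 - ((2 * u - a - b) / (b - a))\<^sup>2 = (2 * r / (b - a))\<^sup>2"
        using ab by (simp add: power_divide power_mult_distrib r divide_simps) (simp add: power2_eq_square algebra_simps)
      hence sq: "sqrt (1 - ((2 * u - a - b) / (b - a))\<^sup>2) = 2 * r / (b - a)"
        using r ab by simp
      have "((\<lambda>u. arcsin ((2 * u - a - b) / (b - a))) has_real_derivative
          inverse (sqrt (1 - ((2 * u - a - b) / (b - a))\<^sup>2)) * (2 / (b - a))) (at u)"
        by (rule DERIV_chain2[where g = "\<lambda>u. (2 * u - a - b) / (b - a)", OF DERIV_arcsin[OF lt]])
           (rule DERIV_cdivide, auto intro!: derivative_eq_intros)
      moreover have "inverse (2 * r / (b - a)) * (2 / (b - a)) = 1 / r"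
        using r ab by (simp add: divide_simps)
      ultimately show ?thesis unfolding sq by simp
    qed
    have d3: "((\<lambda>u. sqrt (a * b) * arcsin (((a + b) * u - 2 * a * b) / (u * (b - a)))) has_real_derivative a * b / (u * r)) (at u)"
    proof (cases "a = 0")
      case False
      hence a0: "a > 0" using ab by simp
      define s where "s = sqrt (a * b)"
      have s: "s > 0" "s\<^sup>2 = a * b" using a0 ab by (auto simp: s_def)
      let ?h = "((a + b) * u - 2 * a * b) / (u * (b - a))"
      have ub: "u * (b - a) > 0" using u0 ab by simp
      have lt: "-1 < ?h" "?h < 1"
      proof -
        have "0 < 2 * a * (b - u)" "0 < 2 * b * (u - a)" using a0 u0 by auto
        thus "-1 < ?h" "?h < 1" using ub by (auto simp: less_divide_eq divide_less_eq algebra_simps)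
      qed
      have "1 - ?h\<^sup>2 = (2 * s * r / (u * (b - a)))\<^sup>2"
        using ub u0 ab by (simp add: power_divide power_mult_distrib r s divide_simps) (simp add: power2_eq_square algebra_simps)
      hence sq: "sqrt (1 - ?h\<^sup>2) = 2 * s * r / (u * (b - a))"
        using r s ub by simp
      have "((\<lambda>u. ((a + b) * u - 2 * a * b) / (u * (b - a))) has_real_derivative 2 * a * b / (u\<^sup>2 * (b - a))) (at u)"
      proof -
        have "((\<lambda>u. ((a + b) * u - 2 * a * b) / (u * (b - a))) has_real_derivative
            ((a + b) * (u * (b - a)) - ((a + b) * u - 2 * a * b) * (b - a)) / ((u * (b - a)) * (u * (b - a)))) (at u)"
          by (rule DERIV_divide) (use ub in \<open>auto intro!: derivative_eq_intros\<close>)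
        moreover have "(a + b) * (u * (b - a)) - ((a + b) * u - 2 * a * b) * (b - a) = 2 * a * b * (b - a)"
          by (simp add: algebra_simps)
        moreover have "2 * a * b * (b - a) / ((u * (b - a)) * (u * (b - a))) = 2 * a * b / (u\<^sup>2 * (b - a))"
          using ab by (simp add: power2_eq_square)
        ultimately show ?thesis by simp
      qed
      from DERIV_chain2[where g = "\<lambda>u. ((a + b) * u - 2 * a * b) / (u * (b - a))", OF DERIV_arcsin[OF lt] this]
      have "((\<lambda>u. arcsin (((a + b) * u - 2 * a * b) / (u * (b - a)))) has_real_derivative
          inverse (2 * s * r / (u * (b - a))) * (2 * a * b / (u\<^sup>2 * (b - a)))) (at u)"
        unfolding sq .
      hence "((\<lambda>u. s * arcsin (((a + b) * u - 2 * a * b) / (u * (b - a)))) has_real_derivative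
          s * (inverse (2 * s * r / (u * (b - a))) * (2 * a * b / (u\<^sup>2 * (b - a))))) (at u)"
        by (rule DERIV_cmult)
      moreover have "s * (inverse (2 * s * r / (u * (b - a))) * (2 * a * b / (u\<^sup>2 * (b - a)))) = a * b / (u * r)"
        using s(1) r(1) u0 ab by (simp add: divide_simps power2_eq_square)
      ultimately show ?thesis by (simp add: s_def)
    qed simp
    have "(F has_real_derivative (a + b - 2 * u) / (2 * r) + (a + b) / 2 * (1 / r) - a * b / (u * r)) (at u)"
      unfolding F_def by (intro DERIV_diff DERIV_add DERIV_cmult d1 d2 d3)
    moreover have "(a + b - 2 * u) / (2 * r) + (a + b) / 2 * (1 / r) - a * b / (u * r) = r / u"
    proof -
      have "r / u = (r * r) / (u * r)" using r(1) by simp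
      also have "\<dots> = r\<^sup>2 / (u * r)" by (simp add: power2_eq_square)
      also have "\<dots> = (b - u) * (u - a) / (u * r)" by (simp add: r)
      also have "\<dots> = (a + b - 2 * u) / (2 * r) + (a + b) / 2 * (1 / r) - a * b / (u * r)"
        using u0 r(1) by (simp add: divide_simps) (simp add: algebra_simps)
      finally show ?thesis by simp
    qed
    ultimately show "(F has_vector_derivative sqrt ((b - u) * (u - a)) / u) (at u)"
      by (simp add: has_real_derivative_iff_has_vector_derivative r_def)
  qed
  moreover have "F b - F a = pi * ((a + b) / 2 - sqrt (a * b))"
  proof (cases "a = 0")
    case True
    have "(- b) / b = -1" using ab by simp
    thus ?thesis using ab True by (simp add: F_def field_simps)
  next
    case False
    have e1: "(2 * b - a - b) / (b - a) = 1" "(2 * a - a - b) / (b - a) = -1" using ab by (auto simp: field_simps)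
    have e2: "((a + b) * b - 2 * a * b) / (b * (b - a)) = 1" "((a + b) * a - 2 * a * b) / (a * (b - a)) = -1"
      using ab False by (auto simp: divide_simps) (auto simp: algebra_simps)
    show ?thesis unfolding F_def e1 e2 by (simp add: algebra_simps)
  qed
  ultimately show ?thesis by simp
qed

lemma semicircle_over_linear_set_integral:
  fixes a b s :: real
  assumes ab: "a < b" "0 \<le> a + s"
  shows "set_integrable lborel {a..b} (\<lambda>y. sqrt ((b - y) * (y - a)) / (y + s))"
    and "(LBINT y:{a..b}. sqrt ((b - y) * (y - a)) / (y + s)) = pi * ((a + b) / 2 + s - sqrt ((a + s) * (b + s)))"
proof -
  let ?f = "\<lambda>y. sqrt ((b - y) * (y - a)) / (y + s)"
  let ?I = "pi * ((a + b) / 2 + s - sqrt ((a + s) * (b + s)))"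
  have "((\<lambda>u. sqrt (((b + s) - u) * (u - (a + s))) / u) has_integral
      pi * (((a + s) + (b + s)) / 2 - sqrt ((a + s) * (b + s)))) (cbox (a + s) (b + s))"
    using semicircle_over_linear_integral[of "a + s" "b + s"] ab by simp
  from has_integral_affinity[OF this, of 1 s]
  have hi: "(?f has_integral ?I) {a..b}"
    by (simp add: algebra_simps add_divide_distrib image_add_atLeastAtMost')
  have nn: "?f y \<ge> 0" if "y \<in> {a..b}" for y using that ab by auto
  have abs: "?f absolutely_integrable_on {a..b}"
    using hi nn by (intro nonnegative_absolutely_integrable_1) (auto simp: integrable_on_def)
  have meas: "set_borel_measurable borel {a..b} ?f"
    unfolding set_borel_measurable_def by measurable
  show int: "set_integrable lborel {a..b} ?f"
    using abs meas unfolding set_integrable_def set_borel_measurable_def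
    by (subst integrable_completion[symmetric]) auto
  show "(LBINT y:{a..b}. ?f y) = ?I"
    using set_borel_integral_eq_integral(2)[OF int] hi by (simp add: integral_unique)
qed

section \<open>The Marchenko-Pastur law and its Stieltjes transform\<close>

text \<open>
  Integration against the Marchenko-Pastur law, with the atom at \<open>0\<close> that is present for \<open>\<gamma> > 1\<close>.
  Working with the functional avoids constructing the law as a measure.
\<close>

definition mp_functional :: "real \<Rightarrow> (real \<Rightarrow> real) \<Rightarrow> real" where
  "mp_functional \<gamma> \<phi> = (1 - 1 / \<gamma>) * (if 1 < \<gamma> then \<phi> 0 else 0) + (\<integral>y. mp_density \<gamma> y * \<phi> y \<partial>lborel)"

text \<open>
  The positive root of \<open>t \<gamma> m\<^sup>2 + (t + 1 - \<gamma>) m = 1\<close>.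
\<close>

definition mp_stieltjes :: "real \<Rightarrow> real \<Rightarrow> real" where
  "mp_stieltjes \<gamma> t = (sqrt ((t + 1 - \<gamma>)\<^sup>2 + 4 * t * \<gamma>) - (t + 1 - \<gamma>)) / (2 * t * \<gamma>)"

text \<open>
  Bounds matter on the half-line \<open>y \<ge> 0\<close>, which carries all spectra; \<open>1/(y + 1)\<close> is unbounded
  elsewhere.
\<close>

definition bounded_test :: "(real \<Rightarrow> real) \<Rightarrow> bool" where
  "bounded_test \<phi> \<longleftrightarrow> \<phi> \<in> borel_measurable borel \<and> (\<exists>B. \<forall>y\<ge>0. \<bar>\<phi> y\<bar> \<le> B)"

lemma mp_density_nonneg: "\<gamma> > 0 \<Longrightarrow> mp_density \<gamma> y \<ge> 0"
proof -
  assume \<gamma>: "\<gamma> > 0"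
  have "(1 - sqrt \<gamma>)\<^sup>2 \<le> y \<Longrightarrow> 0 \<le> y" by (meson order_trans zero_le_power2)
  thus ?thesis using \<gamma> by (auto simp: mp_density_def intro!: divide_nonneg_nonneg mult_nonneg_nonneg)
qed

lemma mp_density_neg: "y < 0 \<Longrightarrow> mp_density \<gamma> y = 0"
  unfolding mp_density_def by (smt (verit) atLeastAtMost_iff zero_le_power2)

lemma mp_density_measurable [measurable]: "mp_density \<gamma> \<in> borel_measurable borel"
  unfolding mp_density_def by measurable

lemma mp_support_algebra:
  assumes "\<gamma> > 0"
  defines "a \<equiv> (1 - sqrt \<gamma>)\<^sup>2" and "b \<equiv> (1 + sqrt \<gamma>)\<^sup>2"
  shows "a < b" "0 \<le> a" "a + b = 2 * (1 + \<gamma>)" "a * b = (1 - \<gamma>)\<^sup>2"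
proof -
  have s: "sqrt \<gamma> > 0" "(sqrt \<gamma>)\<^sup>2 = \<gamma>" using assms by auto
  have "b - a = 4 * sqrt \<gamma>" by (simp add: a_def b_def power2_eq_square algebra_simps)
  thus "a < b" using s by linarith
  show "0 \<le> a" by (simp add: a_def)
  show "a + b = 2 * (1 + \<gamma>)" using s by (simp add: a_def b_def power2_eq_square algebra_simps)
  have "a * b = ((1 - sqrt \<gamma>) * (1 + sqrt \<gamma>))\<^sup>2" by (simp add: a_def b_def power_mult_distrib)
  also have "(1 - sqrt \<gamma>) * (1 + sqrt \<gamma>) = 1 - \<gamma>" using s by (simp add: algebra_simps power2_eq_square)
  finally show "a * b = (1 - \<gamma>)\<^sup>2" .
qed

text \<open>
  Both integrals reduce to the semicircle integral by \<open>1/(y (y + t)) = (1/y - 1/(y + t))/t\<close>.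
\<close>

lemma mp_density_integral:
  assumes \<gamma>: "\<gamma> > 0"
  shows "integrable lborel (mp_density \<gamma>)"
    and "(\<integral>y. mp_density \<gamma> y \<partial>lborel) = ((1 + \<gamma>) - \<bar>1 - \<gamma>\<bar>) / (2 * \<gamma>)"
    and "t > 0 \<Longrightarrow> (\<integral>y. mp_density \<gamma> y * (1 / (y + t)) \<partial>lborel)
        = (sqrt ((t + 1 - \<gamma>)\<^sup>2 + 4 * t * \<gamma>) - t - \<bar>1 - \<gamma>\<bar>) / (2 * t * \<gamma>)"
proof -
  define a where "a = (1 - sqrt \<gamma>)\<^sup>2"
  define b where "b = (1 + sqrt \<gamma>)\<^sup>2"
  note ab = mp_support_algebra[OF \<gamma>, folded a_def b_def]
  define f where "f y = sqrt ((b - y) * (y - a))" for y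
  have I: "set_integrable lborel {a..b} (\<lambda>y. f y / (y + s))"
    "(LBINT y:{a..b}. f y / (y + s)) = pi * ((a + b) / 2 + s - sqrt ((a + s) * (b + s)))" if "s \<ge> 0" for s
    using semicircle_over_linear_set_integral[of a b s] ab that by (auto simp: f_def)
  have dens: "mp_density \<gamma> y = 1 / (2 * pi * \<gamma>) * (indicator {a..b} y *\<^sub>R (f y / (y + 0)))" for y
    by (auto simp: mp_density_def a_def b_def f_def indicator_def)
  show "integrable lborel (mp_density \<gamma>)"
    unfolding dens using I(1)[of 0] by (intro integrable_mult_right) (simp add: set_integrable_def)
  have "(\<integral>y. mp_density \<gamma> y \<partial>lborel) = 1 / (2 * pi * \<gamma>) * (LBINT y:{a..b}. f y / (y + 0))"
    unfolding dens set_lebesgue_integral_def by (rule integral_mult_right_zero)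
  also have "\<dots> = ((1 + \<gamma>) - \<bar>1 - \<gamma>\<bar>) / (2 * \<gamma>)"
    using I(2)[of 0] ab \<gamma> by (simp add: field_simps)
  finally show "(\<integral>y. mp_density \<gamma> y \<partial>lborel) = ((1 + \<gamma>) - \<bar>1 - \<gamma>\<bar>) / (2 * \<gamma>)" .
  assume t: "t > 0"
  have pf: "mp_density \<gamma> y * (1 / (y + t)) = 1 / (2 * pi * \<gamma> * t) *
      (indicator {a..b} y *\<^sub>R (f y / (y + 0)) - indicator {a..b} y *\<^sub>R (f y / (y + t)))" for y
  proof (cases "y \<in> {a..b}")
    case True
    show ?thesis
    proof (cases "y = 0")
      case True
      hence "f y = 0" using \<open>y \<in> {a..b}\<close> ab by (simp add: f_def)
      thus ?thesis unfolding dens by simp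
    next
      case False
      hence "y > 0" using True ab by auto
      thus ?thesis unfolding dens using True t by (simp add: divide_simps) (simp add: algebra_simps)
    qed
  qed (simp add: dens)
  have "(\<integral>y. mp_density \<gamma> y * (1 / (y + t)) \<partial>lborel) = 1 / (2 * pi * \<gamma> * t) *
      ((LBINT y:{a..b}. f y / (y + 0)) - (LBINT y:{a..b}. f y / (y + t)))"
    unfolding pf set_lebesgue_integral_def
    using I(1)[of 0] I(1)[of t] t by (subst integral_mult_right_zero, subst Bochner_Integration.integral_diff)
      (auto simp: set_integrable_def)
  also have "(LBINT y:{a..b}. f y / (y + 0)) = pi * ((1 + \<gamma>) - \<bar>1 - \<gamma>\<bar>)"
    using I(2)[of 0] ab by simp
  also have "(LBINT y:{a..b}. f y / (y + t)) = pi * ((1 + \<gamma>) + t - sqrt ((t + 1 - \<gamma>)\<^sup>2 + 4 * t * \<gamma>))"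
  proof -
    have "(a + t) * (b + t) = a * b + t * (a + b) + t * t" by (simp add: algebra_simps)
    also have "\<dots> = (t + 1 - \<gamma>)\<^sup>2 + 4 * t * \<gamma>"
      unfolding ab by (simp add: power2_eq_square algebra_simps)
    finally show ?thesis using I(2)[of t] ab t by simp
  qed
  also have "1 / (2 * pi * \<gamma> * t) * (pi * ((1 + \<gamma>) - \<bar>1 - \<gamma>\<bar>) - pi * ((1 + \<gamma>) + t - sqrt ((t + 1 - \<gamma>)\<^sup>2 + 4 * t * \<gamma>)))
      = (sqrt ((t + 1 - \<gamma>)\<^sup>2 + 4 * t * \<gamma>) - t - \<bar>1 - \<gamma>\<bar>) / (2 * t * \<gamma>)"
    using t \<gamma> by (simp add: field_simps)
  finally show "(\<integral>y. mp_density \<gamma> y * (1 / (y + t)) \<partial>lborel)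
        = (sqrt ((t + 1 - \<gamma>)\<^sup>2 + 4 * t * \<gamma>) - t - \<bar>1 - \<gamma>\<bar>) / (2 * t * \<gamma>)" .
qed

lemma mp_functional_const: "\<gamma> > 0 \<Longrightarrow> mp_functional \<gamma> (\<lambda>_. 1) = 1"
  using mp_density_integral(2)[of \<gamma>] by (auto simp: mp_functional_def field_simps)

lemma mp_functional_stieltjes:
  assumes "\<gamma> > 0" "t > 0"
  shows "mp_functional \<gamma> (\<lambda>y. 1 / (y + t)) = mp_stieltjes \<gamma> t"
  unfolding mp_functional_def mp_stieltjes_def mp_density_integral(3)[OF assms]
  using assms by (cases "1 < \<gamma>") (simp_all add: field_simps)

lemma mp_functional_integrable:
  assumes \<gamma>: "\<gamma> > 0" and "bounded_test \<phi>"
  shows "integrable lborel (\<lambda>y. mp_density \<gamma> y * \<phi> y)"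
proof -
  obtain B where B: "\<And>y. y \<ge> 0 \<Longrightarrow> \<bar>\<phi> y\<bar> \<le> B" and [measurable]: "\<phi> \<in> borel_measurable borel"
    using assms by (auto simp: bounded_test_def)
  show ?thesis
  proof (rule Bochner_Integration.integrable_bound)
    show "integrable lborel (\<lambda>y. B * mp_density \<gamma> y)"
      using mp_density_integral(1)[OF \<gamma>] by simp
    show "AE y in lborel. norm (mp_density \<gamma> y * \<phi> y) \<le> norm (B * mp_density \<gamma> y)"
    proof (intro AE_I2)
      fix y
      have "B \<ge> 0" using B[of 0] by linarith
      show "norm (mp_density \<gamma> y * \<phi> y) \<le> norm (B * mp_density \<gamma> y)"
      proof (cases "y \<ge> 0")
        case True
        have "mp_density \<gamma> y * \<bar>\<phi> y\<bar> \<le> mp_density \<gamma> y * B"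
          by (intro mult_left_mono B True mp_density_nonneg \<gamma>)
        thus ?thesis using \<open>B \<ge> 0\<close> mp_density_nonneg[OF \<gamma>, of y]
          by (simp add: abs_mult mult.commute)
      qed (simp add: mp_density_neg)
    qed
  qed measurable
qed

lemma mp_functional_linear:
  assumes \<gamma>: "\<gamma> > 0" and "bounded_test \<phi>" "bounded_test \<psi>"
  shows "mp_functional \<gamma> (\<lambda>y. c * \<phi> y + d * \<psi> y) = c * mp_functional \<gamma> \<phi> + d * mp_functional \<gamma> \<psi>"
proof -
  have "(\<integral>y. mp_density \<gamma> y * (c * \<phi> y + d * \<psi> y) \<partial>lborel)
      = (\<integral>y. c * (mp_density \<gamma> y * \<phi> y) + d * (mp_density \<gamma> y * \<psi> y) \<partial>lborel)"
    by (simp add: algebra_simps)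
  also have "\<dots> = c * (\<integral>y. mp_density \<gamma> y * \<phi> y \<partial>lborel) + d * (\<integral>y. mp_density \<gamma> y * \<psi> y \<partial>lborel)"
    using mp_functional_integrable assms by simp
  finally have eq: "(\<integral>y. mp_density \<gamma> y * (c * \<phi> y + d * \<psi> y) \<partial>lborel)
      = c * (\<integral>y. mp_density \<gamma> y * \<phi> y \<partial>lborel) + d * (\<integral>y. mp_density \<gamma> y * \<psi> y \<partial>lborel)" .
  show ?thesis
    unfolding mp_functional_def eq by (simp add: algebra_simps add_divide_distrib)
qed

lemma mp_functional_mono:
  assumes \<gamma>: "\<gamma> > 0" and "bounded_test \<phi>" "bounded_test \<psi>" and le: "\<And>y. y \<ge> 0 \<Longrightarrow> \<phi> y \<le> \<psi> y"
  shows "mp_functional \<gamma> \<phi> \<le> mp_functional \<gamma> \<psi>"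
proof -
  have "(\<integral>y. mp_density \<gamma> y * \<phi> y \<partial>lborel) \<le> (\<integral>y. mp_density \<gamma> y * \<psi> y \<partial>lborel)"
  proof (intro integral_mono mp_functional_integrable assms)
    fix y show "mp_density \<gamma> y * \<phi> y \<le> mp_density \<gamma> y * \<psi> y"
      using le[of y] mp_density_nonneg[OF \<gamma>, of y]
      by (cases "y \<ge> 0") (auto simp: mult_left_mono mp_density_neg)
  qed
  moreover have "(1 - 1 / \<gamma>) * (if 1 < \<gamma> then \<phi> 0 else 0) \<le> (1 - 1 / \<gamma>) * (if 1 < \<gamma> then \<psi> 0 else 0)"
    using le[of 0] by (auto intro!: mult_left_mono)
  ultimately show ?thesis by (simp add: mp_functional_def)
qed

lemma mp_cdf_eq_functional: "mp_cdf \<gamma> x = mp_functional \<gamma> (\<lambda>y. of_bool (y \<le> x))"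
proof -
  have "(LBINT y:{..x}. mp_density \<gamma> y) = (\<integral>y. mp_density \<gamma> y * of_bool (y \<le> x) \<partial>lborel)"
    unfolding set_lebesgue_integral_def
    by (intro Bochner_Integration.integral_cong) (auto simp: indicator_def)
  thus ?thesis by (auto simp: mp_cdf_def mp_functional_def)
qed

section \<open>From Stieltjes transforms to distribution functions\<close>

lemma bounded_test_linear:
  assumes "bounded_test \<phi>" "bounded_test \<psi>"
  shows "bounded_test (\<lambda>y. c * \<phi> y + d * \<psi> y)"
proof -
  obtain B B' where B: "\<And>y. y \<ge> 0 \<Longrightarrow> \<bar>\<phi> y\<bar> \<le> B" "\<And>y. y \<ge> 0 \<Longrightarrow> \<bar>\<psi> y\<bar> \<le> B'"
    using assms by (auto simp: bounded_test_def)
  have "\<bar>c * \<phi> y + d * \<psi> y\<bar> \<le> \<bar>c\<bar> * B + \<bar>d\<bar> * B'" if "y \<ge> 0" for y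
  proof -
    have "\<bar>c * \<phi> y + d * \<psi> y\<bar> \<le> \<bar>c\<bar> * \<bar>\<phi> y\<bar> + \<bar>d\<bar> * \<bar>\<psi> y\<bar>"
      by (metis abs_mult abs_triangle_ineq)
    also have "\<dots> \<le> \<bar>c\<bar> * B + \<bar>d\<bar> * B'"
      using B[OF that] by (intro add_mono mult_left_mono) auto
    finally show ?thesis .
  qed
  thus ?thesis using assms by (auto simp: bounded_test_def)
qed

definition list_average :: "(real \<Rightarrow> real) \<Rightarrow> real list \<Rightarrow> real" where
  "list_average \<phi> es = (\<Sum>e\<leftarrow>es. \<phi> e) / real (length es)"

lemma list_average_linear:
  "list_average (\<lambda>y. c * \<phi> y + d * \<psi> y) es = c * list_average \<phi> es + d * list_average \<psi> es"
  by (simp add: list_average_def sum_list_addf sum_list_const_mult add_divide_distrib)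

lemma list_average_mono:
  assumes "\<And>e. e \<in> set es \<Longrightarrow> \<phi> e \<le> \<psi> e"
  shows "list_average \<phi> es \<le> list_average \<psi> es"
  unfolding list_average_def using assms by (intro divide_right_mono sum_list_mono) auto

lemma list_average_const: "es \<noteq> [] \<Longrightarrow> list_average (\<lambda>_. c) es = c"
  by (simp add: list_average_def sum_list_triv)

text \<open>
  The test functions for which the empirical averages converge to the integral against the law.  They
  form a linear space that is closed under uniform limits on the half-line.
\<close>

definition mp_test :: "real \<Rightarrow> (nat \<Rightarrow> real list) \<Rightarrow> (real \<Rightarrow> real) \<Rightarrow> bool" where
  "mp_test \<gamma> es \<phi> \<longleftrightarrow> bounded_test \<phi> \<and> (\<lambda>n. list_average \<phi> (es n)) \<longlonglongrightarrow> mp_functional \<gamma> \<phi>"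

lemma mp_test_linear:
  assumes "\<gamma> > 0" "mp_test \<gamma> es \<phi>" "mp_test \<gamma> es \<psi>"
  shows "mp_test \<gamma> es (\<lambda>y. c * \<phi> y + d * \<psi> y)"
  using assms unfolding mp_test_def list_average_linear
  by (auto simp: mp_functional_linear bounded_test_linear intro!: tendsto_intros)

lemma mp_test_uniform_limit:
  assumes \<gamma>: "\<gamma> > 0" and ne: "\<forall>\<^sub>F n in sequentially. es n \<noteq> [] \<and> (\<forall>e\<in>set (es n). e \<ge> 0)"
    and \<phi>: "bounded_test \<phi>"
    and approx: "\<And>\<epsilon>. \<epsilon> > 0 \<Longrightarrow> \<exists>\<psi>. mp_test \<gamma> es \<psi> \<and> (\<forall>y\<ge>0. \<bar>\<phi> y - \<psi> y\<bar> \<le> \<epsilon>)"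
  shows "mp_test \<gamma> es \<phi>"
  unfolding mp_test_def
proof (intro conjI \<phi> tendstoI)
  fix \<epsilon> :: real assume "\<epsilon> > 0"
  then obtain \<psi> where \<psi>: "mp_test \<gamma> es \<psi>" and le: "\<And>y. y \<ge> 0 \<Longrightarrow> \<bar>\<phi> y - \<psi> y\<bar> \<le> \<epsilon> / 4"
    using approx[of "\<epsilon> / 4"] by auto
  have one: "bounded_test (\<lambda>_. 1)" by (auto simp: bounded_test_def)
  have sandwich: "\<phi> y \<le> 1 * \<psi> y + \<epsilon> / 4 * 1" "1 * \<psi> y + - (\<epsilon> / 4) * 1 \<le> \<phi> y" if "y \<ge> 0" for y
    using le[OF that] by linarith+
  have b\<psi>: "bounded_test \<psi>" using \<psi> by (simp add: mp_test_def)
  have L: "mp_functional \<gamma> \<phi> \<le> mp_functional \<gamma> \<psi> + \<epsilon> / 4" "mp_functional \<gamma> \<psi> - \<epsilon> / 4 \<le> mp_functional \<gamma> \<phi>"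
    using mp_functional_mono[OF \<gamma> \<phi> bounded_test_linear[OF b\<psi> one, of 1 "\<epsilon> / 4"] sandwich(1)]
      mp_functional_mono[OF \<gamma> bounded_test_linear[OF b\<psi> one, of 1 "- (\<epsilon> / 4)"] \<phi> sandwich(2)]
    unfolding mp_functional_linear[OF \<gamma> b\<psi> one] mp_functional_const[OF \<gamma>] by simp_all
  have "\<forall>\<^sub>F n in sequentially. dist (list_average \<psi> (es n)) (mp_functional \<gamma> \<psi>) < \<epsilon> / 4"
    using \<psi> \<open>\<epsilon> > 0\<close> tendstoD[of _ "mp_functional \<gamma> \<psi>" sequentially "\<epsilon> / 4"] unfolding mp_test_def by simp
  with ne show "\<forall>\<^sub>F n in sequentially. dist (list_average \<phi> (es n)) (mp_functional \<gamma> \<phi>) < \<epsilon>"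
  proof eventually_elim
    case (elim n)
    have "list_average \<phi> (es n) \<le> list_average (\<lambda>y. 1 * \<psi> y + \<epsilon> / 4 * 1) (es n)"
      using elim sandwich by (intro list_average_mono) auto
    hence 1: "list_average \<phi> (es n) \<le> list_average \<psi> (es n) + \<epsilon> / 4"
      unfolding list_average_linear using elim by (simp add: list_average_const)
    have "list_average (\<lambda>y. 1 * \<psi> y + - (\<epsilon> / 4) * 1) (es n) \<le> list_average \<phi> (es n)"
      using elim sandwich by (intro list_average_mono) auto
    hence 2: "list_average \<psi> (es n) - \<epsilon> / 4 \<le> list_average \<phi> (es n)"
      unfolding list_average_linear using elim by (simp add: list_average_const)
    show ?case using elim L 1 2 \<open>\<epsilon> > 0\<close> unfolding dist_real_def by linarith
  qed
qed

text \<open>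
  Induction on \<open>k\<close>.  With \<open>u = 1/(y + 1)\<close>, \<open>s = 1/j\<close> and \<open>f = 1/(y + 1 + s)\<close>, partial fractions give
  \<open>u f = (u - f)/s\<close>, which lowers the power of \<open>u\<close>.  For the shift \<open>0\<close>, which is \<open>j = 0\<close> by the
  convention \<open>inverse 0 = 0\<close>, the function is the uniform limit of those with shift \<open>1/j\<close>.
\<close>

lemma mp_test_resolvent_powers:
  assumes \<gamma>: "\<gamma> > 0" and ne: "\<forall>\<^sub>F n in sequentially. es n \<noteq> [] \<and> (\<forall>e\<in>set (es n). e \<ge> 0)"
    and lim: "\<And>j. mp_test \<gamma> es (\<lambda>y. 1 / (y + (1 + inverse (real j))))"
  shows "mp_test \<gamma> es (\<lambda>y. (1 / (y + 1)) ^ k * (1 / (y + (1 + inverse (real j)))))"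
proof (induction k arbitrary: j)
  case 0
  show ?case using lim by simp
next
  case (Suc k)
  have bt: "bounded_test (\<lambda>y. (1 / (y + 1)) ^ Suc k * (1 / (y + (1 + inverse (real j)))))" for j
  proof -
    have s: "0 \<le> inverse (real j)" by simp
    have "\<bar>(1 / (y + 1)) ^ Suc k * (1 / (y + (1 + inverse (real j))))\<bar> \<le> 1 * 1" if "y \<ge> 0" for y
    proof -
      have "(1 / (y + 1)) ^ Suc k \<le> 1" using that by (intro power_le_one) auto
      moreover have "1 / (y + (1 + inverse (real j))) \<le> 1"
      proof -
        have X: "y + (1 + inverse (real j)) \<ge> 1" using that s by linarith
        hence "0 < y + (1 + inverse (real j))" by linarith
        thus ?thesis using X by (simp only: divide_le_eq_1_pos)
      qed
      moreover have "0 \<le> (1 / (y + 1)) ^ Suc k" "0 \<le> 1 / (y + (1 + inverse (real j)))" using that s by auto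
      ultimately show ?thesis
        unfolding abs_mult by (intro mult_mono) (simp_all only: abs_of_nonneg zero_le_one)
    qed
    moreover have "(\<lambda>y. (1 / (y + 1)) ^ Suc k * (1 / (y + (1 + inverse (real j))))) \<in> borel_measurable borel"
      by measurable
    ultimately show ?thesis
      unfolding bounded_test_def by blast
  qed
  have pos: "mp_test \<gamma> es (\<lambda>y. (1 / (y + 1)) ^ Suc k * (1 / (y + (1 + inverse (real j)))))" if j: "j > 0" for j
  proof -
    have s: "inverse (real j) > 0" using j by simp
    let ?\<phi> = "\<lambda>y. real j * ((1 / (y + 1)) ^ k * (1 / (y + (1 + inverse (real 0))))) +
          - real j * ((1 / (y + 1)) ^ k * (1 / (y + (1 + inverse (real j)))))"
    have t: "mp_test \<gamma> es ?\<phi>" by (intro mp_test_linear \<gamma> Suc.IH)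
    have eq: "?\<phi> y = (1 / (y + 1)) ^ Suc k * (1 / (y + (1 + inverse (real j))))" if "y \<ge> 0" for y
    proof -
      define s where "s = inverse (real j)"
      have s0: "s > 0" "real j * s = 1" using s j by (auto simp: s_def)
      have "1 / (y + 1) - 1 / (y + (1 + s)) = s * (1 / (y + 1) * (1 / (y + (1 + s))))"
        using that s0(1) by (simp add: divide_simps)
      hence "real j * (1 / (y + 1) - 1 / (y + (1 + s))) = (real j * s) * (1 / (y + 1) * (1 / (y + (1 + s))))"
        by simp
      hence d: "real j * (1 / (y + 1) - 1 / (y + (1 + s))) = 1 / (y + 1) * (1 / (y + (1 + s)))"
        by (simp add: s0)
      have "?\<phi> y = (1 / (y + 1)) ^ k * (real j * (1 / (y + 1) - 1 / (y + (1 + s))))"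
        by (simp add: s_def algebra_simps)
      thus ?thesis unfolding d by (simp add: s_def)
    qed
    show ?thesis
    proof (rule mp_test_uniform_limit[OF \<gamma> ne])
      show "bounded_test (\<lambda>y. (1 / (y + 1)) ^ Suc k * (1 / (y + (1 + inverse (real j)))))" by (rule bt)
      show "\<exists>\<psi>. mp_test \<gamma> es \<psi> \<and> (\<forall>y\<ge>0. \<bar>(1 / (y + 1)) ^ Suc k * (1 / (y + (1 + inverse (real j)))) - \<psi> y\<bar> \<le> \<epsilon>)"
        if "\<epsilon> > 0" for \<epsilon>
        using t eq that by (intro exI[of _ ?\<phi>]) (auto simp del: power_Suc)
    qed
  qed
  show ?case
  proof (cases "j = 0")
    case False
    thus ?thesis using pos by blast
  next
    case True
    show ?thesis
    proof (rule mp_test_uniform_limit[OF \<gamma> ne])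
      show "bounded_test (\<lambda>y. (1 / (y + 1)) ^ Suc k * (1 / (y + (1 + inverse (real j)))))" by (rule bt)
      fix \<epsilon> :: real assume "\<epsilon> > 0"
      then obtain i where i: "i > 0" "inverse (real i) < \<epsilon>"
        using ex_inverse_of_nat_less by blast
      have "\<bar>(1 / (y + 1)) ^ Suc k * (1 / (y + (1 + inverse (real j)))) -
          (1 / (y + 1)) ^ Suc k * (1 / (y + (1 + inverse (real i))))\<bar> \<le> \<epsilon>" if y: "y \<ge> 0" for y
      proof -
        let ?s = "inverse (real i)"
        have s: "?s > 0" using i by simp
        have d: "1 / (y + 1) - 1 / (y + (1 + ?s)) = ?s * (1 / ((y + 1) * (y + (1 + ?s))))"
        proof -
          have "1 / (y + 1) - 1 / (y + (1 + s)) = s * (1 / ((y + 1) * (y + (1 + s))))" if "s > 0" for s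
            using y that by (simp add: divide_simps)
          thus ?thesis using s .
        qed
        have "1 * 1 \<le> (y + 1) * (y + (1 + ?s))" using y s by (intro mult_mono) auto
        hence "1 / ((y + 1) * (y + (1 + ?s))) \<le> 1" by (simp add: divide_le_eq)
        hence b: "?s * (1 / ((y + 1) * (y + (1 + ?s)))) \<le> ?s" using s mult_left_mono[of _ 1 ?s] by fastforce
        have b0: "0 \<le> ?s * (1 / ((y + 1) * (y + (1 + ?s))))" using y s by simp
        have "(1 / (y + 1)) ^ Suc k * (1 / (y + (1 + inverse (real j)))) -
          (1 / (y + 1)) ^ Suc k * (1 / (y + (1 + ?s))) = (1 / (y + 1)) ^ Suc k * (?s * (1 / ((y + 1) * (y + (1 + ?s)))))"
          unfolding d[symmetric] using True by (simp add: algebra_simps)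
        also have "\<bar>\<dots>\<bar> \<le> 1 * ?s"
        proof -
          have "(1 / (y + 1)) ^ Suc k \<le> 1" using y by (intro power_le_one) auto
          thus ?thesis unfolding abs_mult using y b b0 by (intro mult_mono) (auto simp del: power_Suc)
        qed
        finally show ?thesis using i by simp
      qed
      thus "\<exists>\<psi>. mp_test \<gamma> es \<psi> \<and> (\<forall>y\<ge>0. \<bar>(1 / (y + 1)) ^ Suc k * (1 / (y + (1 + inverse (real j)))) - \<psi> y\<bar> \<le> \<epsilon>)"
        using pos[OF i(1)] by blast
    qed
  qed
qed

text \<open>
  The Weierstrass theorem in the variable \<open>u = 1/(y + 1)\<close>, which maps the half-line into a compact
  interval.
\<close>

lemma mp_test_continuous:
  assumes \<gamma>: "\<gamma> > 0" and ne: "\<forall>\<^sub>F n in sequentially. es n \<noteq> [] \<and> (\<forall>e\<in>set (es n). e \<ge> 0)"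
    and lim: "\<And>j. mp_test \<gamma> es (\<lambda>y. 1 / (y + (1 + inverse (real j))))"
    and g: "continuous_on UNIV g"
  shows "mp_test \<gamma> es (\<lambda>y. g (1 / (y + 1)))"
proof (rule mp_test_uniform_limit[OF \<gamma> ne])
  have u: "1 / (y + 1) \<in> {0..1}" if "y \<ge> 0" for y :: real using that by auto
  have "compact (g ` {0..1::real})" using g by (intro compact_continuous_image) (auto intro: continuous_on_subset)
  then obtain B where "\<forall>v\<in>g ` {0..1}. \<bar>v\<bar> \<le> B"
    using compact_imp_bounded[of "g ` {0..1}"] unfolding bounded_real by blast
  hence gB: "\<forall>y\<ge>0. \<bar>g (1 / (y + 1))\<bar> \<le> B" using u by blast
  have [measurable]: "g \<in> borel_measurable borel" using g by (rule borel_measurable_continuous_onI)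
  have "(\<lambda>y. g (1 / (y + 1))) \<in> borel_measurable borel" by measurable
  thus "bounded_test (\<lambda>y. g (1 / (y + 1)))"
    unfolding bounded_test_def using gB by blast
  fix \<epsilon> :: real assume "\<epsilon> > 0"
  then obtain p where p: "real_polynomial_function p" "\<And>v. v \<in> {0..1} \<Longrightarrow> \<bar>g v - p v\<bar> < \<epsilon>"
    using Stone_Weierstrass_real_polynomial_function[of "{0..1::real}" g \<epsilon>] g
    by (auto intro: continuous_on_subset)
  then obtain a m where am: "p = (\<lambda>v. \<Sum>i\<le>m. a i * v ^ i)" using real_polynomial_function_iff_sum by blast
  have mono: "mp_test \<gamma> es (\<lambda>y. (1 / (y + 1)) ^ i)" for i
  proof (cases i)
    case 0
    have "\<forall>\<^sub>F n in sequentially. list_average (\<lambda>_. 1) (es n) = 1"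
      using ne by eventually_elim (simp add: list_average_const)
    hence "(\<lambda>n. list_average (\<lambda>_. 1) (es n)) \<longlonglongrightarrow> 1" by (rule tendsto_eventually)
    thus ?thesis using 0 mp_functional_const[OF \<gamma>] by (auto simp: mp_test_def bounded_test_def)
  next
    case (Suc k)
    thus ?thesis using mp_test_resolvent_powers[OF \<gamma> ne lim, of k 0] by (simp add: mult.commute)
  qed
  have "mp_test \<gamma> es (\<lambda>y. \<Sum>i\<le>m. a i * (1 / (y + 1)) ^ i)" for m
  proof (induction m)
    case 0
    show ?case using mp_test_linear[OF \<gamma> mono[of 0] mono[of 0], of "a 0" 0] by simp
  next
    case (Suc m)
    show ?case using mp_test_linear[OF \<gamma> Suc mono[of "Suc m"], of 1 "a (Suc m)"] by simp
  qed
  hence "mp_test \<gamma> es (\<lambda>y. p (1 / (y + 1)))" unfolding am .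
  moreover have "\<bar>g (1 / (y + 1)) - p (1 / (y + 1))\<bar> \<le> \<epsilon>" if "y \<ge> 0" for y
    using p(2)[OF u[OF that]] by simp
  ultimately show "\<exists>\<psi>. mp_test \<gamma> es \<psi> \<and> (\<forall>y\<ge>0. \<bar>g (1 / (y + 1)) - \<psi> y\<bar> \<le> \<epsilon>)" by blast
qed

text \<open>
  Linear interpolation in the variable \<open>1/(y + 1)\<close> between \<open>1\<close> on \<open>y \<le> a\<close> and \<open>0\<close> on \<open>y \<ge> b\<close>.
\<close>

lemma mp_test_ramp:
  assumes \<gamma>: "\<gamma> > 0" and ne: "\<forall>\<^sub>F n in sequentially. es n \<noteq> [] \<and> (\<forall>e\<in>set (es n). e \<ge> 0)"
    and lim: "\<And>j. mp_test \<gamma> es (\<lambda>y. 1 / (y + (1 + inverse (real j))))"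
    and ab: "0 \<le> a" "a < b"
  obtains \<phi> where "mp_test \<gamma> es \<phi>"
    "\<And>y. y \<ge> 0 \<Longrightarrow> of_bool (y \<le> a) \<le> \<phi> y" "\<And>y. y \<ge> 0 \<Longrightarrow> \<phi> y \<le> of_bool (y \<le> b)"
proof -
  define A where "A = 1 / (a + 1)"
  define B where "B = 1 / (b + 1)"
  have AB: "B < A" unfolding A_def B_def using ab by (intro divide_strict_left_mono) auto
  define g where "g v = max 0 (min 1 ((v - B) / (A - B)))" for v :: real
  have "continuous_on UNIV g" unfolding g_def using AB by (intro continuous_intros) auto
  note t = mp_test_continuous[OF \<gamma> ne lim this]
  show ?thesis
  proof (rule that[OF t])
    fix y :: real assume y: "y \<ge> 0"
    have "g (1 / (y + 1)) = 1" if "y \<le> a"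
    proof -
      have "A \<le> 1 / (y + 1)" unfolding A_def using that y ab by (intro divide_left_mono) auto
      thus ?thesis using AB by (simp add: g_def le_divide_eq)
    qed
    thus "of_bool (y \<le> a) \<le> g (1 / (y + 1))" by (cases "y \<le> a") (auto simp: g_def)
    have "g (1 / (y + 1)) = 0" if "\<not> y \<le> b"
    proof -
      have "1 / (y + 1) \<le> B" unfolding B_def using that y ab by (intro divide_left_mono) auto
      hence "(1 / (y + 1) - B) / (A - B) \<le> 0" using AB by (simp add: divide_le_0_iff)
      thus ?thesis by (simp add: g_def)
    qed
    thus "g (1 / (y + 1)) \<le> of_bool (y \<le> b)" by (cases "y \<le> b") (auto simp: g_def)
  qed
qed

theorem stieltjes_convergence_imp_cdf_convergence:
  assumes \<gamma>: "\<gamma> > 0" and ne: "\<forall>\<^sub>F n in sequentially. es n \<noteq> [] \<and> (\<forall>e\<in>set (es n). e \<ge> 0)"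
    and lim: "\<And>j. (\<lambda>n. list_average (\<lambda>y. 1 / (y + (1 + inverse (real j)))) (es n))
        \<longlonglongrightarrow> mp_stieltjes \<gamma> (1 + inverse (real j))"
    and cont: "isCont (mp_cdf \<gamma>) x"
  shows "(\<lambda>n. list_average (\<lambda>y. of_bool (y \<le> x)) (es n)) \<longlonglongrightarrow> mp_cdf \<gamma> x"
proof -
  have ind: "bounded_test (\<lambda>y. of_bool (y \<le> x))" for x
    by (auto simp: bounded_test_def intro!: exI[of _ 1])
  have lim': "mp_test \<gamma> es (\<lambda>y. 1 / (y + (1 + inverse (real j))))" for j
  proof -
    have "\<bar>1 / (y + (1 + inverse (real j)))\<bar> \<le> 1" if "y \<ge> 0" for y
      using that by (simp add: divide_le_eq add_nonneg_pos)
    thus ?thesis unfolding mp_test_def bounded_test_def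
      using lim[of j] mp_functional_stieltjes[OF \<gamma>, of "1 + inverse (real j)"]
      by (auto simp: add_pos_nonneg intro!: exI[of _ 1])
  qed
  have neg: "mp_cdf \<gamma> x = 0" if "x < 0" for x
  proof -
    have eq: "(\<lambda>y. mp_density \<gamma> y * of_bool (y \<le> x)) = (\<lambda>_. 0)"
      using that mp_density_neg by fastforce
    show ?thesis using that by (simp add: mp_cdf_eq_functional mp_functional_def eq)
  qed
  have upper: "\<forall>\<^sub>F n in sequentially. list_average (\<lambda>y. of_bool (y \<le> x)) (es n) < mp_cdf \<gamma> y + \<epsilon>"
    if x: "0 \<le> x" "x < y" "\<epsilon> > 0" for y \<epsilon>
  proof -
    obtain \<phi> where \<phi>: "mp_test \<gamma> es \<phi>"
      "\<And>v. v \<ge> 0 \<Longrightarrow> of_bool (v \<le> x) \<le> \<phi> v" "\<And>v. v \<ge> 0 \<Longrightarrow> \<phi> v \<le> of_bool (v \<le> y)"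
      using mp_test_ramp[OF \<gamma> ne lim' x(1,2)] by blast
    have "mp_functional \<gamma> \<phi> \<le> mp_cdf \<gamma> y"
      unfolding mp_cdf_eq_functional using \<phi> by (intro mp_functional_mono \<gamma> ind) (auto simp: mp_test_def)
    hence "mp_functional \<gamma> \<phi> < mp_cdf \<gamma> y + \<epsilon>" using x by simp
    hence "\<forall>\<^sub>F n in sequentially. list_average \<phi> (es n) < mp_cdf \<gamma> y + \<epsilon>"
      using \<phi>(1) unfolding mp_test_def by (auto intro: order_tendstoD)
    with ne show ?thesis
    proof eventually_elim
      case (elim n)
      have "list_average (\<lambda>y. of_bool (y \<le> x)) (es n) \<le> list_average \<phi> (es n)"
        using elim \<phi> by (intro list_average_mono) auto
      thus ?case using elim by simp
    qed
  qed
  have nonneg: "0 \<le> list_average (\<lambda>y. of_bool (y \<le> x)) (es n)" for n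
    unfolding list_average_def by (intro divide_nonneg_nonneg sum_list_nonneg) auto
  have lower: "\<forall>\<^sub>F n in sequentially. list_average (\<lambda>y. of_bool (y \<le> x)) (es n) > mp_cdf \<gamma> y - \<epsilon>"
    if x: "y < x" "\<epsilon> > 0" for y \<epsilon>
  proof (cases "y < 0")
    case True
    have "mp_cdf \<gamma> y - \<epsilon> < list_average (\<lambda>y. of_bool (y \<le> x)) (es n)" for n
      using nonneg[of n] neg[OF True] x by simp
    thus ?thesis by simp
  next
    case False
    then obtain \<phi> where \<phi>: "mp_test \<gamma> es \<phi>"
      "\<And>v. v \<ge> 0 \<Longrightarrow> of_bool (v \<le> y) \<le> \<phi> v" "\<And>v. v \<ge> 0 \<Longrightarrow> \<phi> v \<le> of_bool (v \<le> x)"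
      using mp_test_ramp[OF \<gamma> ne lim', of y x] x by auto
    have "mp_cdf \<gamma> y \<le> mp_functional \<gamma> \<phi>"
      unfolding mp_cdf_eq_functional using \<phi> by (intro mp_functional_mono \<gamma> ind) (auto simp: mp_test_def)
    hence "mp_functional \<gamma> \<phi> > mp_cdf \<gamma> y - \<epsilon>" using x by simp
    hence "\<forall>\<^sub>F n in sequentially. list_average \<phi> (es n) > mp_cdf \<gamma> y - \<epsilon>"
      using \<phi>(1) unfolding mp_test_def by (auto intro: order_tendstoD)
    with ne show ?thesis
    proof eventually_elim
      case (elim n)
      have "list_average \<phi> (es n) \<le> list_average (\<lambda>y. of_bool (y \<le> x)) (es n)"
        using elim \<phi> by (intro list_average_mono) auto
      thus ?case using elim by simp
    qed
  qed
  show ?thesis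
  proof (cases "x < 0")
    case True
    have "\<forall>\<^sub>F n in sequentially. list_average (\<lambda>y. of_bool (y \<le> x)) (es n) = mp_cdf \<gamma> x"
      using ne
    proof eventually_elim
      case (elim n)
      have "(\<Sum>e\<leftarrow>es n. of_bool (e \<le> x) :: real) = (\<Sum>e\<leftarrow>es n. 0)"
        using elim True by (intro arg_cong[where f = sum_list] map_cong refl) force
      thus ?case using neg[OF True] by (simp add: list_average_def)
    qed
    thus ?thesis by (rule tendsto_eventually)
  next
    case False
    show ?thesis
    proof (rule tendstoI)
      fix \<epsilon> :: real assume \<epsilon>: "\<epsilon> > 0"
      then obtain \<delta> where \<delta>: "\<delta> > 0" "\<And>y. dist y x < \<delta> \<Longrightarrow> dist (mp_cdf \<gamma> y) (mp_cdf \<gamma> x) < \<epsilon> / 2"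
        using cont[unfolded continuous_at_eps_delta, rule_format, of "\<epsilon> / 2"] by auto
      have y: "dist (mp_cdf \<gamma> (x + \<delta> / 2)) (mp_cdf \<gamma> x) < \<epsilon> / 2" "dist (mp_cdf \<gamma> (x - \<delta> / 2)) (mp_cdf \<gamma> x) < \<epsilon> / 2"
        using \<delta> by (auto simp: dist_real_def)
      have "\<forall>\<^sub>F n in sequentially. list_average (\<lambda>y. of_bool (y \<le> x)) (es n) < mp_cdf \<gamma> (x + \<delta> / 2) + \<epsilon> / 2"
        by (rule upper) (use False \<delta> \<epsilon> in auto)
      moreover have "\<forall>\<^sub>F n in sequentially. list_average (\<lambda>y. of_bool (y \<le> x)) (es n) > mp_cdf \<gamma> (x - \<delta> / 2) - \<epsilon> / 2"
        by (rule lower) (use \<delta> \<epsilon> in auto)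
      ultimately show "\<forall>\<^sub>F n in sequentially. dist (list_average (\<lambda>y. of_bool (y \<le> x)) (es n)) (mp_cdf \<gamma> x) < \<epsilon>"
      proof eventually_elim
        case (elim n)
        thus ?case using y unfolding dist_real_def by linarith
      qed
    qed
  qed
qed

section \<open>The law of the random tensor vector\<close>

lemma increasing_tuples_bij:
  assumes "bij_betw e {..<N} (increasing_tuples n d)"
  shows "bij_betw (\<lambda>k. set (e k)) {..<N} {K. K \<subseteq> {1..n} \<and> card K = d}"
proof -
  have "bij_betw set (increasing_tuples n d) {K. K \<subseteq> {1..n} \<and> card K = d}"
    unfolding bij_betw_def
  proof
    show "inj_on set (increasing_tuples n d)"
      unfolding inj_on_def increasing_tuples_def
      by (auto simp: strict_sorted_iff intro: sorted_distinct_set_unique)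
    show "set ` increasing_tuples n d = {K. K \<subseteq> {1..n} \<and> card K = d}"
    proof (intro equalityI subsetI)
      fix K assume "K \<in> set ` increasing_tuples n d"
      thus "K \<in> {K. K \<subseteq> {1..n} \<and> card K = d}"
        by (auto simp: increasing_tuples_def strict_sorted_iff distinct_card)
    next
      fix K assume K: "K \<in> {K. K \<subseteq> {1..n} \<and> card K = d}"
      hence "finite K" using finite_subset by blast
      hence "sorted_list_of_set K \<in> increasing_tuples n d" "set (sorted_list_of_set K) = K"
        using K by (auto simp: increasing_tuples_def)
      thus "K \<in> set ` increasing_tuples n d" by (metis imageI)
    qed
  qed
  from bij_betw_trans[OF assms this] show ?thesis by (simp add: o_def)
qed

lemma tensor_vector_component:
  assumes "bij_betw e {..<N} (increasing_tuples n d)" "k < N"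
  shows "tensor_vector N e x \<omega> k = (\<Prod>i\<in>set (e k). x i \<omega>)"
proof -
  have "distinct (e k)"
    using bij_betwE[OF assms(1)] assms(2) by (auto simp: increasing_tuples_def strict_sorted_iff)
  thus ?thesis using assms(2) by (simp add: tensor_vector_def prod.distinct_set_conv_list)
qed

lemma tensor_vector_measurable:
  assumes "bij_betw e {..<N} (increasing_tuples n d)"
    and x: "\<And>i. i \<in> {1..n} \<Longrightarrow> x i \<in> borel_measurable P"
  shows "tensor_vector N e x \<in> measurable P (PiM {..<N} (\<lambda>_. borel))"
proof -
  have "(\<lambda>\<omega>. \<lambda>k\<in>{..<N}. \<Prod>i\<in>set (e k). x i \<omega>) \<in> measurable P (PiM {..<N} (\<lambda>_. borel))"
    using bij_betwE[OF assms(1)]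
    by (intro measurable_restrict borel_measurable_prod x) (force simp: increasing_tuples_def)
  moreover have "tensor_vector N e x = (\<lambda>\<omega>. \<lambda>k\<in>{..<N}. \<Prod>i\<in>set (e k). x i \<omega>)"
    using tensor_vector_component[OF assms(1)]
    by (intro ext) (auto simp: restrict_def tensor_vector_def)
  ultimately show ?thesis by simp
qed

text \<open>
  Odd moments agree with their negatives by symmetry; \<open>m \<ge> 1\<close> because \<open>m - 1\<close> is the expectation of
  \<open>(X\<^sup>2 - 1)\<^sup>2\<close>.
\<close>

lemma symmetric_standard_moments:
  fixes X :: "'b \<Rightarrow> real"
  assumes P: "prob_space P" and [measurable]: "X \<in> borel_measurable P"
    and symm: "distr P borel X = distr P borel (\<lambda>\<omega>. - X \<omega>)"
    and var: "(\<integral>\<omega>. (X \<omega>)\<^sup>2 \<partial>P) = 1" and i4: "integrable P (\<lambda>\<omega>. X \<omega> ^ 4)"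
  defines "m \<equiv> \<integral>\<omega>. X \<omega> ^ 4 \<partial>P"
  shows "m \<ge> 1"
    and "j \<le> 4 \<Longrightarrow> integrable P (\<lambda>\<omega>. X \<omega> ^ j)"
    and "j \<le> 4 \<Longrightarrow> (\<integral>\<omega>. X \<omega> ^ j \<partial>P) = standard_moment m j"
proof -
  interpret prob_space P by fact
  have int: "integrable P (\<lambda>\<omega>. X \<omega> ^ j)" if j: "j \<le> 4" for j
  proof (rule Bochner_Integration.integrable_bound)
    show "integrable P (\<lambda>\<omega>. 1 + X \<omega> ^ 4)" using i4 by simp
    show "AE \<omega> in P. norm (X \<omega> ^ j) \<le> norm (1 + X \<omega> ^ 4)"
    proof (intro AE_I2)
      fix \<omega>
      have "\<bar>X \<omega>\<bar> ^ j \<le> 1 + \<bar>X \<omega>\<bar> ^ 4"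
      proof (cases "\<bar>X \<omega>\<bar> \<le> 1")
        case True
        hence "\<bar>X \<omega>\<bar> ^ j \<le> 1" by (intro power_le_one) auto
        thus ?thesis by (smt (verit) abs_ge_zero zero_le_power)
      next
        case False
        hence "\<bar>X \<omega>\<bar> ^ j \<le> \<bar>X \<omega>\<bar> ^ 4" using j by (intro power_increasing) auto
        thus ?thesis by simp
      qed
      thus "norm (X \<omega> ^ j) \<le> norm (1 + X \<omega> ^ 4)" by (simp add: power_abs)
    qed
  qed measurable
  show "j \<le> 4 \<Longrightarrow> integrable P (\<lambda>\<omega>. X \<omega> ^ j)" by (rule int)
  have "0 \<le> (\<integral>\<omega>. ((X \<omega>)\<^sup>2 - 1)\<^sup>2 \<partial>P)" by (intro integral_nonneg_AE AE_I2) auto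
  also have "(\<integral>\<omega>. ((X \<omega>)\<^sup>2 - 1)\<^sup>2 \<partial>P) = (\<integral>\<omega>. X \<omega> ^ 4 - 2 * (X \<omega>)\<^sup>2 + 1 \<partial>P)"
    by (simp add: power2_eq_square power4_eq_xxxx algebra_simps)
  also have "\<dots> = m - 1"
    using int[of 4] int[of 2] var by (simp add: m_def prob_space)
  finally show "m \<ge> 1" by simp
  show "(\<integral>\<omega>. X \<omega> ^ j \<partial>P) = standard_moment m j" if j: "j \<le> 4"
  proof (cases "odd j")
    case True
    have "(\<integral>\<omega>. X \<omega> ^ j \<partial>P) = (\<integral>y. y ^ j \<partial>distr P borel X)" by (simp add: integral_distr)
    also have "\<dots> = (\<integral>\<omega>. (- X \<omega>) ^ j \<partial>P)" unfolding symm by (simp add: integral_distr)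
    also have "\<dots> = - (\<integral>\<omega>. X \<omega> ^ j \<partial>P)" using True by simp
    finally show ?thesis using True by (simp add: standard_moment_def)
  next
    case False
    hence "j = 0 \<or> j = 2 \<or> j = 4" using j by presburger
    thus ?thesis using var by (auto simp: standard_moment_def m_def prob_space)
  qed
qed

lemma nn_integral_abs_le_sqrt:
  fixes X :: "'b \<Rightarrow> real"
  assumes P: "prob_space P" and [measurable]: "X \<in> borel_measurable P"
    and i: "integrable P (\<lambda>\<omega>. (X \<omega>)\<^sup>2)" and v: "(\<integral>\<omega>. (X \<omega>)\<^sup>2 \<partial>P) \<le> v"
  shows "(\<integral>\<^sup>+\<omega>. ennreal \<bar>X \<omega>\<bar> \<partial>P) \<le> ennreal (sqrt v)"
proof -
  interpret prob_space P by fact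
  have iX: "integrable P (\<lambda>\<omega>. \<bar>X \<omega>\<bar>)"
  proof (rule Bochner_Integration.integrable_bound)
    show "integrable P (\<lambda>\<omega>. 1 + (X \<omega>)\<^sup>2)" using i by simp
    have "\<bar>a\<bar> \<le> 1 + a\<^sup>2" for a :: real
      using sum_squares_bound[of 1 "\<bar>a\<bar>"] by simp
    thus "AE \<omega> in P. norm \<bar>X \<omega>\<bar> \<le> norm (1 + (X \<omega>)\<^sup>2)" by (intro AE_I2) (simp add: add_nonneg_nonneg)
  qed measurable
  have "0 \<le> variance (\<lambda>\<omega>. \<bar>X \<omega>\<bar>)" by (rule variance_positive)
  also have "\<dots> = (\<integral>\<omega>. (X \<omega>)\<^sup>2 \<partial>P) - (\<integral>\<omega>. \<bar>X \<omega>\<bar> \<partial>P)\<^sup>2"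
    using iX i by (subst variance_eq) auto
  finally have "(\<integral>\<omega>. \<bar>X \<omega>\<bar> \<partial>P)\<^sup>2 \<le> v" using v by simp
  hence "(\<integral>\<omega>. \<bar>X \<omega>\<bar> \<partial>P) \<le> sqrt v" by (rule real_le_rsqrt)
  moreover have "(\<integral>\<^sup>+\<omega>. ennreal \<bar>X \<omega>\<bar> \<partial>P) = ennreal (\<integral>\<omega>. \<bar>X \<omega>\<bar> \<partial>P)"
    using iX by (intro nn_integral_eq_integral) auto
  ultimately show ?thesis by (simp add: ennreal_leI)
qed

text \<open>
  The variance bound, transported from the independent entries to the law of the tensor vector and
  turned into a bound for the absolute deviation by the Cauchy-Schwarz inequality.
\<close>

lemma tensor_law_quadratic_form:
  fixes x :: "nat \<Rightarrow> 'b \<Rightarrow> real"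
  assumes P: "prob_space P" and n: "n \<ge> 1" and d: "d \<le> n"
    and ind: "prob_space.indep_vars P (\<lambda>_. borel) x {1..n}"
    and ident: "\<And>i. i \<in> {1..n} \<Longrightarrow> distr P borel (x i) = distr P borel (x 1)"
    and symm: "distr P borel (x 1) = distr P borel (\<lambda>\<omega>. - x 1 \<omega>)"
    and var: "(\<integral>\<omega>. (x 1 \<omega>)\<^sup>2 \<partial>P) = 1" and i4: "integrable P (\<lambda>\<omega>. x 1 \<omega> ^ 4)"
    and m4: "(\<integral>\<omega>. x 1 \<omega> ^ 4 \<partial>P) \<le> K"
    and e: "bij_betw e {..<N} (increasing_tuples n d)"
    and t: "t > 0" and p: "p \<ge> 1"
  defines "Q \<equiv> distr P (PiM {..<N} (\<lambda>_. borel)) (tensor_vector N e x)"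
    and "\<eta> \<equiv> exp (K * real d ^ 2 / real n) * (1 + 2 * real d ^ 2 / real n) - 1"
  shows "prob_space Q" "sets Q = sets (PiM {..<N} (\<lambda>_. borel))"
    and "(\<Sum>k<N. \<Sum>l<N. (B $$ (k, l))\<^sup>2) \<le> real N / t\<^sup>2 \<Longrightarrow>
      (\<integral>\<^sup>+y. ennreal \<bar>qform N B y / real p - (\<Sum>k<N. B $$ (k, k)) / real p\<bar> \<partial>Q)
        \<le> ennreal (real N / real p * sqrt \<eta> / t)"
proof -
  interpret prob_space P by fact
  have xm [measurable]: "x i \<in> borel_measurable P" if "i \<in> {1..n}" for i
    using ind that by (auto simp: indep_vars_def)
  have xm1 [measurable]: "x 1 \<in> borel_measurable P" using xm n by simp
  have tvm: "tensor_vector N e x \<in> measurable P (PiM {..<N} (\<lambda>_. borel))"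
    by (rule tensor_vector_measurable[OF e xm])
  show "prob_space Q" unfolding Q_def by (rule prob_space_distr[OF tvm])
  show "sets Q = sets (PiM {..<N} (\<lambda>_. borel))" by (simp add: Q_def)
  define m where "m = (\<integral>\<omega>. x 1 \<omega> ^ 4 \<partial>P)"
  note mom1 = symmetric_standard_moments[OF P xm1 symm var i4, folded m_def]
  have int: "integrable P (\<lambda>\<omega>. x i \<omega> ^ j)" if "i \<in> {1..n}" "j \<le> 4" for i j
  proof -
    have "integrable (distr P borel (x 1)) (\<lambda>y. y ^ j)"
      using mom1(2)[OF that(2)] by (subst integrable_distr_eq[OF xm1]) simp_all
    hence "integrable (distr P borel (x i)) (\<lambda>y. y ^ j)" using ident[OF that(1)] by simp
    thus ?thesis by (subst (asm) integrable_distr_eq[OF xm[OF that(1)]]) simp_all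
  qed
  have mom: "(\<integral>\<omega>. x i \<omega> ^ j \<partial>P) = standard_moment m j" if "i \<in> {1..n}" "j \<le> 4" for i j
  proof -
    have "(\<integral>\<omega>. x i \<omega> ^ j \<partial>P) = (\<integral>y. y ^ j \<partial>distr P borel (x i))"
      by (rule integral_distr[OF xm[OF that(1)], symmetric]) simp
    also have "\<dots> = (\<integral>y. y ^ j \<partial>distr P borel (x 1))" using ident[OF that(1)] by simp
    also have "\<dots> = (\<integral>\<omega>. x 1 \<omega> ^ j \<partial>P)" by (rule integral_distr[OF xm1]) simp
    finally show ?thesis using mom1(3)[OF that(2)] by simp
  qed
  assume B: "(\<Sum>k<N. \<Sum>l<N. (B $$ (k, l))\<^sup>2) \<le> real N / t\<^sup>2"
  let ?n = "real (card {1..n})"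
  let ?z = "\<lambda>k \<omega>. \<Prod>i\<in>set (e k). x i \<omega>"
  let ?q = "\<lambda>\<omega>. \<Sum>a<N. \<Sum>b<N. B $$ (a, b) * (?z a \<omega> * ?z b \<omega>)" and ?tr = "\<Sum>k<N. B $$ (k, k)"
  let ?\<beta> = "(1 + (m - 1) * real d / ?n) ^ d * (1 + 2 * real d ^ 2 / ?n) - 1"
  note var = tensor_quadratic_form_variance[OF P finite_atLeastAtMost _ _ ind int mom mom1(1) increasing_tuples_bij[OF e],
      of "\<lambda>a b. B $$ (a, b)"]
  have V: "integrable P (\<lambda>\<omega>. (?q \<omega> - ?tr)\<^sup>2)"
     "(\<integral>\<omega>. (?q \<omega> - ?tr)\<^sup>2 \<partial>P) \<le> real N * ?\<beta> * (\<Sum>k<N. \<Sum>l<N. (B $$ (k, l))\<^sup>2)"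
    using var n d by auto
  have \<beta>\<eta>: "0 \<le> ?\<beta>" "?\<beta> \<le> \<eta>"
  proof -
    have b1: "1 \<le> 1 + (m - 1) * real d / ?n" using mom1(1) by simp
    have p1: "1 \<le> (1 + (m - 1) * real d / ?n) ^ d" using b1 by (rule one_le_power)
    have q1: "1 \<le> 1 + 2 * real d ^ 2 / ?n" by simp
    have "1 * 1 \<le> (1 + (m - 1) * real d / ?n) ^ d * (1 + 2 * real d ^ 2 / ?n)"
      by (intro mult_mono p1 q1) (use p1 in auto)
    thus "0 \<le> ?\<beta>" by simp
    have "1 + (m - 1) * real d / ?n \<le> exp ((m - 1) * real d / ?n)"
      by (rule exp_ge_add_one_self)
    hence "(1 + (m - 1) * real d / ?n) ^ d \<le> exp ((m - 1) * real d / ?n) ^ d"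
      using b1 by (intro power_mono) auto
    also have "\<dots> = exp (real d * ((m - 1) * real d / ?n))" by (rule exp_of_nat_mult[symmetric])
    also have "\<dots> \<le> exp (K * real d ^ 2 / real n)"
    proof -
      have "(m - 1) * (real d ^ 2 / real n) \<le> K * (real d ^ 2 / real n)"
        using m4 by (intro mult_right_mono) (auto simp: m_def)
      thus ?thesis by (simp add: power2_eq_square mult_ac)
    qed
    finally have "(1 + (m - 1) * real d / ?n) ^ d * (1 + 2 * real d ^ 2 / ?n)
        \<le> exp (K * real d ^ 2 / real n) * (1 + 2 * real d ^ 2 / ?n)"
      by (rule mult_right_mono) simp
    thus "?\<beta> \<le> \<eta>" by (simp add: \<eta>_def)
  qed
  have "real N * ?\<beta> * (\<Sum>k<N. \<Sum>l<N. (B $$ (k, l))\<^sup>2) \<le> real N * \<eta> * (real N / t\<^sup>2)"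
    using \<beta>\<eta> B by (intro mult_mono) (auto intro!: sum_nonneg)
  hence V2: "(\<integral>\<omega>. (?q \<omega> - ?tr)\<^sup>2 \<partial>P) \<le> (real N / t)\<^sup>2 * \<eta>"
    using V(2) by (simp add: power2_eq_square mult_ac)
  have zm: "?z k \<in> borel_measurable P" if "k < N" for k
    using bij_betwE[OF e] that by (intro borel_measurable_prod xm) (force simp: increasing_tuples_def)
  have qm: "(\<lambda>\<omega>. ?q \<omega> - ?tr) \<in> borel_measurable P"
    using zm by (intro borel_measurable_diff borel_measurable_sum borel_measurable_times borel_measurable_const) auto
  have L1: "(\<integral>\<^sup>+\<omega>. ennreal \<bar>?q \<omega> - ?tr\<bar> \<partial>P) \<le> ennreal (real N / t * sqrt \<eta>)"
    using nn_integral_abs_le_sqrt[OF P qm V(1) V2] t by (simp add: real_sqrt_mult)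
  have qQ: "(\<lambda>y. ennreal \<bar>qform N B y / real p - ?tr / real p\<bar>) \<in> borel_measurable (PiM {..<N} (\<lambda>_. borel))"
    unfolding qform_def by measurable
  have "(\<integral>\<^sup>+y. ennreal \<bar>qform N B y / real p - ?tr / real p\<bar> \<partial>Q)
      = (\<integral>\<^sup>+\<omega>. ennreal \<bar>qform N B (tensor_vector N e x \<omega>) / real p - ?tr / real p\<bar> \<partial>P)"
    unfolding Q_def by (rule nn_integral_distr[OF tvm]) (use qQ in simp)
  also have "\<dots> = (\<integral>\<^sup>+\<omega>. ennreal (1 / real p) * ennreal \<bar>?q \<omega> - ?tr\<bar> \<partial>P)"
  proof (intro nn_integral_cong)
    fix \<omega>
    have "qform N B (tensor_vector N e x \<omega>) = ?q \<omega>"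
      unfolding qform_def by (intro sum.cong refl) (simp add: tensor_vector_component[OF e])
    moreover have "\<bar>?q \<omega> / real p - ?tr / real p\<bar> = 1 / real p * \<bar>?q \<omega> - ?tr\<bar>"
      by (simp add: diff_divide_distrib[symmetric])
    ultimately show "ennreal \<bar>qform N B (tensor_vector N e x \<omega>) / real p - ?tr / real p\<bar>
        = ennreal (1 / real p) * ennreal \<bar>?q \<omega> - ?tr\<bar>"
      by (simp only: ennreal_mult' zero_le_divide_1_iff of_nat_0_le_iff)
  qed
  also have "\<dots> = ennreal (1 / real p) * (\<integral>\<^sup>+\<omega>. ennreal \<bar>?q \<omega> - ?tr\<bar> \<partial>P)"
    using qm by (intro nn_integral_cmult) auto
  also have "\<dots> \<le> ennreal (1 / real p) * ennreal (real N / t * sqrt \<eta>)"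
    by (intro mult_left_mono L1) auto
  also have "\<dots> = ennreal (real N / real p * sqrt \<eta> / t)"
    by (subst ennreal_mult'[symmetric]) (auto simp: mult_ac)
  finally show "(\<integral>\<^sup>+y. ennreal \<bar>qform N B y / real p - ?tr / real p\<bar> \<partial>Q)
        \<le> ennreal (real N / real p * sqrt \<eta> / t)" .
qed

section \<open>Limits of the parameters and of the mean transform\<close>

lemma mp_stieltjes_root:
  assumes "\<gamma> > 0" "t > 0"
  shows "mp_stieltjes \<gamma> t > 0"
    and "mp_stieltjes \<gamma> t * (t * \<gamma> * mp_stieltjes \<gamma> t + (t + 1 - \<gamma>)) = 1"
proof -
  define b where "b = t + 1 - \<gamma>"
  define r where "r = sqrt (b\<^sup>2 + 4 * t * \<gamma>)"
  have M: "mp_stieltjes \<gamma> t = (r - b) / (2 * t * \<gamma>)" by (simp add: mp_stieltjes_def b_def r_def)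
  have "b\<^sup>2 < b\<^sup>2 + 4 * t * \<gamma>" using assms by simp
  hence "sqrt (b\<^sup>2) < r" unfolding r_def by (rule real_sqrt_less_mono)
  hence "\<bar>b\<bar> < r" by simp
  thus "mp_stieltjes \<gamma> t > 0" unfolding M using assms by simp
  have r2: "r * r = b * b + 4 * t * \<gamma>" using assms by (simp add: r_def power2_eq_square)
  have "(r - b) / (2 * t * \<gamma>) * (t * \<gamma> * ((r - b) / (2 * t * \<gamma>)) + b) = (r * r - b * b) / (4 * t * \<gamma>)"
    using assms by (simp add: divide_simps) (simp add: algebra_simps)
  also have "\<dots> = 1" unfolding r2 using assms by simp
  finally show "mp_stieltjes \<gamma> t * (t * \<gamma> * mp_stieltjes \<gamma> t + (t + 1 - \<gamma>)) = 1"
    unfolding M b_def .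
qed

text \<open>
  Clearing denominators, \<open>h n = t \<gamma> (m n)\<^sup>2 + (t + 1 - \<gamma>) m n - 1\<close> tends to \<open>0\<close>.  With \<open>M\<close> the positive
  root, \<open>h n * M = (m n - M) (1 + t \<gamma> m n M)\<close>, and the last factor is at least \<open>1\<close>.
\<close>

lemma approximate_root_converges:
  fixes g m :: "nat \<Rightarrow> real"
  assumes \<gamma>: "\<gamma> > 0" and t: "t > 0" and g: "g \<longlonglongrightarrow> \<gamma>"
    and m: "\<forall>\<^sub>F n in sequentially. 0 \<le> m n \<and> m n \<le> 1 / t" and g0: "\<forall>\<^sub>F n in sequentially. 0 < g n"
    and lim: "(\<lambda>n. g n * (1 - t * m n) - g n * m n / (1 + g n * m n)) \<longlonglongrightarrow> 0"
  shows "m \<longlonglongrightarrow> mp_stieltjes \<gamma> t"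
proof -
  let ?M = "mp_stieltjes \<gamma> t"
  note M = mp_stieltjes_root[OF \<gamma> t]
  let ?E = "\<lambda>n. g n * (1 - t * m n) - g n * m n / (1 + g n * m n)"
  define h where "h n = t * \<gamma> * (m n)\<^sup>2 + (t + 1 - \<gamma>) * m n - 1" for n
  have Bm: "Bfun m sequentially"
    using m by (intro BfunI[of _ "1 / t"]) (auto elim: eventually_mono)
  have gm: "(\<lambda>n. (g n - \<gamma>) * (t * (m n)\<^sup>2 - m n)) \<longlonglongrightarrow> 0"
  proof (rule tendsto_0_le[where K = "1 / t + 1 / t"])
    show "(\<lambda>n. g n - \<gamma>) \<longlonglongrightarrow> 0" using tendsto_diff[OF g tendsto_const[of \<gamma>]] by simp
    show "\<forall>\<^sub>F n in sequentially. norm ((g n - \<gamma>) * (t * (m n)\<^sup>2 - m n)) \<le> norm (g n - \<gamma>) * (1 / t + 1 / t)"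
      using m
    proof eventually_elim
      case (elim n)
      have "t * (m n)\<^sup>2 \<le> t * (1 / t)\<^sup>2" using elim t by (intro mult_left_mono power_mono) auto
      hence "t * (m n)\<^sup>2 \<le> 1 / t" using t by (simp add: power2_eq_square)
      moreover have "0 \<le> t * (m n)\<^sup>2" using t by simp
      ultimately have "\<bar>t * (m n)\<^sup>2 - m n\<bar> \<le> 1 / t + 1 / t" using elim by (simp add: abs_le_iff)
      thus ?case unfolding real_norm_def abs_mult by (rule mult_left_mono) simp
    qed
  qed
  have E: "(\<lambda>n. ?E n * ((1 + g n * m n) / g n)) \<longlonglongrightarrow> 0"
  proof (rule tendsto_0_le[OF lim, where K = "2 / \<gamma> + 1 / t"])
    have "\<forall>\<^sub>F n in sequentially. g n > \<gamma> / 2" using g \<gamma> by (intro order_tendstoD) auto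
    with m g0 show "\<forall>\<^sub>F n in sequentially. norm (?E n * ((1 + g n * m n) / g n)) \<le> norm (?E n) * (2 / \<gamma> + 1 / t)"
    proof eventually_elim
      case (elim n)
      have "(1 + g n * m n) / g n = 1 / g n + m n" using elim by (simp add: field_simps)
      moreover have "1 / g n \<le> 2 / \<gamma>" using elim \<gamma> by (simp add: field_simps)
      ultimately have "0 \<le> (1 + g n * m n) / g n" "(1 + g n * m n) / g n \<le> 2 / \<gamma> + 1 / t" using elim by auto
      thus ?case unfolding norm_mult by (intro mult_left_mono) auto
    qed
  qed
  have "\<forall>\<^sub>F n in sequentially. - (?E n * ((1 + g n * m n) / g n)) - (g n - \<gamma>) * (t * (m n)\<^sup>2 - m n) = h n"
    using m g0
  proof eventually_elim
    case (elim n)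
    have "0 \<le> g n * m n" using elim by simp
    hence ne: "1 + g n * m n \<noteq> 0" by linarith
    have "?E n * (1 + g n * m n) = g n * (1 - t * m n) * (1 + g n * m n) - g n * m n"
      using ne by (simp add: left_diff_distrib)
    also have "\<dots> = g n * ((1 - t * m n) * (1 + g n * m n) - m n)" by (simp add: algebra_simps)
    finally have "?E n * ((1 + g n * m n) / g n) = (1 - t * m n) * (1 + g n * m n) - m n"
      using elim by (simp add: field_simps)
    thus ?case by (simp add: h_def power2_eq_square algebra_simps)
  qed
  moreover have "(\<lambda>n. - (?E n * ((1 + g n * m n) / g n)) - (g n - \<gamma>) * (t * (m n)\<^sup>2 - m n)) \<longlonglongrightarrow> 0"
    using tendsto_diff[OF tendsto_minus[OF E] gm] by simp
  ultimately have h: "h \<longlonglongrightarrow> 0" using Lim_transform_eventually by blast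
  have "(\<lambda>n. m n - ?M) \<longlonglongrightarrow> 0"
  proof (rule tendsto_0_le[OF h, where K = ?M])
    show "\<forall>\<^sub>F n in sequentially. norm (m n - ?M) \<le> norm (h n) * ?M"
      using m
    proof eventually_elim
      case (elim n)
      have inv: "t * \<gamma> * ?M + (t + 1 - \<gamma>) = 1 / ?M" using M by (simp add: field_simps)
      have "h n = (m n - ?M) * (t * \<gamma> * m n + (t * \<gamma> * ?M + (t + 1 - \<gamma>)))"
        using M(2) by (simp add: h_def power2_eq_square algebra_simps)
      hence "h n * ?M = (m n - ?M) * (t * \<gamma> * m n * ?M + 1)"
        unfolding inv using M(1) by (simp add: field_simps)
      hence eq: "\<bar>h n\<bar> * ?M = \<bar>m n - ?M\<bar> * \<bar>t * \<gamma> * m n * ?M + 1\<bar>"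
        using M(1) by (metis abs_mult abs_of_pos)
      have "0 \<le> t * \<gamma> * m n * ?M" using t \<gamma> elim M(1) by simp
      hence "\<bar>m n - ?M\<bar> * 1 \<le> \<bar>m n - ?M\<bar> * \<bar>t * \<gamma> * m n * ?M + 1\<bar>" by (intro mult_left_mono) auto
      thus ?case unfolding real_norm_def eq by simp
    qed
  qed
  thus ?thesis by (rule LIM_zero_cancel)
qed

text \<open>
  As \<open>ln C\<close> is bounded below, the assumption forces \<open>ln r\<close> to tend to infinity; and \<open>C \<le> sqrt r\<close>
  eventually.
\<close>

lemma log_ratio_growth:
  fixes C r :: "nat \<Rightarrow> real"
  assumes C: "\<forall>\<^sub>F n in sequentially. C n \<ge> 2" and r: "\<forall>\<^sub>F n in sequentially. r n > 1"
    and lim: "(\<lambda>n. ln (C n) / ln (r n)) \<longlonglongrightarrow> 0"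
  shows "(\<lambda>n. C n / r n) \<longlonglongrightarrow> 0"
proof -
  have "(\<lambda>n. ln 2 / ln (r n)) \<longlonglongrightarrow> 0"
  proof (rule tendsto_sandwich[OF _ _ tendsto_const lim])
    show "\<forall>\<^sub>F n in sequentially. 0 \<le> ln 2 / ln (r n)" using r by eventually_elim auto
    show "\<forall>\<^sub>F n in sequentially. ln 2 / ln (r n) \<le> ln (C n) / ln (r n)"
      using r C by eventually_elim (intro divide_right_mono, auto)
  qed
  from tendsto_mult[OF this tendsto_const[of "1 / ln 2"]]
  have "(\<lambda>n. inverse (ln (r n))) \<longlonglongrightarrow> 0" by (simp add: inverse_eq_divide)
  hence "filterlim (\<lambda>n. inverse (inverse (ln (r n)))) at_top sequentially"
    by (rule filterlim_inverse_at_top) (use r in \<open>auto elim: eventually_mono\<close>)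
  hence "filterlim (\<lambda>n. ln (r n)) at_top sequentially" by simp
  from filterlim_tendsto_pos_mult_at_top[OF tendsto_const[of "1 / 2"] _ this]
  have "filterlim (\<lambda>n. 1 / 2 * ln (r n)) at_top sequentially" by simp
  hence ex: "(\<lambda>n. exp (- (1 / 2 * ln (r n)))) \<longlonglongrightarrow> 0"
    by (intro filterlim_compose[OF exp_at_bot] filterlim_uminus_at_bot[THEN iffD2]) simp
  have half: "\<forall>\<^sub>F n in sequentially. ln (C n) / ln (r n) < 1 / 2"
    using lim by (rule order_tendstoD) simp
  show ?thesis
  proof (rule tendsto_sandwich[OF _ _ tendsto_const ex])
    show "\<forall>\<^sub>F n in sequentially. 0 \<le> C n / r n" using r C by eventually_elim auto
    show "\<forall>\<^sub>F n in sequentially. C n / r n \<le> exp (- (1 / 2 * ln (r n)))"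
      using r C half
    proof eventually_elim
      case (elim n)
      have "ln (C n) \<le> 1 / 2 * ln (r n)" using elim by (simp add: divide_less_eq split: if_splits)
      hence "exp (ln (C n) - ln (r n)) \<le> exp (- (1 / 2 * ln (r n)))" by simp
      thus ?case using elim by (simp add: exp_diff)
    qed
  qed
qed

section \<open>Almost sure convergence of the spectral distribution\<close>

text \<open>
  Independent columns with law \<open>Q\<close> have the product law, which is where the concentration and mean
  estimates live.
\<close>

lemma column_law:
  fixes Zc :: "nat \<Rightarrow> 'a \<Rightarrow> nat \<Rightarrow> real"
  assumes M: "prob_space M" and p: "p \<ge> 1"
    and ind: "prob_space.indep_vars M (\<lambda>_. V) Zc {..<p}"
    and law: "\<And>j. j < p \<Longrightarrow> distr M V (Zc j) = Q"
  shows "(\<lambda>\<omega>. \<lambda>j\<in>{..<p}. Zc j \<omega>) \<in> measurable M (PiM {..<p} (\<lambda>_. V))"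
    and "distr M (PiM {..<p} (\<lambda>_. V)) (\<lambda>\<omega>. \<lambda>j\<in>{..<p}. Zc j \<omega>) = PiM {..<p} (\<lambda>_. Q)"
proof -
  interpret prob_space M by fact
  have rv: "Zc j \<in> measurable M V" if "j < p" for j
    using ind that by (auto simp: indep_vars_def)
  show "(\<lambda>\<omega>. \<lambda>j\<in>{..<p}. Zc j \<omega>) \<in> measurable M (PiM {..<p} (\<lambda>_. V))"
    by (intro measurable_restrict rv) simp
  have ne: "{..<p} \<noteq> {}" using p by (auto simp: lessThan_empty_iff)
  have "distr M (PiM {..<p} (\<lambda>_. V)) (\<lambda>\<omega>. \<lambda>j\<in>{..<p}. Zc j \<omega>) = PiM {..<p} (\<lambda>j. distr M V (Zc j))"
    using indep_vars_iff_distr_eq_PiM'[OF ne, where X = Zc and M' = "\<lambda>_. V"] ind rv by simp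
  also have "\<dots> = PiM {..<p} (\<lambda>_. Q)" using law by (intro PiM_cong) auto
  finally show "distr M (PiM {..<p} (\<lambda>_. V)) (\<lambda>\<omega>. \<lambda>j\<in>{..<p}. Zc j \<omega>) = PiM {..<p} (\<lambda>_. Q)" .
qed

text \<open>
  A single list of eigenvalues represents the distribution function and the Stieltjes transform for
  every \<open>t\<close>.
\<close>

lemma esd_gram:
  fixes N p :: nat and A :: "real mat"
  assumes A: "A \<in> carrier_mat N p" and N: "N \<ge> 1"
  obtains es where "es \<noteq> []" "\<And>e. e \<in> set es \<Longrightarrow> e \<ge> 0"
    "\<And>x. esd ((1 / real p) \<cdot>\<^sub>m (A * A\<^sup>T)) x = list_average (\<lambda>y. of_bool (y \<le> x)) es"
    "\<And>t. t > 0 \<Longrightarrow> list_average (\<lambda>y. 1 / (y + t)) es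
       = mtrace (resolvent N t (1 / real p) {..<p} (\<lambda>j\<in>{..<p}. col_fun N A j)) / real N"
proof -
  let ?z = "\<lambda>j\<in>{..<p}. col_fun N A j"
  have S: "(1 / real p) \<cdot>\<^sub>m (A * A\<^sup>T) = mat N N (\<lambda>(k, l). 1 / real p * (\<Sum>j\<in>{..<p}. ?z j k * ?z j l))"
    using A by (intro eq_matI) (auto simp: scalar_prod_def col_fun_def atLeast0LessThan intro!: sum.cong)
  obtain es where es: "proots (char_poly ((1 / real p) \<cdot>\<^sub>m (A * A\<^sup>T))) = mset es" "length es = N"
    "\<And>e. e \<in> set es \<Longrightarrow> e \<ge> 0"
    "\<And>t. t > 0 \<Longrightarrow> mtrace (resolvent N t (1 / real p) {..<p} ?z) = (\<Sum>e\<leftarrow>es. 1 / (e + t))"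
    unfolding S by (rule gram_spectrum[of "1 / real p" "{..<p}" N ?z]) auto
  have "es \<noteq> []" using es(2) N by auto
  moreover have "esd ((1 / real p) \<cdot>\<^sub>m (A * A\<^sup>T)) x = list_average (\<lambda>y. of_bool (y \<le> x)) es" for x
  proof -
    have "real (size {#l \<in># mset es. l \<le> x#}) = (\<Sum>e\<leftarrow>es. of_bool (e \<le> x))"
      by (induction es) auto
    thus ?thesis using A es(1,2) by (simp add: esd_def list_average_def)
  qed
  moreover have "list_average (\<lambda>y. 1 / (y + t)) es
       = mtrace (resolvent N t (1 / real p) {..<p} ?z) / real N" if "t > 0" for t
    using es(4)[OF that] es(2) by (simp add: list_average_def)
  ultimately show ?thesis using that es(3) by blast
qed

text \<open>
  The first Borel-Cantelli lemma for each tolerance \<open>1/(k + 1)\<close>.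
\<close>

lemma AE_tendsto_of_summable_tails:
  fixes X :: "nat \<Rightarrow> 'a \<Rightarrow> real"
  assumes M: "prob_space M" and X: "\<And>n. n \<ge> nmin \<Longrightarrow> X n \<in> borel_measurable M"
    and tail: "\<And>\<epsilon>. \<epsilon> > 0 \<Longrightarrow> \<exists>b. summable b \<and>
       (\<forall>\<^sub>F n in sequentially. measure M {\<omega> \<in> space M. \<bar>X n \<omega> - c n\<bar> \<ge> \<epsilon>} \<le> b n)"
    and c: "c \<longlonglongrightarrow> l"
  shows "AE \<omega> in M. (\<lambda>n. X n \<omega>) \<longlonglongrightarrow> l"
proof -
  interpret prob_space M by fact
  have ev: "AE \<omega> in M. \<forall>\<^sub>F n in sequentially. \<bar>X n \<omega> - c n\<bar> < \<epsilon>" if \<epsilon>: "\<epsilon> > 0" for \<epsilon>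
  proof -
    define A where "A n = (if n \<ge> nmin then {\<omega> \<in> space M. \<bar>X n \<omega> - c n\<bar> \<ge> \<epsilon>} else {})" for n
    have A: "A n \<in> sets M" for n
    proof (cases "n \<ge> nmin")
      case True
      note [measurable] = X[OF True]
      show ?thesis unfolding A_def by simp
    qed (simp add: A_def)
    obtain b where b: "summable b"
      "\<forall>\<^sub>F n in sequentially. measure M {\<omega> \<in> space M. \<bar>X n \<omega> - c n\<bar> \<ge> \<epsilon>} \<le> b n"
      using tail[OF \<epsilon>] by blast
    have "summable (\<lambda>n. measure M (A n))"
    proof (rule summable_comparison_test_ev[OF _ b(1)])
      show "\<forall>\<^sub>F n in sequentially. norm (measure M (A n)) \<le> b n"
        using b(2) eventually_ge_at_top[of nmin] by eventually_elim (simp add: A_def)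
    qed
    hence "AE \<omega> in M. \<forall>\<^sub>F n in sequentially. \<omega> \<in> space M - A n"
      by (intro borel_cantelli_AE1 A) (auto simp: emeasure_eq_measure)
    thus ?thesis
    proof eventually_elim
      case (elim \<omega>)
      thus ?case using eventually_ge_at_top[of nmin] by eventually_elim (auto simp: A_def)
    qed
  qed
  have "AE \<omega> in M. \<forall>k. \<forall>\<^sub>F n in sequentially. \<bar>X n \<omega> - c n\<bar> < inverse (real (Suc k))"
    unfolding AE_all_countable by (intro allI ev) simp
  thus ?thesis
  proof eventually_elim
    case (elim \<omega>)
    have "(\<lambda>n. X n \<omega> - c n) \<longlonglongrightarrow> 0"
    proof (rule tendstoI)
      fix \<epsilon> :: real assume "\<epsilon> > 0"
      then obtain k where k: "inverse (real (Suc k)) < \<epsilon>" using reals_Archimedean by blast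
      show "\<forall>\<^sub>F n in sequentially. dist (X n \<omega> - c n) 0 < \<epsilon>"
        using elim[rule_format, of k] by eventually_elim (use k in auto)
    qed
    from tendsto_add[OF this c] show ?case by simp
  qed
qed

lemma geometric_exp_summable:
  assumes "\<kappa> > 0"
  shows "summable (\<lambda>n. 2 * exp (- (\<kappa> * real n)))"
proof -
  have "summable (\<lambda>n. 2 * exp (- \<kappa>) ^ n)"
    using assms by (intro summable_mult summable_geometric) simp
  thus ?thesis by (simp add: exp_of_nat_mult[symmetric] mult.commute)
qed

theorem theorem1:
  fixes d N p :: "nat \<Rightarrow> nat"
    and \<gamma> :: real
    and C :: "nat \<Rightarrow> real"
    and P :: "nat \<Rightarrow> 'b measure"
    and x :: "nat \<Rightarrow> nat \<Rightarrow> 'b \<Rightarrow> real"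
    and e :: "nat \<Rightarrow> nat \<Rightarrow> nat list"
    and M :: "'a measure"
    and Z :: "nat \<Rightarrow> 'a \<Rightarrow> real mat"
  assumes d: "\<And>n. n \<ge> 2 \<Longrightarrow> d n \<ge> 1 \<and> real (d n) < sqrt (real n)"
    and N: "\<And>n. n \<ge> 2 \<Longrightarrow> N n = n choose d n"
    and p: "\<And>n. n \<ge> 2 \<Longrightarrow> p n \<ge> 1"
    and \<gamma>: "\<gamma> > 0" "(\<lambda>n. real (N n) / real (p n)) \<longlonglongrightarrow> \<gamma>"
    \<comment> \<open>the entry distribution, and \<open>n\<close> i.i.d. copies of it\<close>
    and P: "\<And>n. n \<ge> 2 \<Longrightarrow> prob_space (P n)"
    and x_indep: "\<And>n. n \<ge> 2 \<Longrightarrow> prob_space.indep_vars (P n) (\<lambda>_. borel) (x n) {1..n}"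
    and x_ident: "\<And>n i. n \<ge> 2 \<Longrightarrow> i \<in> {1..n} \<Longrightarrow>
      distr (P n) borel (x n i) = distr (P n) borel (x n 1)"
    and x_symm: "\<And>n. n \<ge> 2 \<Longrightarrow>
      distr (P n) borel (x n 1) = distr (P n) borel (\<lambda>\<omega>. - x n 1 \<omega>)"
    and x_var: "\<And>n. n \<ge> 2 \<Longrightarrow> (\<integral>\<omega>. (x n 1 \<omega>)\<^sup>2 \<partial>P n) = 1"
    and C: "\<And>n. n \<ge> 2 \<Longrightarrow> C n \<ge> 2"
    and x_moments_finite: "\<And>n k. n \<ge> 2 \<Longrightarrow> k \<ge> 1 \<Longrightarrow> integrable (P n) (\<lambda>\<omega>. x n 1 \<omega> ^ (2 * k))"
    and x_moments: "\<And>n k. n \<ge> 2 \<Longrightarrow> k \<ge> 1 \<Longrightarrow>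
      (\<integral>\<omega>. x n 1 \<omega> ^ (2 * k) \<partial>P n) \<le> (C n * real k) ^ k"
    and C_lim: "(\<lambda>n. ln (C n) / ln (sqrt (real n) / real (d n))) \<longlonglongrightarrow> 0"
    \<comment> \<open>the fixed labelling of coordinates by index tuples\<close>
    and e: "\<And>n. n \<ge> 2 \<Longrightarrow> bij_betw (e n) {..<N n} (increasing_tuples n (d n))"
    \<comment> \<open>the random matrices, on a common probability space\<close>
    and M: "prob_space M"
    and Z_dim: "\<And>n \<omega>. n \<ge> 2 \<Longrightarrow> \<omega> \<in> space M \<Longrightarrow> Z n \<omega> \<in> carrier_mat (N n) (p n)"
    and Z_indep: "\<And>n. n \<ge> 2 \<Longrightarrow>
      prob_space.indep_vars M (\<lambda>_. PiM {..<N n} (\<lambda>_. borel))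
        (\<lambda>j \<omega>. col_fun (N n) (Z n \<omega>) j) {..<p n}"
    and Z_distr: "\<And>n j. n \<ge> 2 \<Longrightarrow> j < p n \<Longrightarrow>
      distr M (PiM {..<N n} (\<lambda>_. borel)) (\<lambda>\<omega>. col_fun (N n) (Z n \<omega>) j) =
      distr (P n) (PiM {..<N n} (\<lambda>_. borel)) (tensor_vector (N n) (e n) (x n))"
  shows "AE \<omega> in M.
    weak_conv (\<lambda>n. esd ((1 / real (p n)) \<cdot>\<^sub>m (Z n \<omega> * (Z n \<omega>)\<^sup>T))) (mp_cdf \<gamma>)"
proof -
  interpret prob_space M by (rule M)
  have ev2: "\<forall>\<^sub>F n in sequentially. n \<ge> (2::nat)" by (rule eventually_ge_at_top)
  define g where "g n = real (N n) / real (p n)" for n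
  define Q where "Q n = distr (P n) (PiM {..<N n} (\<lambda>_. borel)) (tensor_vector (N n) (e n) (x n))" for n
  define F where "F t n z = mtrace (resolvent (N n) t (1 / real (p n)) {..<p n} z) / real (N n)" for t n z
  define m where "m t n = (\<integral>z. F t n z \<partial>PiM {..<p n} (\<lambda>_. Q n))" for t n
  define cols where "cols n \<omega> = (\<lambda>j\<in>{..<p n}. col_fun (N n) (Z n \<omega>) j)" for n \<omega>
  \<comment> \<open>The bound \<open>(2 C)\<^sup>2\<close> for the fourth moment, the case \<open>k = 2\<close> of the moment hypothesis.\<close>
  define K where "K n = 4 * (C n)\<^sup>2" for n
  define \<eta> where "\<eta> n = exp (K n * real (d n) ^ 2 / real n) * (1 + 2 * real (d n) ^ 2 / real n) - 1" for n
  have g: "g \<longlonglongrightarrow> \<gamma>" using \<gamma>(2) by (simp add: g_def[abs_def])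

  have dn: "1 \<le> d n" "d n < n" "real n \<le> real (N n)" "N n \<ge> 1" if n: "n \<ge> 2" for n
  proof -
    show "1 \<le> d n" using d[OF n] by simp
    have "sqrt (real n) * 1 \<le> sqrt (real n) * sqrt (real n)"
      using n by (intro mult_left_mono) auto
    hence "sqrt (real n) \<le> real n" by simp
    thus "d n < n" using d[OF n] by linarith
    hence "n \<le> N n" using N[OF n] \<open>1 \<le> d n\<close> by (simp add: upper_le_binomial)
    thus "real n \<le> real (N n)" "N n \<ge> 1" using n by auto
  qed
  have gpos: "g n > 0" if "n \<ge> 2" for n
    using dn(4)[OF that] p[OF that] by (simp add: g_def)

  have Q: "prob_space (Q n)" "sets (Q n) = sets (PiM {..<N n} (\<lambda>_. borel))"
    and quad: "t > 0 \<Longrightarrow> (\<Sum>k<N n. \<Sum>l<N n. (B $$ (k, l))\<^sup>2) \<le> real (N n) / t\<^sup>2 \<Longrightarrow>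
      (\<integral>\<^sup>+y. ennreal \<bar>qform (N n) B y / real (p n) - (\<Sum>k<N n. B $$ (k, k)) / real (p n)\<bar> \<partial>Q n)
        \<le> ennreal (g n * sqrt (\<eta> n) / t)" if n: "n \<ge> 2" for n t B
  proof -
    have i4: "integrable (P n) (\<lambda>\<omega>. x n 1 \<omega> ^ 4)" using x_moments_finite[OF n, of 2] by simp
    have m4: "(\<integral>\<omega>. x n 1 \<omega> ^ 4 \<partial>P n) \<le> K n"
      using x_moments[OF n, of 2] by (simp add: K_def power_mult_distrib)
    have n1: "n \<ge> 1" and dle: "d n \<le> n" using n dn(2)[OF n] by auto
    note T = tensor_law_quadratic_form[OF P[OF n] n1 dle x_indep[OF n] x_ident[OF n] x_symm[OF n] x_var[OF n] i4 m4 e[OF n],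
        folded Q_def]
    show "prob_space (Q n)" "sets (Q n) = sets (PiM {..<N n} (\<lambda>_. borel))"
      using T(1,2)[of 1 1] by auto
    show "(\<integral>\<^sup>+y. ennreal \<bar>qform (N n) B y / real (p n) - (\<Sum>k<N n. B $$ (k, k)) / real (p n)\<bar> \<partial>Q n)
        \<le> ennreal (g n * sqrt (\<eta> n) / t)"
      if "t > 0" "(\<Sum>k<N n. \<Sum>l<N n. (B $$ (k, l))\<^sup>2) \<le> real (N n) / t\<^sup>2"
      unfolding g_def \<eta>_def by (rule T(3)) (use that p[OF n] in auto)
  qed

  have \<eta>0: "\<eta> n \<ge> 0" if n: "n \<ge> 2" for n
  proof -
    have "1 * 1 \<le> exp (K n * real (d n) ^ 2 / real n) * (1 + 2 * real (d n) ^ 2 / real n)"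
      by (intro mult_mono) (auto simp: K_def)
    thus ?thesis by (simp add: \<eta>_def)
  qed
  have \<eta>: "\<eta> \<longlonglongrightarrow> 0"
  proof -
    \<comment> \<open>With \<open>v = (C d/sqrt n)\<^sup>2\<close>, both \<open>K d\<^sup>2/n = 4 v\<close> and \<open>d\<^sup>2/n \<le> v\<close> tend to \<open>0\<close>.\<close>
    let ?r = "\<lambda>n. sqrt (real n) / real (d n)"
    define v where "v n = (C n / ?r n)\<^sup>2" for n
    have "(\<lambda>n. C n / ?r n) \<longlonglongrightarrow> 0"
    proof (rule log_ratio_growth[OF _ _ C_lim])
      show "\<forall>\<^sub>F n in sequentially. 2 \<le> C n" using ev2 by eventually_elim (rule C)
      show "\<forall>\<^sub>F n in sequentially. 1 < ?r n"
        using ev2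
      proof eventually_elim
        case (elim n)
        have "0 < real (d n)" "real (d n) < sqrt (real n)" using d[OF elim] by auto
        thus ?case by (simp add: less_divide_eq)
      qed
    qed
    hence v: "v \<longlonglongrightarrow> 0" unfolding v_def[abs_def] using tendsto_power[of _ 0 sequentially 2] by fastforce
    have up: "(\<lambda>n. exp (4 * v n) * (1 + 2 * v n) - 1) \<longlonglongrightarrow> exp (4 * 0) * (1 + 2 * 0) - 1"
      by (intro tendsto_intros v)
    show ?thesis
    proof (rule tendsto_sandwich[OF _ _ tendsto_const])
      show "(\<lambda>n. exp (4 * v n) * (1 + 2 * v n) - 1) \<longlonglongrightarrow> 0" using up by simp
      show "\<forall>\<^sub>F n in sequentially. 0 \<le> \<eta> n" using ev2 by eventually_elim (rule \<eta>0)
      show "\<forall>\<^sub>F n in sequentially. \<eta> n \<le> exp (4 * v n) * (1 + 2 * v n) - 1"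
        using ev2
      proof eventually_elim
        case (elim n)
        have vn: "v n = (C n)\<^sup>2 * (real (d n) ^ 2 / real n)"
          using elim by (simp add: v_def power_divide power_mult_distrib)
        have K: "K n * real (d n) ^ 2 / real n = 4 * v n" by (simp add: vn K_def)
        have "1 * (real (d n) ^ 2 / real n) \<le> (C n)\<^sup>2 * (real (d n) ^ 2 / real n)"
          using C[OF elim] by (intro mult_right_mono) (auto simp: one_le_power)
        hence "2 * real (d n) ^ 2 / real n \<le> 2 * v n" by (simp add: vn)
        thus ?case unfolding \<eta>_def K by (intro diff_right_mono mult_left_mono) auto
      qed
    qed
  qed

  have cols_law: "cols n \<in> measurable M (PiM {..<p n} (\<lambda>_. PiM {..<N n} (\<lambda>_. borel)))"
    "distr M (PiM {..<p n} (\<lambda>_. PiM {..<N n} (\<lambda>_. borel))) (cols n) = PiM {..<p n} (\<lambda>_. Q n)"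
    if n: "n \<ge> 2" for n
    unfolding cols_def[abs_def] Q_def
    using column_law[OF M p[OF n] Z_indep[OF n] Z_distr[OF n]] by auto
  have FQ: "F t n \<in> borel_measurable (PiM {..<p n} (\<lambda>_. Q n))"
    and FV: "F t n \<in> borel_measurable (PiM {..<p n} (\<lambda>_. PiM {..<N n} (\<lambda>_. borel)))"
    if "n \<ge> 2" "t > 0" for n t
    unfolding F_def[abs_def] using Q(2)[OF that(1)] that(2)
    by (auto intro!: borel_measurable_divide resolvent_trace_measurable)
  have Fb: "0 \<le> F t n z \<and> F t n z \<le> 1 / t" if "n \<ge> 2" "t > 0" for n t z
    using resolvent_trace_bounds[of "{..<p n}" "1 / real (p n)" t "N n" z] that dn(4)[OF that(1)]
    by (simp add: F_def field_simps)
  have PMp: "prob_space (PiM {..<p n} (\<lambda>_. Q n))" if "n \<ge> 2" for n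
    using Q(1)[OF that] by (intro prob_space_PiM)
  \<comment> \<open>As \<open>N n \<ge> n\<close>, the exponent is at least \<open>n\<close> times a factor that tends to a positive limit.\<close>
  have conc: "measure (PiM {..<p n} (\<lambda>_. Q n)) {z \<in> space (PiM {..<p n} (\<lambda>_. Q n)). \<bar>F t n z - m t n\<bar> \<ge> \<epsilon>}
      \<le> 2 * exp (- (\<epsilon>\<^sup>2 * t\<^sup>2 / 2 * g n * real n))" if "n \<ge> 2" "t > 0" "\<epsilon> > 0" for n t \<epsilon>
  proof -
    have "\<epsilon>\<^sup>2 * t\<^sup>2 / 2 * g n * real n \<le> \<epsilon>\<^sup>2 * t\<^sup>2 / 2 * g n * real (N n)"
      using gpos[OF that(1)] dn(3)[OF that(1)] by (intro mult_left_mono) auto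
    also have "\<dots> = \<epsilon>\<^sup>2 * t\<^sup>2 * (real (N n))\<^sup>2 / (2 * real (p n))"
      by (simp add: g_def power2_eq_square)
    finally have "2 * exp (- (\<epsilon>\<^sup>2 * t\<^sup>2 * (real (N n))\<^sup>2 / (2 * real (p n)))) \<le> 2 * exp (- (\<epsilon>\<^sup>2 * t\<^sup>2 / 2 * g n * real n))"
      by simp
    with stieltjes_concentration[OF Q[OF that(1)] that(2) p[OF that(1)] dn(4)[OF that(1)] that(3)]
    show ?thesis unfolding m_def F_def[abs_def] by (rule order_trans)
  qed
  have rate: "\<forall>\<^sub>F n in sequentially. 2 * exp (- (\<epsilon>\<^sup>2 * t\<^sup>2 / 2 * g n * real n)) \<le> 2 * exp (- (\<epsilon>\<^sup>2 * t\<^sup>2 * \<gamma> / 4 * real n))"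
    for \<epsilon> t :: real
  proof -
    have "\<forall>\<^sub>F n in sequentially. g n > \<gamma> / 2" using g \<gamma>(1) by (intro order_tendstoD) auto
    thus ?thesis
    proof eventually_elim
      case (elim n)
      have "\<epsilon>\<^sup>2 * t\<^sup>2 / 2 * (\<gamma> / 2) * real n \<le> \<epsilon>\<^sup>2 * t\<^sup>2 / 2 * g n * real n"
        using elim by (intro mult_right_mono mult_left_mono) auto
      thus ?case by simp
    qed
  qed
  have sumb: "summable (\<lambda>n. 2 * exp (- (\<epsilon>\<^sup>2 * t\<^sup>2 * \<gamma> / 4 * real n)))" if "t > 0" "\<epsilon> > 0" for t \<epsilon>
    using that \<gamma>(1) by (intro geometric_exp_summable) simp

  define D where "D t n = (\<integral>z. \<bar>F t n z - m t n\<bar> \<partial>PiM {..<p n} (\<lambda>_. Q n))" for t n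
  have D: "D t \<longlonglongrightarrow> 0" if t: "t > 0" for t
  proof (rule tendstoI)
    fix \<epsilon> :: real assume \<epsilon>: "\<epsilon> > 0"
    let ?b = "\<lambda>n. 2 * exp (- ((\<epsilon> / 2)\<^sup>2 * t\<^sup>2 * \<gamma> / 4 * real n))"
    have "(\<lambda>n. 1 / t * ?b n) \<longlonglongrightarrow> 1 / t * 0"
      using sumb[OF t, of "\<epsilon> / 2"] \<epsilon> by (intro tendsto_mult_left summable_LIMSEQ_zero) simp
    hence "\<forall>\<^sub>F n in sequentially. 1 / t * ?b n < \<epsilon> / 2" using \<epsilon> by (intro order_tendstoD) auto
    with ev2 rate[of "\<epsilon> / 2" t] show "\<forall>\<^sub>F n in sequentially. dist (D t n) 0 < \<epsilon>"
    proof eventually_elim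
      case (elim n)
      have "D t n \<le> \<epsilon> / 2 + 1 / t * ?b n"
        unfolding D_def m_def
        by (rule abs_deviation_le_of_tail[OF PMp[OF elim(1)] FQ[OF elim(1) t] Fb[OF elim(1) t]])
           (use \<epsilon> order_trans[OF conc[OF elim(1) t, of "\<epsilon> / 2"] elim(2)] in \<open>auto simp: m_def\<close>)
      moreover have "D t n \<ge> 0" by (simp add: D_def)
      ultimately show ?case using elim(3) by (simp add: dist_real_def)
    qed
  qed
  have pinv: "(\<lambda>n. 1 / real (p n)) \<longlonglongrightarrow> 0"
  proof (rule tendsto_sandwich[OF _ _ tendsto_const])
    have "(\<lambda>n. g n * (1 / real n)) \<longlonglongrightarrow> \<gamma> * 0" by (intro tendsto_mult g lim_1_over_n)
    thus "(\<lambda>n. g n * (1 / real n)) \<longlonglongrightarrow> 0" by simp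
    show "\<forall>\<^sub>F n in sequentially. 1 / real (p n) \<le> g n * (1 / real n)"
      using ev2
    proof eventually_elim
      case (elim n)
      have "1 / real (p n) * 1 \<le> 1 / real (p n) * (real (N n) / real n)"
        using dn(3)[OF elim] elim by (intro mult_left_mono) auto
      thus ?case by (simp add: g_def)
    qed
  qed simp
  have mlim: "m t \<longlonglongrightarrow> mp_stieltjes \<gamma> t" if t: "t > 0" for t
  proof (rule approximate_root_converges[OF \<gamma>(1) t g])
    show "\<forall>\<^sub>F n in sequentially. 0 < g n" using ev2 by eventually_elim (rule gpos)
    show "\<forall>\<^sub>F n in sequentially. 0 \<le> m t n \<and> m t n \<le> 1 / t"
      using ev2
    proof eventually_elim
      case (elim n)
      interpret PM: prob_space "PiM {..<p n} (\<lambda>_. Q n)" by (rule PMp[OF elim])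
      have "integrable (PiM {..<p n} (\<lambda>_. Q n)) (F t n)"
        by (rule PM.integrable_const_bound[of _ "1 / t"]) (use Fb[OF elim t] FQ[OF elim t] in \<open>auto intro!: AE_I2\<close>)
      thus ?case unfolding m_def using Fb[OF elim t]
        by (auto intro!: integral_nonneg_AE AE_I2 PM.integral_le_const)
    qed
    let ?err = "\<lambda>n. g n * sqrt (\<eta> n) / t + 1 / (t * real (p n)) + g n * D t n"
    have "(\<lambda>n. g n * sqrt (\<eta> n) * (1 / t) + 1 / t * (1 / real (p n)) + g n * D t n)
        \<longlonglongrightarrow> \<gamma> * sqrt 0 * (1 / t) + 1 / t * 0 + \<gamma> * 0"
      by (intro tendsto_intros g \<eta> pinv D t)
    hence err: "?err \<longlonglongrightarrow> 0" by simp
    show "(\<lambda>n. g n * (1 - t * m t n) - g n * m t n / (1 + g n * m t n)) \<longlonglongrightarrow> 0"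
    proof (rule Lim_null_comparison[OF _ err])
      show "\<forall>\<^sub>F n in sequentially. norm (g n * (1 - t * m t n) - g n * m t n / (1 + g n * m t n)) \<le> ?err n"
        using ev2
      proof eventually_elim
        case (elim n)
        have \<delta>0: "0 \<le> g n * sqrt (\<eta> n) / t" using gpos[OF elim] \<eta>0[OF elim] t by simp
        show ?case
          unfolding real_norm_def D_def m_def F_def[abs_def] g_def
          by (rule expected_stieltjes_equation[OF Q[OF elim] t p[OF elim] dn(4)[OF elim] \<delta>0[unfolded g_def]
                quad[OF elim t, unfolded g_def]])
      qed
    qed
  qed

  have aslim: "AE \<omega> in M. (\<lambda>n. F t n (cols n \<omega>)) \<longlonglongrightarrow> mp_stieltjes \<gamma> t" if t: "t > 0" for t
  proof (rule AE_tendsto_of_summable_tails[OF M _ _ mlim[OF t], where nmin = 2])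
    show "(\<lambda>\<omega>. F t n (cols n \<omega>)) \<in> borel_measurable M" if "n \<ge> 2" for n
      by (rule measurable_compose[OF cols_law(1)[OF that] FV[OF that t]])
    fix \<epsilon> :: real assume \<epsilon>: "\<epsilon> > 0"
    have "\<forall>\<^sub>F n in sequentially. measure M {\<omega> \<in> space M. \<bar>F t n (cols n \<omega>) - m t n\<bar> \<ge> \<epsilon>}
        \<le> 2 * exp (- (\<epsilon>\<^sup>2 * t\<^sup>2 * \<gamma> / 4 * real n))"
      using ev2 rate[of \<epsilon> t]
    proof eventually_elim
      case (elim n)
      let ?V = "PiM {..<p n} (\<lambda>_. PiM {..<N n} (\<lambda>_. borel :: real measure))"
      let ?A = "{z \<in> space ?V. \<bar>F t n z - m t n\<bar> \<ge> \<epsilon>}"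
      note [measurable] = FV[OF elim(1) t] cols_law(1)[OF elim(1)]
      have sp: "space ?V = space (PiM {..<p n} (\<lambda>_. Q n))"
        using sets_eq_imp_space_eq[OF Q(2)[OF elim(1)]] by (simp add: space_PiM)
      have "measure M {\<omega> \<in> space M. \<bar>F t n (cols n \<omega>) - m t n\<bar> \<ge> \<epsilon>} = measure M (cols n -` ?A \<inter> space M)"
        using measurable_space[OF cols_law(1)[OF elim(1)]] by (intro arg_cong[where f = "measure M"]) auto
      also have "\<dots> = measure (distr M ?V (cols n)) ?A"
        by (rule measure_distr[symmetric]) measurable
      also have "\<dots> \<le> 2 * exp (- (\<epsilon>\<^sup>2 * t\<^sup>2 / 2 * g n * real n))"
        unfolding cols_law(2)[OF elim(1)] sp by (rule conc[OF elim(1) t \<epsilon>])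
      finally show ?case using elim(2) by linarith
    qed
    thus "\<exists>b. summable b \<and>
       (\<forall>\<^sub>F n in sequentially. measure M {\<omega> \<in> space M. \<bar>F t n (cols n \<omega>) - m t n\<bar> \<ge> \<epsilon>} \<le> b n)"
      using sumb[OF t \<epsilon>] by blast
  qed
  have "AE \<omega> in M. \<forall>k. (\<lambda>n. F (1 + inverse (real k)) n (cols n \<omega>)) \<longlonglongrightarrow> mp_stieltjes \<gamma> (1 + inverse (real k))"
    unfolding AE_all_countable by (intro allI aslim) (simp add: add_pos_nonneg)
  with AE_space show ?thesis
  proof eventually_elim
    case (elim \<omega>)
    have "\<exists>es. n \<ge> 2 \<longrightarrow> es \<noteq> [] \<and> (\<forall>e\<in>set es. e \<ge> 0) \<and>
       (\<forall>x. esd ((1 / real (p n)) \<cdot>\<^sub>m (Z n \<omega> * (Z n \<omega>)\<^sup>T)) x = list_average (\<lambda>y. of_bool (y \<le> x)) es) \<and>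
       (\<forall>t>0. list_average (\<lambda>y. 1 / (y + t)) es = F t n (cols n \<omega>))" for n
    proof (cases "n \<ge> 2")
      case True
      show ?thesis
        using esd_gram[OF Z_dim[OF True elim(1)] dn(4)[OF True]] unfolding F_def cols_def by metis
    qed simp
    then obtain es where es: "\<And>n. n \<ge> 2 \<Longrightarrow> es n \<noteq> [] \<and> (\<forall>e\<in>set (es n). e \<ge> 0)"
      "\<And>n x. n \<ge> 2 \<Longrightarrow> esd ((1 / real (p n)) \<cdot>\<^sub>m (Z n \<omega> * (Z n \<omega>)\<^sup>T)) x = list_average (\<lambda>y. of_bool (y \<le> x)) (es n)"
      "\<And>n t. n \<ge> 2 \<Longrightarrow> t > 0 \<Longrightarrow> list_average (\<lambda>y. 1 / (y + t)) (es n) = F t n (cols n \<omega>)"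
      by metis
    have ne: "\<forall>\<^sub>F n in sequentially. es n \<noteq> [] \<and> (\<forall>e\<in>set (es n). e \<ge> 0)"
      using ev2 by eventually_elim (rule es(1))
    have lim: "(\<lambda>n. list_average (\<lambda>y. 1 / (y + (1 + inverse (real k)))) (es n)) \<longlonglongrightarrow> mp_stieltjes \<gamma> (1 + inverse (real k))" for k
    proof (rule Lim_transform_eventually[OF elim(2)[rule_format, of k]])
      show "\<forall>\<^sub>F n in sequentially. F (1 + inverse (real k)) n (cols n \<omega>)
          = list_average (\<lambda>y. 1 / (y + (1 + inverse (real k)))) (es n)"
        using ev2 by eventually_elim (simp add: es(3) add_pos_nonneg)
    qed
    show ?case
      unfolding weak_conv_def
    proof (intro allI impI)
      fix x assume "isCont (mp_cdf \<gamma>) x"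
      from stieltjes_convergence_imp_cdf_convergence[OF \<gamma>(1) ne lim this]
      show "(\<lambda>n. esd ((1 / real (p n)) \<cdot>\<^sub>m (Z n \<omega> * (Z n \<omega>)\<^sup>T)) x) \<longlonglongrightarrow> mp_cdf \<gamma> x"
      proof (rule Lim_transform_eventually)
        show "\<forall>\<^sub>F n in sequentially. list_average (\<lambda>y. of_bool (y \<le> x)) (es n)
            = esd ((1 / real (p n)) \<cdot>\<^sub>m (Z n \<omega> * (Z n \<omega>)\<^sup>T)) x"
          using ev2 by eventually_elim (simp add: es(2))
      qed
    qed
  qed
qed

end
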